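(* If a compactification $(\overline M,\overline f)$ of $(M,f)$ is locally semialgebraic, then both the set $\mathcal{C}$ and the set of (stratified) critical values of $\overline f|_{\partial\overline M}$ are finite. In particular, $(\overline M,\overline f)$ is a finite action compactification.
   Context: $\mathbb{R}^{n,m}=\mathbb{R}^{n-m}\times\mathbb{R}^m_{\ge0}$ with coordinates $(x,y)$. A manifold with corners is a Hausdorff second-countable space with an atlas of corner charts modelled on open subsets of $\mathbb{R}^{n,m}$, $0\le m\le n$, with smooth transition maps; it is stratified by depth, strata are smooth manifolds, the interior is the depth $0$ stratum and the boundary is the union of strata of depth $\ge1$. A boundary function is a smooth $\tau\colon\overline M\to[0,1]$, positive on the interior, such that every $p\in\partial\overline M$ has a corner chart centred at $p$ in which $\tau=\prod_{i=1}^my_i^{\alpha_i}$, $\alpha_i\in\mathbb{N}_{>0}$. A compactification $(\overline M,\overline f)$ of $(M,f)$, $f\colon M\to\mathbb{R}$ smooth, is a compact manifold with corners $\overline M$ with interior $M$ and a smooth $\overline f\colon\overline M\to\mathbb{R}$ such that $\overline f/f$ extends to a boundary function $\tau$ (so $\overline f=\tau f$ on $M$). Stratified critical values of $\overline f|_{\partial\overline M}$ are the critical values of the restrictions of $\overline f$ to the strata of $\partial\overline M$. Let $f_\varepsilon=f+\varepsilon/\tau\colon M\to\mathbb{R}$ and let $\mathcal{C}_\varepsilon$ be its set of critical values. $\mathcal{C}\subset\mathbb{R}$ is the set of limits of convergent sequences $(c_n)$ with $c_n\in\mathcal{C}_{\varepsilon_n}$ for some sequence $\varepsilon_n\to0$.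 The compactification is a finite action compactification if $\mathcal{C}$ is bounded and $0$ is either a regular value or an isolated critical value of $\overline f|_{\partial\overline M}$ in the stratified sense. A subset of $\mathbb{R}^N$ is semialgebraic if it is a finite union of sets defined by finitely many polynomial equations and strict polynomial inequalities; a function is semialgebraic if its graph is. A $C^k$ Nash function on a $C^k$ submanifold with corners $T\subset\mathbb{R}^N$ is a function $T\to\mathbb{R}$ that is both $C^k$ and semialgebraic. The compactification $(\overline M,\overline f)$ is locally semialgebraic if: (1) there is a finite open cover $\overline U_1,\dots,\overline U_l$ of $\overline M$ by $C^1$ submanifolds with corners; (2) for each $j$ there is a $C^1$ embedding $\phi_j\colon\overline U_j\hookrightarrow\mathbb{R}^{N_j}$ whose image is a semialgebraic $C^1$ submanifold with corners; (3) $\overline f\circ\phi_j^{-1}$ and $f\circ\phi_j^{-1}$ are $C^1$ Nash functions on $\phi_j(\overline U_j)$ and $\phi_j(\overline U_j\cap M)$, respectively. *)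

theory Defs
  imports "HOL-Analysis.Analysis"
begin

section \<open>Differentiable functions on subsets of Euclidean spaces\<close>

text \<open>
  The space of real \<open>n\<close>-tuples is \<^const>\<open>Euclidean_space\<close>~\<open>n\<close>: the functions from \<open>nat\<close> to \<open>real\<close>
  vanishing at all indices \<open>\<ge> n\<close>.  Coordinates are thus numbered \<open>0, \<dots>, n - 1\<close>, and \<open>n = 0\<close> is
  allowed.
\<close>

type_synonym point = "nat \<Rightarrow> real"

text \<open>
  The \<open>i\<close>-th partial derivative at \<open>x\<close> of a function defined on \<open>V\<close>.  It is two-sided if \<open>V\<close>
  contains a segment in direction \<open>i\<close> around \<open>x\<close>, and one-sided at a boundary point of a half-space.
\<close>

definition has_partial_derivative ::
    "(point \<Rightarrow> real) \<Rightarrow> nat \<Rightarrow> real \<Rightarrow> point \<Rightarrow> point set \<Rightarrow> bool" where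
  "has_partial_derivative g i d x V \<longleftrightarrow>
     ((\<lambda>t. g (x(i := t))) has_real_derivative d) (at (x i) within {t. x(i := t) \<in> V})"

primrec C_diff_open :: "nat \<Rightarrow> nat \<Rightarrow> point set \<Rightarrow> (point \<Rightarrow> real) \<Rightarrow> bool" where
  "C_diff_open 0 n W g \<longleftrightarrow>
     continuous_map (subtopology (Euclidean_space n) W) euclideanreal g"
| "C_diff_open (Suc k) n W g \<longleftrightarrow>
     continuous_map (subtopology (Euclidean_space n) W) euclideanreal g \<and>
     (\<forall>i<n. \<exists>g'. (\<forall>x\<in>W. has_partial_derivative g i (g' x) x W) \<and> C_diff_open k n W g')"

text \<open>
  Class \<open>C\<^sup>k\<close>, \<open>k \<le> \<infinity>\<close>, on an arbitrary subset \<open>S\<close> of real \<open>n\<close>-space: near every point of \<open>S\<close>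
  the function extends to a \<open>C\<^sup>k\<close> function on an open set.
\<close>

definition C_diff_on :: "enat \<Rightarrow> nat \<Rightarrow> point set \<Rightarrow> (point \<Rightarrow> real) \<Rightarrow> bool" where
  "C_diff_on k n S g \<longleftrightarrow>
     (\<forall>p\<in>S. \<exists>W h. openin (Euclidean_space n) W \<and> p \<in> W \<and>
        (\<forall>j. enat j \<le> k \<longrightarrow> C_diff_open j n W h) \<and> (\<forall>x\<in>W \<inter> S. h x = g x))"

definition C_diff_map_on :: "enat \<Rightarrow> nat \<Rightarrow> nat \<Rightarrow> point set \<Rightarrow> (point \<Rightarrow> point) \<Rightarrow> bool" where
  "C_diff_map_on k n N S G \<longleftrightarrow> (\<forall>j<N. C_diff_on k n S (\<lambda>x. G x j))"

section \<open>Manifolds with corners\<close>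

text \<open>
  The model space: the first \<open>n - m\<close> coordinates are the free ones (\<open>x\<close>), the last \<open>m\<close> are the
  nonnegative ones (\<open>y\<close>).
\<close>

definition corner_space :: "nat \<Rightarrow> nat \<Rightarrow> point set" where
  "corner_space n m =
     {z \<in> topspace (Euclidean_space n). \<forall>i\<in>{n - m..<n}. 0 \<le> z i}"

text \<open>A chart \<open>(U, m, \<phi>)\<close> consists of its domain, the number of \<open>y\<close>-coordinates and the coordinate map.\<close>

type_synonym 'a chart = "'a set \<times> nat \<times> ('a \<Rightarrow> point)"

definition corner_chart :: "nat \<Rightarrow> 'a topology \<Rightarrow> 'a chart \<Rightarrow> bool" where
  "corner_chart n X = (\<lambda>(U, m, \<phi>).
     m \<le> n \<and> openin X U \<and>
     openin (subtopology (Euclidean_space n) (corner_space n m)) (\<phi> ` U) \<and>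
     homeomorphic_map (subtopology X U) (subtopology (Euclidean_space n) (\<phi> ` U)) \<phi>)"

definition smooth_transition :: "nat \<Rightarrow> 'a chart \<Rightarrow> 'a chart \<Rightarrow> bool" where
  "smooth_transition n = (\<lambda>(U, m, \<phi>) (V, l, \<psi>).
     C_diff_map_on \<infinity> n n (\<phi> ` (U \<inter> V)) (\<lambda>x. \<psi> (inv_into U \<phi> x)))"

definition manifold_with_corners :: "nat \<Rightarrow> 'a topology \<Rightarrow> 'a chart set \<Rightarrow> bool" where
  "manifold_with_corners n X A \<longleftrightarrow>
     Hausdorff_space X \<and> second_countable X \<and>
     (\<forall>c\<in>A. corner_chart n X c) \<and>
     (\<Union>(U, m, \<phi>)\<in>A. U) = topspace X \<and>
     (\<forall>c\<in>A. \<forall>d\<in>A. smooth_transition n c d)"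

definition smooth_charts :: "nat \<Rightarrow> 'a topology \<Rightarrow> 'a chart set \<Rightarrow> 'a chart set" where
  "smooth_charts n X A =
     {c. corner_chart n X c \<and> (\<forall>d\<in>A. smooth_transition n c d \<and> smooth_transition n d c)}"

definition C_diff_mfd ::
    "enat \<Rightarrow> nat \<Rightarrow> 'a chart set \<Rightarrow> 'a set \<Rightarrow> ('a \<Rightarrow> real) \<Rightarrow> bool" where
  "C_diff_mfd k n A S g \<longleftrightarrow>
     (\<forall>(U, m, \<phi>)\<in>A. C_diff_on k n (\<phi> ` (U \<inter> S)) (\<lambda>x. g (inv_into U \<phi> x)))"

text \<open>The indices of the \<open>y\<close>-coordinates that vanish at \<open>z\<close>; their number is the depth of \<open>z\<close>.\<close>

definition vanishing :: "nat \<Rightarrow> nat \<Rightarrow> point \<Rightarrow> nat set" where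
  "vanishing n m z = {i \<in> {n - m..<n}. z i = 0}"

definition stratum :: "nat \<Rightarrow> 'a chart set \<Rightarrow> nat \<Rightarrow> 'a set" where
  "stratum n A k = {p. \<exists>(U, m, \<phi>)\<in>A. p \<in> U \<and> card (vanishing n m (\<phi> p)) = k}"

abbreviation mfd_interior :: "nat \<Rightarrow> 'a chart set \<Rightarrow> 'a set" where
  "mfd_interior n A \<equiv> stratum n A 0"

definition mfd_boundary :: "nat \<Rightarrow> 'a chart set \<Rightarrow> 'a set" where
  "mfd_boundary n A = (\<Union>k\<in>{1..}. stratum n A k)"

section \<open>Critical values\<close>

text \<open>
  In a chart around a point \<open>p\<close> of depth \<open>k\<close>, the stratum of depth \<open>k\<close> is the set where the
  coordinates \<open>i \<in> vanishing n m (\<phi> p)\<close> are \<open>0\<close>.  The remaining coordinates are local coordinates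
  of the stratum as a manifold without boundary (of dimension \<open>n - k\<close>), and \<open>p\<close> is critical for the
  restriction of \<open>g\<close> to the stratum iff all its partial derivatives in these coordinates vanish.
  On a stratum of dimension \<open>0\<close> every point is critical.
\<close>

definition critical_points :: "nat \<Rightarrow> 'a chart set \<Rightarrow> nat \<Rightarrow> ('a \<Rightarrow> real) \<Rightarrow> 'a set" where
  "critical_points n A k g =
     {p \<in> stratum n A k. \<exists>(U, m, \<phi>)\<in>A. p \<in> U \<and>
        (\<forall>i\<in>{..<n} - vanishing n m (\<phi> p).
           has_partial_derivative (\<lambda>x. g (inv_into U \<phi> x)) i 0 (\<phi> p)
             (\<phi> ` (U \<inter> stratum n A k)))}"

definition critical_values :: "nat \<Rightarrow> 'a chart set \<Rightarrow> nat \<Rightarrow> ('a \<Rightarrow> real) \<Rightarrow> real set" where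
  "critical_values n A k g = g ` critical_points n A k g"

definition boundary_critical_values :: "nat \<Rightarrow> 'a chart set \<Rightarrow> ('a \<Rightarrow> real) \<Rightarrow> real set" where
  "boundary_critical_values n A g = (\<Union>k\<in>{1..}. critical_values n A k g)"

section \<open>Compactifications\<close>

definition boundary_function ::
    "nat \<Rightarrow> 'a topology \<Rightarrow> 'a chart set \<Rightarrow> ('a \<Rightarrow> real) \<Rightarrow> bool" where
  "boundary_function n X A \<tau> \<longleftrightarrow>
     C_diff_mfd \<infinity> n A (topspace X) \<tau> \<and>
     \<tau> ` topspace X \<subseteq> {0..1} \<and>
     (\<forall>p\<in>mfd_interior n A. 0 < \<tau> p) \<and>
     (\<forall>p\<in>mfd_boundary n A. \<exists>(U, m, \<phi>)\<in>smooth_charts n X A.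
        p \<in> U \<and> \<phi> p = (\<lambda>_. 0) \<and>
        (\<exists>\<alpha>::nat \<Rightarrow> nat. (\<forall>i\<in>{n - m..<n}. 0 < \<alpha> i) \<and>
             (\<forall>q\<in>U. \<tau> q = (\<Prod>i\<in>{n - m..<n}. \<phi> q i ^ \<alpha> i))))"

text \<open>
  \<open>(X, A)\<close> is the manifold with corners and \<open>M\<close> its interior with the induced smooth structure;
  \<open>f\<close> is only relevant on \<open>M\<close>.  The boundary function \<open>\<tau>\<close> is kept as an argument, because the
  functions \<open>f + \<epsilon> / \<tau>\<close> depend on it and it is not determined by \<open>f\<close> and \<open>fbar\<close> where \<open>f\<close>
  vanishes identically.
\<close>

definition compactification ::
    "nat \<Rightarrow> 'a topology \<Rightarrow> 'a chart set \<Rightarrow> ('a \<Rightarrow> real) \<Rightarrow> ('a \<Rightarrow> real) \<Rightarrow> ('a \<Rightarrow> real) \<Rightarrow> bool" where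
  "compactification n X A f fbar \<tau> \<longleftrightarrow>
     manifold_with_corners n X A \<and> compact_space X \<and>
     C_diff_mfd \<infinity> n A (mfd_interior n A) f \<and>
     C_diff_mfd \<infinity> n A (topspace X) fbar \<and>
     boundary_function n X A \<tau> \<and>
     (\<forall>p\<in>mfd_interior n A. fbar p = \<tau> p * f p)"

definition perturbed_critical_values ::
    "nat \<Rightarrow> 'a chart set \<Rightarrow> ('a \<Rightarrow> real) \<Rightarrow> ('a \<Rightarrow> real) \<Rightarrow> real \<Rightarrow> real set" where
  "perturbed_critical_values n A f \<tau> \<epsilon> = critical_values n A 0 (\<lambda>p. f p + \<epsilon> / \<tau> p)"

definition limit_critical_values ::
    "nat \<Rightarrow> 'a chart set \<Rightarrow> ('a \<Rightarrow> real) \<Rightarrow> ('a \<Rightarrow> real) \<Rightarrow> real set" where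
  "limit_critical_values n A f \<tau> =
     {c. \<exists>\<epsilon> cs. \<epsilon> \<longlonglongrightarrow> 0 \<and> (\<forall>j::nat. cs j \<in> perturbed_critical_values n A f \<tau> (\<epsilon> j)) \<and>
          cs \<longlonglongrightarrow> c}"

definition finite_action_compactification ::
    "nat \<Rightarrow> 'a topology \<Rightarrow> 'a chart set \<Rightarrow> ('a \<Rightarrow> real) \<Rightarrow> ('a \<Rightarrow> real) \<Rightarrow> ('a \<Rightarrow> real) \<Rightarrow> bool" where
  "finite_action_compactification n X A f fbar \<tau> \<longleftrightarrow>
     compactification n X A f fbar \<tau> \<and>
     bounded (limit_critical_values n A f \<tau>) \<and>
     (0 \<notin> boundary_critical_values n A fbar \<or>
      0 isolated_in boundary_critical_values n A fbar)"

section \<open>Semialgebraic sets and Nash functions\<close>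

inductive_set polynomial_functions :: "nat \<Rightarrow> (point \<Rightarrow> real) set" for N :: nat where
  const: "(\<lambda>_. c) \<in> polynomial_functions N"
| coord: "i < N \<Longrightarrow> (\<lambda>x. x i) \<in> polynomial_functions N"
| add: "p \<in> polynomial_functions N \<Longrightarrow> q \<in> polynomial_functions N \<Longrightarrow>
          (\<lambda>x. p x + q x) \<in> polynomial_functions N"
| mult: "p \<in> polynomial_functions N \<Longrightarrow> q \<in> polynomial_functions N \<Longrightarrow>
          (\<lambda>x. p x * q x) \<in> polynomial_functions N"

definition basic_semialgebraic :: "nat \<Rightarrow> point set \<Rightarrow> bool" where
  "basic_semialgebraic N S \<longleftrightarrow>
     (\<exists>P Q. finite P \<and> finite Q \<and>
        P \<subseteq> polynomial_functions N \<and> Q \<subseteq> polynomial_functions N \<and>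
        S = {x \<in> topspace (Euclidean_space N). (\<forall>p\<in>P. p x = 0) \<and> (\<forall>q\<in>Q. 0 < q x)})"

definition semialgebraic :: "nat \<Rightarrow> point set \<Rightarrow> bool" where
  "semialgebraic N S \<longleftrightarrow>
     (\<exists>F. finite F \<and> (\<forall>B\<in>F. basic_semialgebraic N B) \<and> S = \<Union>F)"

text \<open>The value \<open>g x\<close> is stored in the additional last coordinate, of index \<open>N\<close>.\<close>

definition graph_on :: "nat \<Rightarrow> point set \<Rightarrow> (point \<Rightarrow> real) \<Rightarrow> point set" where
  "graph_on N T g = (\<lambda>x. x(N := g x)) ` T"

definition semialgebraic_function :: "nat \<Rightarrow> point set \<Rightarrow> (point \<Rightarrow> real) \<Rightarrow> bool" where
  "semialgebraic_function N T g \<longleftrightarrow> semialgebraic (Suc N) (graph_on N T g)"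

definition nash_function :: "enat \<Rightarrow> nat \<Rightarrow> point set \<Rightarrow> (point \<Rightarrow> real) \<Rightarrow> bool" where
  "nash_function k N T g \<longleftrightarrow> C_diff_on k N T g \<and> semialgebraic_function N T g"

text \<open>
  A \<open>d\<close>-dimensional \<open>C\<^sup>k\<close> submanifold with corners of real \<open>N\<close>-space: locally, a \<open>C\<^sup>k\<close>
  diffeomorphism of the ambient space takes \<open>T\<close> to a corner space, included by zero in the last
  \<open>N - d\<close> coordinates.
\<close>

definition submanifold_with_corners :: "enat \<Rightarrow> nat \<Rightarrow> nat \<Rightarrow> point set \<Rightarrow> bool" where
  "submanifold_with_corners k d N T \<longleftrightarrow>
     T \<subseteq> topspace (Euclidean_space N) \<and>
     (\<forall>p\<in>T. \<exists>W W' \<Phi> \<Psi> m.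
        d \<le> N \<and> m \<le> d \<and> p \<in> W \<and>
        openin (Euclidean_space N) W \<and> openin (Euclidean_space N) W' \<and>
        \<Phi> ` W = W' \<and> \<Psi> ` W' = W \<and>
        (\<forall>x\<in>W. \<Psi> (\<Phi> x) = x) \<and> (\<forall>z\<in>W'. \<Phi> (\<Psi> z) = z) \<and>
        C_diff_map_on k N N W \<Phi> \<and> C_diff_map_on k N N W' \<Psi> \<and>
        \<Phi> ` (T \<inter> W) = corner_space d m \<inter> W')"

text \<open>
  A \<open>C\<^sup>1\<close> embedding of the open subset \<open>U\<close> of \<open>(X, A)\<close> into real \<open>N\<close>-space: a topological embedding
  that is \<open>C\<^sup>1\<close> and has an injective differential (the matrix \<open>J\<close> in a chart) at every point.
\<close>

definition C1_embedding ::
    "nat \<Rightarrow> 'a topology \<Rightarrow> 'a chart set \<Rightarrow> 'a set \<Rightarrow> nat \<Rightarrow> ('a \<Rightarrow> point) \<Rightarrow> bool" where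
  "C1_embedding n X A U N \<phi> \<longleftrightarrow>
     embedding_map (subtopology X U) (Euclidean_space N) \<phi> \<and>
     (\<forall>j<N. C_diff_mfd 1 n A U (\<lambda>p. \<phi> p j)) \<and>
     (\<forall>(V, m, \<psi>)\<in>A. \<forall>p\<in>U \<inter> V. \<exists>J :: nat \<Rightarrow> nat \<Rightarrow> real.
        (\<forall>j<N. \<forall>i<n.
           has_partial_derivative (\<lambda>x. \<phi> (inv_into V \<psi> x) j) i (J j i) (\<psi> p) (\<psi> ` (U \<inter> V))) \<and>
        (\<forall>v :: nat \<Rightarrow> real. (\<forall>j<N. (\<Sum>i<n. J j i * v i) = 0) \<longrightarrow> (\<forall>i<n. v i = 0)))"

text \<open>
  An open subset of a manifold with corners is itself a (\<open>C\<^sup>1\<close>) manifold with corners, so the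
  members of the cover are just open sets.
\<close>

definition locally_semialgebraic ::
    "nat \<Rightarrow> 'a topology \<Rightarrow> 'a chart set \<Rightarrow> ('a \<Rightarrow> real) \<Rightarrow> ('a \<Rightarrow> real) \<Rightarrow> bool" where
  "locally_semialgebraic n X A f fbar \<longleftrightarrow>
     (\<exists>\<U>. finite \<U> \<and> (\<forall>U\<in>\<U>. openin X U) \<and> \<Union>\<U> = topspace X \<and>
        (\<forall>U\<in>\<U>. \<exists>N \<phi>.
           C1_embedding n X A U N \<phi> \<and>
           semialgebraic N (\<phi> ` U) \<and>
           submanifold_with_corners 1 n N (\<phi> ` U) \<and>
           nash_function 1 N (\<phi> ` U) (\<lambda>x. fbar (inv_into U \<phi> x)) \<and>
           nash_function 1 N (\<phi> ` (U \<inter> mfd_interior n A)) (\<lambda>x. f (inv_into U \<phi> x))))"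

end

theory Submission
  imports Defs "HOL-Computational_Algebra.Polynomial"
begin

text \<open>
  The argument is a semialgebraic Sard theorem without derivatives.  Call a point \<open>p\<close> of a set
  critical for a function if, to first order, the function does not change along pairs \<open>q, q'\<close> that
  approach \<open>p\<close> from opposite directions.  On a manifold with corners only the directions tangent to
  the stratum of \<open>p\<close> can be approached in this way, so all stratified critical points are critical in
  this sense; and the condition is a first-order formula, hence semialgebraic by quantifier
  elimination.  If the critical values were infinite in number, they would contain an interval, and
  definable choice would give a semialgebraic curve \<open>\<gamma>\<close> of critical points on which the function takes
  the value \<open>t\<close> at \<open>\<gamma> t\<close>.  Such a curve is differentiable off a countable set, and the pairs
  \<open>\<gamma> (t + h)\<close>, \<open>\<gamma> (t - h)\<close> contradict criticality.

  For the limit values, \<open>f + \<epsilon> / \<tau>\<close> is a pencil of functions on the graph of \<open>(f, 1 / \<tau>)\<close>, which is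
  semialgebraic over the closure of \<open>f \<noteq> 0\<close> because \<open>\<tau> = fbar / f\<close> there.  A semialgebraic subset of the
  \<open>(\<epsilon>, c)\<close>-plane with finite fibres over every \<open>\<epsilon>\<close> has finitely many limit points over \<open>\<epsilon> = 0\<close>.
  Where \<open>f\<close> vanishes identically, nothing is known about \<open>\<tau>\<close>, but critical points are critical for \<open>\<tau>\<close>
  itself; these stay away from the boundary, so they only contribute the limit value \<open>0\<close>.
\<close>

section \<open>Cauchy index and Tarski queries\<close>

text \<open>In the coordinates that are semialgebraic the functions are only known to be C^1, and
  Sard's theorem fails for C^1 functions of several variables; finiteness has to come from
  semialgebraicity. Moreover the charts and the boundary strata are not given by semialgebraic data,
  only the image of each cover set and the values of \<open>f\<close> and \<open>fbar\<close> on it.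
  Criticality must therefore be phrased through points of the image alone, and this is what the
  pairs achieve: they detect tangential directions without naming a stratum. Quantifier elimination
  counts real roots by Cauchy indices because the Euclidean algorithm, unlike the roots themselves,
  depends on the parameters through finitely many sign conditions. Cell decompositions and
  continuity of the chosen curves are avoided altogether. Their substitute is that a semialgebraic
  subset of the line has a finite frontier: an uncountable one contains an interval, so any
  undesirable behaviour that cannot persist on an interval is confined to countably many
  points.\<close>

text \<open>Half the jump of \<open>sgn\<close> of the values of \<open>u\<close> at
  \<open>x\<close>: a nonzero \<open>u\<close> changes sign at \<open>x\<close> exactly if its order
  there is odd, and the cofactor has the sign of \<open>u\<close> to the right of
  \<open>x\<close>.\<close>

definition sign_jump :: "real poly \<Rightarrow> real \<Rightarrow> real" where
  "sign_jump u x =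
     (if odd (order x u) then sgn (poly (u div [:- x, 1:] ^ order x u) x) else 0)"

lemma order_factored:
  fixes x :: real
  assumes "poly v x \<noteq> 0"
  shows "order x ([:- x, 1:] ^ k * v) = k"
proof -
  have "v \<noteq> 0" using assms by auto
  then have "order x ([:- x, 1:] ^ k * v) = order x ([:- x, 1:] ^ k) + order x v"
    by (intro order_mult) simp
  also have "order x v = 0" using assms by (simp add: order_root)
  finally show ?thesis by (simp add: order_power_n_n)
qed

lemma sign_jump_factored:
  assumes "poly v x \<noteq> 0"
  shows "sign_jump ([:- x, 1:] ^ k * v) x = (if odd k then sgn (poly v x) else 0)"
  unfolding sign_jump_def order_factored[OF assms] by simp

lemma order_factorE:
  fixes x :: real
  assumes "p \<noteq> 0"
  obtains P where "p = [:- x, 1:] ^ order x p * P" "poly P x \<noteq> 0"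
proof -
  obtain P where "p = [:- x, 1:] ^ order x p * P" "\<not> [:- x, 1:] dvd P"
    using order_decomp[OF assms] by blast
  then show ?thesis using that by (auto simp: poly_eq_0_iff_dvd)
qed

lemma sign_jump_0 [simp]: "sign_jump 0 x = 0"
  by (simp add: sign_jump_def)

section \<open>Poles of rational functions and the Cauchy index\<close>

text \<open>Half the sign jump of the rational function \<open>r / p\<close> at a pole. Off its
  zeros and poles, \<open>r / p\<close> has the sign of \<open>p * r\<close>; the comparison of
  orders says that \<open>x\<close> is a pole.\<close>

definition pole_jump :: "real poly \<Rightarrow> real poly \<Rightarrow> real \<Rightarrow> real" where
  "pole_jump p r x = (if order x r < order x p then sign_jump (p * r) x else 0)"

text \<open>The Cauchy index of \<open>r / p\<close> over the whole line. For \<open>p = 0\<close>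
  the index set is infinite and the sum is 0 by convention.\<close>

definition cauchy_index :: "real poly \<Rightarrow> real poly \<Rightarrow> real" where
  "cauchy_index p r = (\<Sum>x | poly p x = 0. pole_jump p r x)"

lemma pole_jump_high_order:
  assumes "[:- x, 1:] ^ order x p dvd r"
  shows "pole_jump p r x = 0"
proof (cases "r = 0")
  case False
  then have "order x p \<le> order x r" using assms by (simp add: order_divides)
  then show ?thesis by (simp add: pole_jump_def)
qed (simp add: pole_jump_def)

lemma pole_jump_factored:
  assumes "poly P x \<noteq> 0" "poly R x \<noteq> 0" "b < a"
  shows "pole_jump ([:- x, 1:] ^ a * P) ([:- x, 1:] ^ b * R) x
    = (if odd (a + b) then sgn (poly P x * poly R x) else 0)"
proof -
  have eq: "[:- x, 1:] ^ a * P * ([:- x, 1:] ^ b * R) = [:- x, 1:] ^ (a + b) * (P * R)"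
    by (simp only: power_add mult_ac)
  have "poly (P * R) x \<noteq> 0" using assms by simp
  from sign_jump_factored[OF this, of "a + b"] show ?thesis
    unfolding pole_jump_def order_factored[OF assms(1)] order_factored[OF assms(2)] eq
    using assms(3) by simp
qed

text \<open>The new quotient is \<open>c * (r / p) + k\<close>. Adding a polynomial and scaling by
  \<open>c > 0\<close> changes neither the poles, nor their orders, nor the sign of the leading term
  at a pole.\<close>

lemma pole_jump_reduce:
  assumes "p \<noteq> 0" "c > 0"
  shows "pole_jump p (smult c r + k * p) x = pole_jump p r x"
proof -
  define a where "a = order x p"
  obtain P where P: "p = [:- x, 1:] ^ a * P" "poly P x \<noteq> 0"
    using order_factorE[OF assms(1)] unfolding a_def by metis
  show ?thesis
  proof (cases "[:- x, 1:] ^ a dvd r")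
    case True
    then have "[:- x, 1:] ^ a dvd smult c r + k * p"
      using P(1) by (simp add: dvd_smult dvd_add)
    then show ?thesis using True pole_jump_high_order unfolding a_def by metis
  next
    case False
    then have "r \<noteq> 0" by auto
    define b where "b = order x r"
    obtain R where R: "r = [:- x, 1:] ^ b * R" "poly R x \<noteq> 0"
      using order_factorE[OF \<open>r \<noteq> 0\<close>] unfolding b_def by metis
    have "b < a" using False \<open>r \<noteq> 0\<close> unfolding b_def by (simp add: order_divides)
    \<comment> \<open>The cofactor of the new numerator at \<open>x\<close>. Its second summand
      vanishes at \<open>x\<close> because \<open>b < a\<close>, so only \<open>c * R\<close>
      decides the sign.\<close>
    define R' where "R' = smult c R + k * [:- x, 1:] ^ (a - b) * P"
    have R': "smult c r + k * p = [:- x, 1:] ^ b * R'"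
    proof -
      have "[:- x, 1:] ^ a = [:- x, 1:] ^ b * [:- x, 1:] ^ (a - b)"
        using \<open>b < a\<close> by (simp flip: power_add)
      then have "k * p = [:- x, 1:] ^ b * (k * [:- x, 1:] ^ (a - b) * P)"
        using P(1) by (simp only: mult_ac)
      moreover have "smult c r = [:- x, 1:] ^ b * smult c R" using R(1) by simp
      ultimately show ?thesis by (simp add: R'_def distrib_left)
    qed
    have R'x: "poly R' x = c * poly R x" using \<open>b < a\<close> by (simp add: R'_def)
    then have "poly R' x \<noteq> 0" using R(2) assms(2) by simp
    show ?thesis
      unfolding R' unfolding P(1) R(1) pole_jump_factored[OF P(2) \<open>poly R' x \<noteq> 0\<close> \<open>b < a\<close>]
        pole_jump_factored[OF P(2) R(2) \<open>b < a\<close>]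
      using assms(2) by (simp add: R'x sgn_mult)
  qed
qed

lemma cauchy_index_reduce:
  assumes "p \<noteq> 0" "c > 0"
  shows "cauchy_index p (smult c r + k * p) = cauchy_index p r"
  unfolding cauchy_index_def pole_jump_reduce[OF assms] ..

section \<open>Signs at infinity and the total sign change\<close>

text \<open>The values eventually have the sign of the leading coefficient, and the intermediate
  value theorem forbids a sign change before that. A negative leading coefficient is handled by
  passing to \<open>- u\<close>.\<close>

lemma sgn_poly_no_root_right:
  fixes u :: "real poly"
  assumes "u \<noteq> 0" "\<And>x. x \<ge> a \<Longrightarrow> poly u x \<noteq> 0"
  shows "sgn (poly u a) = sgn (lead_coeff u)"
proof -
  have *: "poly v a > 0" if v: "lead_coeff v > 0" "\<And>x. x \<ge> a \<Longrightarrow> poly v x \<noteq> 0" for v :: "real poly"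
  proof (rule ccontr)
    assume "\<not> ?thesis"
    then have "poly v a < 0" using v(2)[of a] by force
    obtain n where n: "\<forall>x\<ge>n. poly v x \<ge> lead_coeff v" using poly_pinfty_gt_lc[OF v(1)] by blast
    have "poly v (max n (a + 1)) > 0" using n v(1) by (meson less_le_trans max.cobounded1)
    moreover have "a < max n (a + 1)" by simp
    ultimately obtain x where "x > a" "poly v x = 0"
      using poly_IVT_pos[of a "max n (a + 1)" v] \<open>poly v a < 0\<close> by blast
    then show False using v(2) by force
  qed
  show ?thesis
  proof (cases "lead_coeff u > 0")
    case True
    then show ?thesis using *[of u] assms(2) by simp
  next
    case False
    then have "lead_coeff (- u) > 0" using assms(1) by (simp add: not_less less_le)
    then have "poly (- u) a > 0" by (rule *) (use assms(2) in auto)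
    then show ?thesis using \<open>lead_coeff (- u) > 0\<close> by simp
  qed
qed

definition sgn_minfty :: "real poly \<Rightarrow> real" where
  "sgn_minfty u = sgn (lead_coeff u) * (-1) ^ degree u"

text \<open>Reflection \<open>x \<mapsto> - x\<close> turns this into the statement to the right;
  the leading coefficient acquires the factor \<open>(-1) ^ degree u\<close>.\<close>

lemma sgn_poly_no_root_left:
  fixes u :: "real poly"
  assumes "u \<noteq> 0" "\<And>x. x \<le> a \<Longrightarrow> poly u x \<noteq> 0"
  shows "sgn (poly u a) = sgn_minfty u"
proof -
  define v where "v = pcompose u [:0, -1:]"
  have v0: "v \<noteq> 0" using assms(1) by (auto simp: v_def pcompose_eq_0_iff)
  have nz: "poly v x \<noteq> 0" if "x \<ge> - a" for x using assms(2)[of "- x"] that by (simp add: v_def poly_pcompose)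
  have "sgn (poly v (- a)) = sgn (lead_coeff v)"
    by (rule sgn_poly_no_root_right[OF v0]) (use nz in auto)
  moreover have "lead_coeff v = lead_coeff u * (-1) ^ degree u"
    unfolding v_def by (subst lead_coeff_comp) auto
  ultimately show ?thesis by (simp add: v_def poly_pcompose sgn_minfty_def sgn_mult power_sgn)
qed

text \<open>Each summand is half a jump of the sign, so twice the sum telescopes to the difference
  of the signs at the two ends of the line. The induction splits off the largest root.\<close>

lemma sum_sign_jump:
  assumes "u \<noteq> 0"
  shows "2 * (\<Sum>x | poly u x = 0. sign_jump u x) = sgn (lead_coeff u) - sgn_minfty u"
  using assms
proof (induction "card {x. poly u x = 0}" arbitrary: u rule: less_induct)
  case less
  let ?Z = "{x. poly u x = 0}"
  have fin: "finite ?Z" using less.prems poly_roots_finite by blast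
  show ?case
  proof (cases "?Z = {}")
    case True
    then have nr: "poly u x \<noteq> 0" for x by auto
    have "sgn (poly u 0) = sgn (lead_coeff u)" "sgn (poly u 0) = sgn_minfty u"
      using sgn_poly_no_root_right[OF less.prems nr] sgn_poly_no_root_left[OF less.prems nr] by auto
    then show ?thesis using True by simp
  next
    case False
    define a where "a = Max ?Z"
    have aZ: "poly u a = 0" using Max_in[OF fin False] by (simp add: a_def)
    have amax: "x \<le> a" if "poly u x = 0" for x using Max_ge[OF fin] that by (simp add: a_def)
    define k where "k = order a u"
    obtain v where v: "u = [:- a, 1:] ^ k * v" "poly v a \<noteq> 0"
      using order_factorE[OF less.prems] unfolding k_def by metis
    have k0: "k \<noteq> 0" using v aZ by (cases k) auto
    have v0: "v \<noteq> 0" using v by auto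
    have Zv: "{x. poly v x = 0} = ?Z - {a}" using v k0 by (auto simp: poly_power)
    have "card {x. poly v x = 0} < card ?Z"
      unfolding Zv using fin aZ by (intro psubset_card_mono) auto
    then have IH: "2 * (\<Sum>x | poly v x = 0. sign_jump v x) = sgn (lead_coeff v) - sgn_minfty v"
      using less.hyps v0 by blast
    \<comment> \<open>All roots of \<open>v\<close> lie to the left of \<open>a\<close>, where the
      removed factor has the constant sign \<open>(-1) ^ k\<close>.\<close>
    have jv: "sign_jump u x = (-1) ^ k * sign_jump v x" if "poly v x = 0" for x
    proof -
      have "x \<in> ?Z - {a}" using that Zv by blast
      then have xa: "x < a" using amax[of x] by auto
      define b where "b = order x v"
      obtain w where w: "v = [:- x, 1:] ^ b * w" "poly w x \<noteq> 0"
        using order_factorE[OF v0] unfolding b_def by metis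
      have u': "u = [:- x, 1:] ^ b * ([:- a, 1:] ^ k * w)"
        using v(1) unfolding w(1) by (simp only: mult_ac)
      have nz: "poly ([:- a, 1:] ^ k * w) x \<noteq> 0" using w(2) xa by (simp add: poly_power)
      have "sgn (poly ([:- a, 1:] ^ k * w) x) = (-1) ^ k * sgn (poly w x)"
        using xa by (simp add: poly_power sgn_mult power_sgn)
      then show ?thesis
        unfolding u' sign_jump_factored[OF nz] w(1) sign_jump_factored[OF w(2)] by simp
    qed
    have ja: "sign_jump u a = (if odd k then sgn (poly v a) else 0)"
      unfolding v(1) sign_jump_factored[OF v(2)] ..
    have sv: "sgn (poly v a) = sgn (lead_coeff v)"
    proof (rule sgn_poly_no_root_right[OF v0])
      fix x assume "x \<ge> a"
      then show "poly v x \<noteq> 0" using v(2) Zv amax[of x] by (cases "x = a") auto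
    qed
    have "(\<Sum>x\<in>?Z. sign_jump u x) = sign_jump u a + (\<Sum>x\<in>?Z - {a}. sign_jump u x)"
      using fin aZ by (intro sum.remove) auto
    also have "(\<Sum>x\<in>?Z - {a}. sign_jump u x) = (-1) ^ k * (\<Sum>x | poly v x = 0. sign_jump v x)"
      unfolding Zv[symmetric] sum_distrib_left by (intro sum.cong) (use jv in auto)
    finally have S: "2 * (\<Sum>x\<in>?Z. sign_jump u x) = 2 * sign_jump u a
        + (-1) ^ k * (sgn (lead_coeff v) - sgn_minfty v)"
      unfolding IH[symmetric] by simp
    have lc: "lead_coeff u = lead_coeff v"
      unfolding v(1) lead_coeff_mult lead_coeff_power by simp
    have deg: "degree u = k + degree v"
      unfolding v(1) using v0 by (subst degree_mult_eq) (auto simp: degree_power_eq)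
    have sm: "sgn_minfty u = (-1) ^ k * sgn_minfty v"
      unfolding sgn_minfty_def lc unfolding deg by (simp add: power_add)
    show ?thesis unfolding S sm ja sv lc by (cases "even k") auto
  qed
qed

text \<open>At each point at most one of \<open>r / p\<close> and \<open>p / r\<close> has a pole,
  and there it carries the sign jump of \<open>p * r\<close>. If neither has one, the orders agree,
  \<open>p * r\<close> has even order and does not jump. Hence the two indices add up to the total
  sign change of \<open>p * r\<close>.\<close>

lemma cauchy_index_swap:
  assumes "p \<noteq> 0" "r \<noteq> 0"
  shows "cauchy_index p r + cauchy_index r p = (sgn (lead_coeff (p * r)) - sgn_minfty (p * r)) / 2"
proof -
  let ?Z = "{x. poly (p * r) x = 0}"
  have pr: "p * r \<noteq> 0" using assms by simp
  have fin: "finite ?Z" using poly_roots_finite[OF pr] .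
  have "cauchy_index p r + cauchy_index r p = (\<Sum>x\<in>?Z. pole_jump p r x) + (\<Sum>x\<in>?Z. pole_jump r p x)"
    unfolding cauchy_index_def
    by (intro arg_cong2[where f = "(+)"] sum.mono_neutral_left)
      (use fin in \<open>auto simp: pole_jump_def order_root\<close>)
  also have "\<dots> = (\<Sum>x\<in>?Z. sign_jump (p * r) x)"
    unfolding sum.distrib[symmetric]
  proof (rule sum.cong[OF refl])
    fix x
    have "order x p = order x r \<Longrightarrow> sign_jump (p * r) x = 0"
      by (simp add: sign_jump_def order_mult[OF pr])
    then show "pole_jump p r x + pole_jump r p x = sign_jump (p * r) x"
      by (auto simp: pole_jump_def mult.commute)
  qed
  finally show ?thesis using sum_sign_jump[OF pr] by simp
qed

text \<open>The logarithmic derivative \<open>pderiv p / p\<close> has a simple pole with positive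
  residue, the multiplicity, at every root of \<open>p\<close>. Multiplied by \<open>q\<close>, it
  jumps in the direction of the sign of \<open>q\<close> there, and the pole disappears where
  \<open>q\<close> vanishes.\<close>

lemma tarski_query:
  assumes "p \<noteq> 0"
  shows "(\<Sum>x | poly p x = 0. sgn (poly q x)) = cauchy_index p (pderiv p * q)"
  unfolding cauchy_index_def
proof (rule sum.cong[OF refl])
  fix x assume "x \<in> {x. poly p x = 0}"
  then have px: "poly p x = 0" by simp
  define a where "a = order x p"
  obtain P where P: "p = [:- x, 1:] ^ a * P" "poly P x \<noteq> 0"
    using order_factorE[OF assms] unfolding a_def by metis
  obtain b where b: "a = Suc b" using px assms unfolding a_def order_root by (cases "order x p") auto
  \<comment> \<open>The cofactor of \<open>pderiv p\<close>; its value at \<open>x\<close> is the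
    multiplicity \<open>a\<close> times the cofactor of \<open>p\<close>, so the product of both has
    the sign of a square.\<close>
  define R where "R = smult (real a) P + [:- x, 1:] * pderiv P"
  have der: "pderiv p = [:- x, 1:] ^ b * R"
    unfolding P(1) R_def b pderiv_mult pderiv_power_Suc
    by (simp add: pderiv_pCons algebra_simps)
  have Rx: "poly R x = real a * poly P x" by (simp add: R_def)
  show "sgn (poly q x) = pole_jump p (pderiv p * q) x"
  proof (cases "poly q x = 0")
    case True
    then have "[:- x, 1:] dvd q" by (simp add: poly_eq_0_iff_dvd)
    then have "[:- x, 1:] ^ order x p dvd pderiv p * q"
      unfolding a_def[symmetric] b der power_Suc2 mult.assoc by (intro mult_dvd_mono) auto
    from pole_jump_high_order[OF this] True show ?thesis by simp
  next
    case False
    have e: "pderiv p * q = [:- x, 1:] ^ b * (R * q)" unfolding der by (simp only: mult_ac)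
    have nz: "poly (R * q) x \<noteq> 0" using False Rx P(2) b by simp
    have "real a * (poly P x * poly P x) > 0" using P(2) b by (simp add: zero_less_mult_iff) argo
    moreover have "poly P x * poly (R * q) x = (real a * (poly P x * poly P x)) * poly q x"
      using Rx by simp
    ultimately have "sgn (poly P x * poly (R * q) x) = sgn (poly q x)"
      by (metis sgn_mult sgn_pos mult_1)
    moreover have "b < a" using b by simp
    moreover have "odd (a + b)" using b by simp
    ultimately show ?thesis unfolding e unfolding P(1) pole_jump_factored[OF P(2) nz \<open>b < a\<close>] by simp
  qed
qed

section \<open>Quantifier elimination\<close>

text \<open>Formulas are embedded shallowly: a state of arbitrary type replaces the valuation, and
  \<open>V\<close> is the set of functions that read the variables from it. Substitution is then
  composition, and a quantifier adds a component to the state. Strict positivity suffices as the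
  only atom of \<open>semialg\<close>, since equations and weak inequalities are boolean
  combinations.\<close>

inductive_set polyfun :: "('s \<Rightarrow> real) set \<Rightarrow> ('s \<Rightarrow> real) set" for V :: "('s \<Rightarrow> real) set" where
  polyfun_const: "(\<lambda>_. c) \<in> polyfun V"
| polyfun_var: "v \<in> V \<Longrightarrow> v \<in> polyfun V"
| polyfun_add: "F \<in> polyfun V \<Longrightarrow> G \<in> polyfun V \<Longrightarrow> (\<lambda>s. F s + G s) \<in> polyfun V"
| polyfun_mult: "F \<in> polyfun V \<Longrightarrow> G \<in> polyfun V \<Longrightarrow> (\<lambda>s. F s * G s) \<in> polyfun V"

inductive semialg :: "('s \<Rightarrow> real) set \<Rightarrow> ('s \<Rightarrow> bool) \<Rightarrow> bool" for V :: "('s \<Rightarrow> real) set" where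
  semialg_pos: "F \<in> polyfun V \<Longrightarrow> semialg V (\<lambda>s. 0 < F s)"
| semialg_not: "semialg V P \<Longrightarrow> semialg V (\<lambda>s. \<not> P s)"
| semialg_conj: "semialg V P \<Longrightarrow> semialg V Q \<Longrightarrow> semialg V (\<lambda>s. P s \<and> Q s)"

lemma polyfun_uminus: "F \<in> polyfun V \<Longrightarrow> (\<lambda>s. - F s) \<in> polyfun V"
  using polyfun_mult[OF polyfun_const[of "-1"]] by simp

lemma polyfun_diff: "F \<in> polyfun V \<Longrightarrow> G \<in> polyfun V \<Longrightarrow> (\<lambda>s. F s - G s) \<in> polyfun V"
  using polyfun_add[OF _ polyfun_uminus] by simp

lemma polyfun_sum: "(\<And>i. i \<in> I \<Longrightarrow> F i \<in> polyfun V) \<Longrightarrow> (\<lambda>s. \<Sum>i\<in>I. F i s) \<in> polyfun V"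
  by (induction I rule: infinite_finite_induct) (auto intro: polyfun_const polyfun_add)

lemma polyfun_power: "F \<in> polyfun V \<Longrightarrow> (\<lambda>s. F s ^ k) \<in> polyfun V"
  by (induction k) (auto intro: polyfun_const polyfun_mult)

lemma semialg_disj: "semialg V P \<Longrightarrow> semialg V Q \<Longrightarrow> semialg V (\<lambda>s. P s \<or> Q s)"
  using semialg_not[OF semialg_conj[OF semialg_not semialg_not]] by simp

lemma semialg_imp: "semialg V P \<Longrightarrow> semialg V Q \<Longrightarrow> semialg V (\<lambda>s. P s \<longrightarrow> Q s)"
  unfolding imp_conv_disj by (rule semialg_disj[OF semialg_not])

lemma semialg_less: "F \<in> polyfun V \<Longrightarrow> G \<in> polyfun V \<Longrightarrow> semialg V (\<lambda>s. F s < G s)"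
  using semialg_pos[OF polyfun_diff] by simp

lemma semialg_le: "F \<in> polyfun V \<Longrightarrow> G \<in> polyfun V \<Longrightarrow> semialg V (\<lambda>s. F s \<le> G s)"
  using semialg_not[OF semialg_less] by (simp add: not_less)

lemma semialg_eq: "F \<in> polyfun V \<Longrightarrow> G \<in> polyfun V \<Longrightarrow> semialg V (\<lambda>s. F s = G s)"
  using semialg_conj[OF semialg_le semialg_le, of F V G G F] by (simp add: order_eq_iff)

lemma semialg_const: "semialg V (\<lambda>_. b)"
  using semialg_pos[OF polyfun_const[of 1]] semialg_pos[OF polyfun_const[of 0]] by (cases b) auto

lemma semialg_bex_finite:
  "finite I \<Longrightarrow> (\<And>i. i \<in> I \<Longrightarrow> semialg V (P i)) \<Longrightarrow> semialg V (\<lambda>s. \<exists>i\<in>I. P i s)"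
  by (induction I rule: finite_induct) (auto intro: semialg_const semialg_disj)

lemma semialg_ball_finite:
  assumes "finite I" "\<And>i. i \<in> I \<Longrightarrow> semialg V (P i)"
  shows "semialg V (\<lambda>s. \<forall>i\<in>I. P i s)"
  using semialg_not[OF semialg_bex_finite[OF assms(1) semialg_not], of V P] assms(2) by auto

lemma polyfun_comp:
  assumes "F \<in> polyfun V" "\<And>v. v \<in> V \<Longrightarrow> (\<lambda>t. v (g t)) \<in> polyfun V'"
  shows "(\<lambda>t. F (g t)) \<in> polyfun V'"
  using assms(1) by induction (auto intro: assms(2) polyfun.intros)

lemma semialg_comp:
  assumes "semialg V P" "\<And>v. v \<in> V \<Longrightarrow> (\<lambda>t. v (g t)) \<in> polyfun V'"
  shows "semialg V' (\<lambda>t. P (g t))"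
  using assms(1)
proof induction
  case (semialg_pos F)
  then show ?case by (intro semialg.semialg_pos polyfun_comp[OF _ assms(2)])
qed (auto intro: semialg.intros)

text \<open>The quantities met in root counting (signs, degrees, Cauchy indices) are piecewise
  constant in the parameters, with finitely many semialgebraic pieces. This class is closed under
  arbitrary functions of the values, which takes care of all arithmetic and case
  distinctions.\<close>

definition simple_on :: "('s \<Rightarrow> real) set \<Rightarrow> ('s \<Rightarrow> 'b) \<Rightarrow> bool" where
  "simple_on V F \<longleftrightarrow> finite (range F) \<and> (\<forall>v. semialg V (\<lambda>s. F s = v))"

lemma simple_on_const: "simple_on V (\<lambda>_. c)"
  by (simp add: simple_on_def semialg_const)

lemma simple_on_comp2:
  assumes "simple_on V F" "simple_on V G"
  shows "simple_on V (\<lambda>s. H (F s) (G s))"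
  unfolding simple_on_def
proof (intro conjI allI)
  have "range (\<lambda>s. H (F s) (G s)) \<subseteq> (\<lambda>(a, b). H a b) ` (range F \<times> range G)" by auto
  then show "finite (range (\<lambda>s. H (F s) (G s)))"
    using assms finite_subset unfolding simple_on_def by blast
  fix v
  have "semialg V (\<lambda>s. \<exists>a\<in>range F. \<exists>b\<in>range G. H a b = v \<and> F s = a \<and> G s = b)"
    using assms unfolding simple_on_def
    by (intro semialg_bex_finite semialg_conj semialg_const) auto
  moreover have "(\<lambda>s. \<exists>a\<in>range F. \<exists>b\<in>range G. H a b = v \<and> F s = a \<and> G s = b) = (\<lambda>s. H (F s) (G s) = v)"
    by (intro ext) (metis rangeI)
  ultimately show "semialg V (\<lambda>s. H (F s) (G s) = v)" by simp
qed

lemma simple_on_comp: "simple_on V F \<Longrightarrow> simple_on V (\<lambda>s. H (F s))"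
  by (rule simple_on_comp2[where H = "\<lambda>a _. H a" and G = F])

lemma semialg_iff_simple_on: "semialg V P \<longleftrightarrow> simple_on V P"
proof
  assume P: "semialg V P"
  have "semialg V (\<lambda>s. P s = v)" for v
    using P semialg_not[OF P] by (cases v) auto
  then show "simple_on V P" unfolding simple_on_def by simp
next
  assume "simple_on V P"
  then have "semialg V (\<lambda>s. P s = True)" unfolding simple_on_def by blast
  then show "semialg V P" by simp
qed

lemma simple_on_pred: "simple_on V F \<Longrightarrow> semialg V (\<lambda>s. Q (F s))"
  unfolding semialg_iff_simple_on by (rule simple_on_comp)

lemma simple_on_if:
  assumes "semialg V P" "simple_on V F" "simple_on V G"
  shows "simple_on V (\<lambda>s. if P s then F s else G s)"
  using simple_on_comp2[of V P "\<lambda>s. (F s, G s)" "\<lambda>p ab. if p then fst ab else snd ab"]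
    simple_on_comp2[OF assms(2,3), of Pair] assms(1)
  by (simp add: semialg_iff_simple_on cong: if_cong)

lemma simple_on_sgn:
  assumes "F \<in> polyfun V" shows "simple_on V (\<lambda>s. sgn (F s))"
proof -
  have "simple_on V (\<lambda>s. if F s < 0 then - 1 else if 0 < F s then 1 else (0::real))"
    by (intro simple_on_if semialg_less simple_on_const polyfun_const assms)
  moreover have "(\<lambda>s. if F s < 0 then - 1 else if 0 < F s then 1 else 0) = (\<lambda>s. sgn (F s))"
    by (auto simp: sgn_if)
  ultimately show ?thesis by simp
qed

section \<open>Univariate polynomials with parameters\<close>

text \<open>The number \<open>d\<close> is a formal strict bound for the degree. The actual degree
  may drop at particular parameters, so recursions run over \<open>d\<close> and branch on the
  vanishing of the formal leading coefficient.\<close>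

definition polyfam :: "('s \<Rightarrow> real) set \<Rightarrow> nat \<Rightarrow> ('s \<Rightarrow> real poly) \<Rightarrow> bool" where
  "polyfam V d P \<longleftrightarrow> (\<forall>i. (\<lambda>s. coeff (P s) i) \<in> polyfun V) \<and> (\<forall>s. \<forall>i\<ge>d. coeff (P s) i = 0)"

lemma polyfamI:
  "(\<And>i. (\<lambda>s. coeff (P s) i) \<in> polyfun V) \<Longrightarrow> (\<And>s i. i \<ge> d \<Longrightarrow> coeff (P s) i = 0) \<Longrightarrow> polyfam V d P"
  by (simp add: polyfam_def)

lemma polyfam_coeff: "polyfam V d P \<Longrightarrow> (\<lambda>s. coeff (P s) i) \<in> polyfun V"
  by (simp add: polyfam_def)

lemma polyfam_high: "polyfam V d P \<Longrightarrow> i \<ge> d \<Longrightarrow> coeff (P s) i = 0"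
  by (simp add: polyfam_def)

lemma polyfam_const: "F \<in> polyfun V \<Longrightarrow> polyfam V 1 (\<lambda>s. [:F s:])"
proof (rule polyfamI)
  show "(\<lambda>s. coeff [:F s:] i) \<in> polyfun V" if "F \<in> polyfun V" for i
    using that by (cases i) (simp_all add: polyfun_const)
  show "coeff [:F s:] i = 0" if "1 \<le> i" for s i
    using that by (cases i) simp_all
qed

lemma polyfam_add:
  "polyfam V d P \<Longrightarrow> polyfam V e Q \<Longrightarrow> polyfam V (max d e) (\<lambda>s. P s + Q s)"
  by (auto simp: polyfam_def intro: polyfun_add)

lemma polyfam_smult:
  "F \<in> polyfun V \<Longrightarrow> polyfam V d P \<Longrightarrow> polyfam V d (\<lambda>s. smult (F s) (P s))"
  by (auto simp: polyfam_def intro: polyfun_mult)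

lemma polyfam_mult:
  assumes "polyfam V d P" "polyfam V e Q"
  shows "polyfam V (d + e) (\<lambda>s. P s * Q s)"
proof (rule polyfamI)
  show "(\<lambda>s. coeff (P s * Q s) i) \<in> polyfun V" for i
    unfolding coeff_mult
    by (intro polyfun_sum polyfun_mult polyfam_coeff[OF assms(1)] polyfam_coeff[OF assms(2)])
  fix s i assume i: "d + e \<le> i"
  show "coeff (P s * Q s) i = 0" unfolding coeff_mult
  proof (intro sum.neutral ballI)
    fix j
    have "j \<ge> d \<or> i - j \<ge> e" using i by auto
    then show "coeff (P s) j * coeff (Q s) (i - j) = 0"
      using polyfam_high[OF assms(1)] polyfam_high[OF assms(2)] by auto
  qed
qed

lemma polyfam_monom: "F \<in> polyfun V \<Longrightarrow> polyfam V (Suc k) (\<lambda>s. monom (F s) k)"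
  by (rule polyfamI, case_tac "i = k") (simp_all add: polyfun_const)

lemma polyfam_pderiv:
  assumes "polyfam V d P" shows "polyfam V d (\<lambda>s. pderiv (P s))"
  using assms by (auto simp: polyfam_def coeff_pderiv intro!: polyfun_mult polyfun_const)

lemma polyfam_cutoff: "polyfam V d P \<Longrightarrow> polyfam V k (\<lambda>s. poly_cutoff k (P s))"
  by (rule polyfamI, case_tac "i < k") (auto simp: polyfam_def coeff_poly_cutoff intro: polyfun_const)

lemma polyfam_0: "polyfam V 0 P \<Longrightarrow> P s = 0"
  by (simp add: poly_eq_iff polyfam_high)

lemma polyfam_cutoff_eq: "polyfam V (Suc k) P \<Longrightarrow> coeff (P s) k = 0 \<Longrightarrow> poly_cutoff k (P s) = P s"
proof (rule poly_eqI)
  fix i assume a: "polyfam V (Suc k) P" "coeff (P s) k = 0"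
  show "coeff (poly_cutoff k (P s)) i = coeff (P s) i"
  proof (cases "i < k")
    case False
    then have "i = k \<or> Suc k \<le> i" by auto
    then show ?thesis using a(2) polyfam_high[OF a(1), of i s] False
      by (auto simp: coeff_poly_cutoff)
  qed (simp add: coeff_poly_cutoff)
qed

lemma polyfam_degree: "polyfam V (Suc k) P \<Longrightarrow> coeff (P s) k \<noteq> 0 \<Longrightarrow> degree (P s) = k"
  by (rule antisym[OF degree_le le_degree]) (simp_all add: polyfam_high)

text \<open>One step of a division by a polynomial of formal degree \<open>a\<close>; the square keeps the scaling
  factor positive, so that Cauchy indices are unchanged.\<close>

lemma polyfam_reduce:
  assumes P: "polyfam V (Suc a) P" and R: "polyfam V (Suc b) R" and ab: "a \<le> b"
  shows "polyfam V b (\<lambda>s. smult ((coeff (P s) a)\<^sup>2) (R s)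
    - monom (coeff (R s) b * coeff (P s) a) (b - a) * P s)" (is "polyfam V b ?F")
proof -
  have "polyfam V (Suc (b - a) + Suc a) (\<lambda>s. monom (coeff (R s) b * coeff (P s) a) (b - a) * P s)"
    by (intro polyfam_mult polyfam_monom polyfun_mult polyfam_coeff[OF R] polyfam_coeff[OF P] P)
  moreover have "polyfam V (Suc b) (\<lambda>s. smult ((coeff (P s) a)\<^sup>2) (R s))"
    by (intro polyfam_smult polyfun_power polyfam_coeff[OF P] R)
  ultimately have c: "(\<lambda>s. coeff (?F s) i) \<in> polyfun V" for i
    unfolding coeff_diff by (intro polyfun_diff polyfam_coeff)
  show ?thesis
  proof (rule polyfamI[OF c])
    fix s i assume i: "b \<le> i"
    show "coeff (?F s) i = 0"
    proof (cases "i = b")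
      case True
      then show ?thesis using ab by (simp add: coeff_monom_mult power2_eq_square)
    next
      case False
      then have "i \<ge> Suc b" "i - (b - a) \<ge> Suc a" using i ab by auto
      then show ?thesis by (simp add: coeff_monom_mult polyfam_high[OF P] polyfam_high[OF R])
    qed
  qed
qed

section \<open>Root counting with parameters\<close>

lemma cauchy_index_0_left [simp]: "cauchy_index 0 r = 0"
  by (simp add: cauchy_index_def infinite_UNIV_char_0)

lemma cauchy_index_0_right [simp]: "cauchy_index p 0 = 0"
  unfolding cauchy_index_def pole_jump_def by (intro sum.neutral) simp

text \<open>The Euclidean algorithm with parameters, by induction on the sum of the formal degree
  bounds. If a formal leading coefficient vanishes it is cut off. Otherwise the polynomial of larger
  formal degree is reduced by the other one, after applying the inversion formula if that is the
  denominator.\<close>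

lemma simple_on_cauchy_index:
  "polyfam V d P \<Longrightarrow> polyfam V e R \<Longrightarrow> simple_on V (\<lambda>s. cauchy_index (P s) (R s))"
proof (induction "d + e" arbitrary: d e P R rule: less_induct)
  case less
  note P = less.prems(1) and R = less.prems(2)
  show ?case
  proof (cases "d = 0 \<or> e = 0")
    case True
    then have "(\<lambda>s. cauchy_index (P s) (R s)) = (\<lambda>_. 0)"
      using polyfam_0 P R by fastforce
    then show ?thesis by (simp add: simple_on_const)
  next
    case False
    then obtain a b where ab: "d = Suc a" "e = Suc b" by (meson not0_implies_Suc)
    note P = P[unfolded ab] and R = R[unfolded ab]
    define p r where "p s = coeff (P s) a" and "r s = coeff (R s) b" for s
    have p: "p \<in> polyfun V" and r: "r \<in> polyfun V"
      unfolding p_def r_def using polyfam_coeff P R by blast+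
    have I1: "simple_on V (\<lambda>s. cauchy_index (poly_cutoff a (P s)) (R s))"
      by (rule less.hyps[OF _ polyfam_cutoff[OF P] R]) (simp add: ab)
    have I2: "simple_on V (\<lambda>s. cauchy_index (P s) (poly_cutoff b (R s)))"
      by (rule less.hyps[OF _ P polyfam_cutoff[OF R]]) (simp add: ab)
    obtain F where F: "simple_on V F"
      "\<And>s. p s \<noteq> 0 \<Longrightarrow> r s \<noteq> 0 \<Longrightarrow> F s = cauchy_index (P s) (R s)"
    proof (cases "a \<le> b")
      case True
      define F where "F s = cauchy_index (P s) (smult ((p s)\<^sup>2) (R s) - monom (r s * p s) (b - a) * P s)" for s
      have "simple_on V F" unfolding F_def p_def r_def
        by (rule less.hyps[OF _ P polyfam_reduce[OF P R True]]) (simp add: ab)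
      moreover have "F s = cauchy_index (P s) (R s)" if "p s \<noteq> 0" for s
      proof -
        have "P s \<noteq> 0" using that by (auto simp: p_def)
        then show ?thesis
          using cauchy_index_reduce[of "P s" "(p s)\<^sup>2" "R s" "- monom (r s * p s) (b - a)"] that
          by (simp add: F_def)
      qed
      ultimately show ?thesis using that by blast
    next
      case False
      then have ba: "b \<le> a" by simp
      \<comment> \<open>The first summand is the right-hand side of
        \<open>cauchy_index_swap\<close>, as the product \<open>P s * R s\<close> has degree
        \<open>a + b\<close> and leading coefficient \<open>p s * r s\<close> when neither factor is
        0.\<close>
      define F where "F s = sgn (p s) * sgn (r s) * ((1 - (-1) ^ (a + b)) / 2)
        - cauchy_index (R s) (smult ((r s)\<^sup>2) (P s) - monom (p s * r s) (a - b) * R s)" for s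
      have "simple_on V (\<lambda>s. cauchy_index (R s) (smult ((r s)\<^sup>2) (P s) - monom (p s * r s) (a - b) * R s))"
        unfolding p_def r_def
        by (rule less.hyps[OF _ R polyfam_reduce[OF R P ba]]) (simp add: ab)
      then have "simple_on V F" unfolding F_def
        by (intro simple_on_comp2[where H = "(-)"] simple_on_comp2[where H = "(*)"] simple_on_sgn
            simple_on_const p r)
      moreover have "F s = cauchy_index (P s) (R s)" if pr: "p s \<noteq> 0" "r s \<noteq> 0" for s
      proof -
        have nz: "P s \<noteq> 0" "R s \<noteq> 0" using pr by (auto simp: p_def r_def)
        have deg: "degree (P s) = a" "degree (R s) = b"
          using pr polyfam_degree[OF P, of s] polyfam_degree[OF R, of s] by (simp_all add: p_def r_def)
        have "cauchy_index (R s) (smult ((r s)\<^sup>2) (P s) - monom (p s * r s) (a - b) * R s)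
            = cauchy_index (R s) (P s)"
          using cauchy_index_reduce[OF nz(2), of "(r s)\<^sup>2" "P s" "- monom (p s * r s) (a - b)"] pr by simp
        moreover have "lead_coeff (P s * R s) = p s * r s"
          unfolding lead_coeff_mult deg p_def r_def ..
        moreover have "degree (P s * R s) = a + b" using nz by (simp add: degree_mult_eq deg)
        ultimately show ?thesis using cauchy_index_swap[OF nz]
          by (simp add: F_def sgn_minfty_def sgn_mult field_simps)
      qed
      ultimately show ?thesis using that by blast
    qed
    have "(\<lambda>s. cauchy_index (P s) (R s)) = (\<lambda>s. if p s = 0 then cauchy_index (poly_cutoff a (P s)) (R s)
        else if r s = 0 then cauchy_index (P s) (poly_cutoff b (R s)) else F s)"
      using polyfam_cutoff_eq[OF P] polyfam_cutoff_eq[OF R] F(2) by (auto simp: p_def r_def)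
    moreover have "simple_on V \<dots>"
      by (intro simple_on_if semialg_eq p r polyfun_const I1 I2 F(1))
    ultimately show ?thesis by simp
  qed
qed

text \<open>The first nonzero coefficient from the top decides; there are only \<open>d\<close>
  candidates.\<close>

lemma simple_on_leading_sgn:
  "polyfam V d P \<Longrightarrow> simple_on V (\<lambda>s. (sgn (lead_coeff (P s)), degree (P s)))"
proof (induction d arbitrary: P)
  case 0
  then have "(\<lambda>s. (sgn (lead_coeff (P s)), degree (P s))) = (\<lambda>_. (0, 0))"
    using polyfam_0 by fastforce
  then show ?case by (simp add: simple_on_const)
next
  case (Suc d)
  have "(\<lambda>s. (sgn (lead_coeff (P s)), degree (P s))) = (\<lambda>s. if coeff (P s) d = 0
      then (sgn (lead_coeff (poly_cutoff d (P s))), degree (poly_cutoff d (P s)))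
      else (sgn (coeff (P s) d), d))"
    using polyfam_cutoff_eq[OF Suc.prems] polyfam_degree[OF Suc.prems] by auto
  moreover have "simple_on V \<dots>"
    by (intro simple_on_if semialg_eq polyfam_coeff[OF Suc.prems] polyfun_const Suc.IH
        polyfam_cutoff[OF Suc.prems] simple_on_comp2[where H = Pair] simple_on_sgn simple_on_const)
  ultimately show ?case by simp
qed

text \<open>For \<open>r = 1\<close> and \<open>p \<noteq> 0\<close> this counts the roots of
  \<open>p\<close> at which all of \<open>qs\<close> are positive. The weight
  \<open>sgn (poly r x)\<close> is carried along so that a recursion over \<open>qs\<close> can move
  factors into \<open>r\<close> until a Tarski query remains.\<close>

definition root_sum :: "real poly \<Rightarrow> real poly \<Rightarrow> real poly list \<Rightarrow> real" where
  "root_sum p r qs = (\<Sum>x | poly p x = 0. sgn (poly r x) * (\<Prod>q\<leftarrow>qs. if poly q x > 0 then 1 else 0))"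

text \<open>The indicator of \<open>q > 0\<close> is \<open>(\<sigma>\<^sup>2 + \<sigma>) / 2\<close> for the sign \<open>\<sigma>\<close> of \<open>q\<close>.\<close>

lemma simple_on_root_sum:
  assumes "polyfam V d P"
  shows "polyfam V e R \<Longrightarrow> \<forall>Q\<in>set Qs. \<exists>k. polyfam V k Q \<Longrightarrow>
    simple_on V (\<lambda>s. root_sum (P s) (R s) (map (\<lambda>Q. Q s) Qs))"
proof (induction Qs arbitrary: R e)
  case Nil
  have "root_sum (P s) (R s) [] = cauchy_index (P s) (pderiv (P s) * R s)" for s
    using tarski_query[of "P s" "R s"] by (cases "P s = 0") (auto simp: root_sum_def infinite_UNIV_char_0)
  then show ?case
    using simple_on_cauchy_index[OF assms polyfam_mult[OF polyfam_pderiv[OF assms] Nil(1)]] by simp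
next
  case (Cons Q Qs)
  obtain k where Q: "polyfam V k Q" using Cons.prems(2) by auto
  have *: "\<forall>Q\<in>set Qs. \<exists>k. polyfam V k Q" using Cons.prems(2) by auto
  have e: "root_sum (P s) (R s) (map (\<lambda>Q. Q s) (Q # Qs)) =
    (root_sum (P s) (R s * Q s * Q s) (map (\<lambda>Q. Q s) Qs) + root_sum (P s) (R s * Q s) (map (\<lambda>Q. Q s) Qs)) / 2" for s
    unfolding root_sum_def sum.distrib[symmetric] sum_divide_distrib
  proof (intro sum.cong refl)
    fix x
    show "sgn (poly (R s) x) * (\<Prod>q\<leftarrow>map (\<lambda>Q. Q s) (Q # Qs). if 0 < poly q x then 1 else 0) =
      (sgn (poly (R s * Q s * Q s) x) * (\<Prod>q\<leftarrow>map (\<lambda>Q. Q s) Qs. if 0 < poly q x then 1 else 0)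
        + sgn (poly (R s * Q s) x) * (\<Prod>q\<leftarrow>map (\<lambda>Q. Q s) Qs. if 0 < poly q x then 1 else 0)) / 2"
      by (cases "poly (Q s) x" "0 :: real" rule: linorder_cases) (simp_all add: sgn_mult)
  qed
  have RQ: "polyfam V (e + k) (\<lambda>s. R s * Q s)" by (rule polyfam_mult[OF Cons.prems(1) Q])
  show ?case unfolding e
    by (rule simple_on_comp2[where H = "\<lambda>a b. (a + b) / 2"])
      (rule Cons.IH[OF polyfam_mult[OF RQ Q] *] Cons.IH[OF RQ *])+
qed

text \<open>The root sum with weight 1 is the number of such roots. The conjunct
  \<open>P s \<noteq> 0\<close> matches the value 0 of the sum over infinitely many roots.\<close>

lemma semialg_ex_root:
  assumes "polyfam V d P" "\<forall>Q\<in>set Qs. \<exists>k. polyfam V k Q"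
  shows "semialg V (\<lambda>s. P s \<noteq> 0 \<and> (\<exists>x. poly (P s) x = 0 \<and> (\<forall>Q\<in>set Qs. poly (Q s) x > 0)))"
proof -
  have ind: "(\<Prod>q\<leftarrow>map (\<lambda>Q. Q s) Qs. if poly q x > 0 then 1 else (0::real))
      = (if \<forall>Q\<in>set Qs. poly (Q s) x > 0 then 1 else 0)" for s x
    by (induction Qs) auto
  have "P s \<noteq> 0 \<and> (\<exists>x. poly (P s) x = 0 \<and> (\<forall>Q\<in>set Qs. poly (Q s) x > 0))
    \<longleftrightarrow> root_sum (P s) [:1:] (map (\<lambda>Q. Q s) Qs) \<noteq> 0" for s
  proof (cases "P s = 0")
    case True
    then show ?thesis by (simp add: root_sum_def infinite_UNIV_char_0)
  next
    case False
    then have fin: "finite {x. poly (P s) x = 0}" by (rule poly_roots_finite)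
    show ?thesis unfolding root_sum_def ind
      by (subst sum_nonneg_eq_0_iff[OF fin]) (use False in auto)
  qed
  then show ?thesis
    using simple_on_pred[OF simple_on_root_sum[OF assms(1) polyfam_const[OF polyfun_const] assms(2)],
        of "\<lambda>c. c \<noteq> 0" 1] by simp
qed

section \<open>Systems of equations and inequalities in one unknown\<close>

text \<open>The set of solutions is open. If it contains neither end of the line, a solution
  \<open>x\<close> lies between two neighbouring roots of the product, and Rolle's theorem yields a
  root of the derivative of the product in the same gap, where no factor changes sign. This reduces
  pure inequalities to the case with an equation.\<close>

lemma all_pos_iff:
  fixes qs :: "real poly list"
  shows "(\<exists>x. \<forall>q\<in>set qs. poly q x > 0) \<longleftrightarrow>
    (\<forall>q\<in>set qs. sgn (lead_coeff q) = 1) \<or> (\<forall>q\<in>set qs. sgn_minfty q = 1) \<or>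
    (pderiv (prod_list qs) \<noteq> 0 \<and>
      (\<exists>x. poly (pderiv (prod_list qs)) x = 0 \<and> (\<forall>q\<in>set qs. poly q x > 0)))"
    (is "_ \<longleftrightarrow> ?A \<or> ?B \<or> ?C")
proof
  assume "\<exists>x. \<forall>q\<in>set qs. poly q x > 0"
  then obtain x where x: "\<And>q. q \<in> set qs \<Longrightarrow> poly q x > 0" by blast
  show "?A \<or> ?B \<or> ?C"
  proof (rule ccontr)
    assume n: "\<not> ?thesis"
    define u where "u = prod_list qs"
    have ux: "poly u x > 0" using x unfolding u_def by (induction qs) auto
    have uroot: "poly u y = 0 \<longleftrightarrow> (\<exists>q\<in>set qs. poly q y = 0)" for y
      unfolding u_def by (induction qs) auto
    have u0: "u \<noteq> 0" using ux by auto
    have fin: "finite {y. poly u y = 0}" using poly_roots_finite[OF u0] .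
    obtain q where q: "q \<in> set qs" "sgn (lead_coeff q) \<noteq> 1" using n by blast
    have q0: "q \<noteq> 0" using x[OF q(1)] by auto
    have "\<exists>y\<ge>x. poly u y = 0"
    proof (rule ccontr)
      assume "\<not> ?thesis"
      then have "poly q y \<noteq> 0" if "y \<ge> x" for y using that q(1) uroot by auto
      then have "sgn (poly q x) = sgn (lead_coeff q)" by (intro sgn_poly_no_root_right[OF q0])
      then show False using x[OF q(1)] q(2) by simp
    qed
    then have ne1: "{y. poly u y = 0 \<and> x \<le> y} \<noteq> {}" by blast
    obtain q' where q': "q' \<in> set qs" "sgn_minfty q' \<noteq> 1" using n by blast
    have q'0: "q' \<noteq> 0" using x[OF q'(1)] by auto
    have "\<exists>y\<le>x. poly u y = 0"
    proof (rule ccontr)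
      assume "\<not> ?thesis"
      then have "poly q' y \<noteq> 0" if "y \<le> x" for y using that q'(1) uroot by auto
      then have "sgn (poly q' x) = sgn_minfty q'" by (intro sgn_poly_no_root_left[OF q'0])
      then show False using x[OF q'(1)] q'(2) by simp
    qed
    then have ne2: "{y. poly u y = 0 \<and> y \<le> x} \<noteq> {}" by blast
    \<comment> \<open>The neighbouring roots \<open>a < x < b\<close> of the product; both exist
      because some factor fails to be positive at each end of the line.\<close>
    define b where "b = Min {y. poly u y = 0 \<and> x \<le> y}"
    define a where "a = Max {y. poly u y = 0 \<and> y \<le> x}"
    have f1: "finite {y. poly u y = 0 \<and> x \<le> y}" and f2: "finite {y. poly u y = 0 \<and> y \<le> x}"
      by (rule finite_subset[OF _ fin], blast)+
    have b: "poly u b = 0" "x \<le> b" using Min_in[OF f1 ne1] by (auto simp: b_def)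
    have a: "poly u a = 0" "a \<le> x" using Max_in[OF f2 ne2] by (auto simp: a_def)
    have ab: "a < x" "x < b" using a b ux by (auto simp: less_le)
    have nr: "poly u y \<noteq> 0" if "a < y" "y < b" for y
    proof
      assume "poly u y = 0"
      then show False
        using Min_le[OF f1, of y] Max_ge[OF f2, of y] that by (cases "x \<le> y") (auto simp: a_def b_def)
    qed
    have pos: "poly q y > 0" if "a < y" "y < b" "q \<in> set qs" for q y
    proof (rule ccontr)
      assume "\<not> ?thesis"
      moreover have "poly q y \<noteq> 0" using nr[OF that(1,2)] uroot that(3) by auto
      ultimately have "poly q y < 0" by simp
      then have "\<exists>z. min x y < z \<and> z < max x y \<and> poly q z = 0"
        using poly_IVT[of "min x y" "max x y" q] x[OF that(3)]
        by (cases "x < y") (auto simp: min_def max_def mult_pos_neg mult_neg_pos)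
      then obtain z where "min x y < z" "z < max x y" "poly q z = 0" by blast
      then show False using nr[of z] that ab uroot by (auto simp: min_def max_def split: if_splits)
    qed
    \<comment> \<open>Rolle's theorem, as \<open>u\<close> vanishes at both \<open>a\<close> and
      \<open>b\<close>.\<close>
    obtain z where z: "a < z" "z < b" "poly u b - poly u a = (b - a) * poly (pderiv u) z"
      using poly_MVT[of a b u] ab by auto
    then have "poly (pderiv u) z = 0" using a b ab by simp
    moreover have "pderiv u \<noteq> 0"
    proof
      assume "pderiv u = 0"
      then have "degree u = 0" by (simp add: pderiv_eq_0_iff)
      then obtain c where "u = [:c:]" by (rule degree_eq_zeroE)
      then show False using ux a by simp
    qed
    ultimately show False using n pos[OF z(1,2)] unfolding u_def by blast
  qed
next
  assume "?A \<or> ?B \<or> ?C"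
  then show "\<exists>x. \<forall>q\<in>set qs. poly q x > 0"
  proof (elim disjE)
    assume A: ?A
    then have "\<exists>n. \<forall>x\<ge>n. poly q x > 0" if "q \<in> set qs" for q
    proof -
      have "0 < lead_coeff q" using A that by (metis sgn_1_pos)
      from poly_pinfty_gt_lc[OF this] show ?thesis using \<open>0 < lead_coeff q\<close> by (meson less_le_trans)
    qed
    then have "\<forall>\<^sub>F x in at_top. \<forall>q\<in>set qs. poly q x > 0"
      by (intro eventually_ball_finite) (auto simp: eventually_at_top_linorder)
    then show ?thesis by (rule eventually_happens'[OF trivial_limit_at_top_linorder])
  next
    assume B: ?B
    have "\<exists>n. \<forall>x\<le>n. poly q x > 0" if q: "q \<in> set qs" for q
    proof -
      have q0: "q \<noteq> 0" using B q by (auto simp: sgn_minfty_def)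
      then have fin: "finite {y. poly q y = 0}" by (rule poly_roots_finite)
      obtain n where n: "\<And>y. poly q y = 0 \<Longrightarrow> n < y"
      proof -
        obtain m where m: "\<And>y. y \<in> {y. poly q y = 0} \<Longrightarrow> m \<le> y"
          using bdd_below_finite[OF fin] unfolding bdd_below_def by blast
        show ?thesis by (rule that[of "m - 1"]) (use m in force)
      qed
      have "poly q x > 0" if "x \<le> n" for x
      proof -
        have "sgn (poly q x) = sgn_minfty q"
          by (rule sgn_poly_no_root_left[OF q0]) (use n that in force)
        then show ?thesis using B q by (metis sgn_1_pos)
      qed
      then show ?thesis by blast
    qed
    then have "\<forall>\<^sub>F x in at_bot. \<forall>q\<in>set qs. poly q x > 0"
      by (intro eventually_ball_finite) (auto simp: eventually_at_bot_linorder)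
    then show ?thesis by (rule eventually_happens'[OF trivial_limit_at_bot_linorder])
  next
    assume ?C
    then show ?thesis by blast
  qed
qed

lemma polyfam_prod_list:
  "\<forall>Q\<in>set Qs. \<exists>k. polyfam V k Q \<Longrightarrow> \<exists>k. polyfam V k (\<lambda>s. prod_list (map (\<lambda>Q. Q s) Qs))"
proof (induction Qs)
  case Nil
  then show ?case using polyfam_const[OF polyfun_const[of 1 V]] by (auto simp: one_pCons)
next
  case (Cons Q Qs)
  then obtain k l where "polyfam V k Q" "polyfam V l (\<lambda>s. prod_list (map (\<lambda>Q. Q s) Qs))" by auto
  from polyfam_mult[OF this] show ?case by auto
qed

lemma semialg_ex_all_pos:
  assumes "\<forall>Q\<in>set Qs. \<exists>k. polyfam V k Q"
  shows "semialg V (\<lambda>s. \<exists>x. \<forall>Q\<in>set Qs. poly (Q s) x > 0)"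
proof -
  obtain k where k: "polyfam V k (\<lambda>s. prod_list (map (\<lambda>Q. Q s) Qs))"
    using polyfam_prod_list[OF assms] by blast
  have 1: "semialg V (\<lambda>s. \<forall>Q\<in>set Qs. sgn (lead_coeff (Q s)) = 1)"
    using assms simple_on_pred[OF simple_on_leading_sgn, of V _ _ "\<lambda>a. fst a = 1"]
    by (intro semialg_ball_finite) auto
  have 2: "semialg V (\<lambda>s. \<forall>Q\<in>set Qs. sgn_minfty (Q s) = 1)"
    using assms simple_on_pred[OF simple_on_leading_sgn, of V _ _ "\<lambda>a. fst a * (-1) ^ snd a = 1"]
    by (intro semialg_ball_finite) (auto simp: sgn_minfty_def)
  have "semialg V (\<lambda>s. (\<forall>Q\<in>set Qs. sgn (lead_coeff (Q s)) = 1) \<or> (\<forall>Q\<in>set Qs. sgn_minfty (Q s) = 1) \<or>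
    (pderiv (prod_list (map (\<lambda>Q. Q s) Qs)) \<noteq> 0 \<and>
      (\<exists>x. poly (pderiv (prod_list (map (\<lambda>Q. Q s) Qs))) x = 0 \<and> (\<forall>Q\<in>set Qs. poly (Q s) x > 0))))"
    by (intro semialg_disj 1 2 semialg_ex_root[OF polyfam_pderiv[OF k] assms])
  then show ?thesis using all_pos_iff[of "map (\<lambda>Q. Q _) Qs"] by simp
qed

text \<open>A system of real equations is equivalent to the single equation that the sum of squares
  vanishes. Where that sum is the zero polynomial only the inequalities remain; elsewhere its roots
  can be counted.\<close>

lemma semialg_ex_basic:
  assumes "\<forall>P\<in>set Ps. \<exists>k. polyfam V k P" "\<forall>Q\<in>set Qs. \<exists>k. polyfam V k Q"
  shows "semialg V (\<lambda>s. \<exists>x. (\<forall>P\<in>set Ps. poly (P s) x = 0) \<and> (\<forall>Q\<in>set Qs. poly (Q s) x > 0))"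
proof -
  define S where "S s = (\<Sum>P\<leftarrow>Ps. P s * P s)" for s
  have "\<exists>d. polyfam V d S" using assms(1) unfolding S_def
  proof (induction Ps)
    case Nil
    then show ?case using polyfam_const[OF polyfun_const[of 0 V]] by auto
  next
    case (Cons P Ps)
    then obtain k l where k: "polyfam V k P" and l: "polyfam V l (\<lambda>s. \<Sum>P\<leftarrow>Ps. P s * P s)" by auto
    from polyfam_add[OF polyfam_mult[OF k k] l] show ?case by auto
  qed
  then obtain d where S: "polyfam V d S" by blast
  have S0: "poly (S s) x = 0 \<longleftrightarrow> (\<forall>P\<in>set Ps. poly (P s) x = 0)" for s x
  proof -
    have "poly (S s) x = (\<Sum>P\<leftarrow>Ps. poly (P s) x * poly (P s) x)"
      unfolding S_def by (induction Ps) auto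
    also have "\<dots> = 0 \<longleftrightarrow> (\<forall>a\<in>set (map (\<lambda>P. poly (P s) x * poly (P s) x) Ps). a = 0)"
      by (rule sum_list_nonneg_eq_0_iff) auto
    finally show ?thesis by simp
  qed
  have "S s = 0 \<longleftrightarrow> (\<forall>i<d. coeff (S s) i = 0)" for s
    using polyfam_high[OF S] by (auto simp: poly_eq_iff) (meson leI)
  then have Z: "semialg V (\<lambda>s. S s = 0)"
    using semialg_ball_finite[of "{..<d}" V "\<lambda>i s. coeff (S s) i = 0"]
      semialg_eq[OF polyfam_coeff[OF S] polyfun_const] by (simp add: Ball_def)
  have "semialg V (\<lambda>s. (S s = 0 \<and> (\<exists>x. \<forall>Q\<in>set Qs. poly (Q s) x > 0)) \<or>
    (S s \<noteq> 0 \<and> (\<exists>x. poly (S s) x = 0 \<and> (\<forall>Q\<in>set Qs. poly (Q s) x > 0))))"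
    by (intro semialg_disj semialg_conj[OF Z] semialg_ex_all_pos semialg_ex_root[OF S] assms(2))
  moreover have "(\<exists>x. (\<forall>P\<in>set Ps. poly (P s) x = 0) \<and> (\<forall>Q\<in>set Qs. poly (Q s) x > 0)) \<longleftrightarrow>
    (S s = 0 \<and> (\<exists>x. \<forall>Q\<in>set Qs. poly (Q s) x > 0)) \<or>
    (S s \<noteq> 0 \<and> (\<exists>x. poly (S s) x = 0 \<and> (\<forall>Q\<in>set Qs. poly (Q s) x > 0)))" for s
    unfolding S0[symmetric] by (cases "S s = 0") auto
  ultimately show ?thesis by simp
qed

section \<open>Elimination of one variable\<close>

definition ext_real :: "('s \<Rightarrow> real) set \<Rightarrow> ('s \<times> real \<Rightarrow> real) set" where
  "ext_real V = insert snd ((\<lambda>v z. v (fst z)) ` V)"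

lemma polyfun_ext_real_polyfam:
  assumes "F \<in> polyfun (ext_real V)"
  shows "\<exists>d P. polyfam V d P \<and> (\<forall>s x. F (s, x) = poly (P s) x)"
  using assms
proof induction
  case (polyfun_const c)
  show ?case using polyfam_const[OF polyfun.polyfun_const, of V c]
    by (intro exI[of _ 1] exI[of _ "\<lambda>_. [:c:]"]) simp
next
  case (polyfun_var v)
  then consider "v = snd" | w where "w \<in> V" "v = (\<lambda>z. w (fst z))" by (auto simp: ext_real_def)
  then show ?case
  proof cases
    case 1
    have "polyfam V (Suc 1) (\<lambda>_. monom 1 1)" by (rule polyfam_monom[OF polyfun.polyfun_const])
    then show ?thesis using 1 by (intro exI[of _ "Suc 1"] exI[of _ "\<lambda>_. monom 1 1"]) (simp add: poly_monom)
  next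
    case 2
    then show ?thesis using polyfam_const[OF polyfun.polyfun_var[OF 2(1)]]
      by (intro exI[of _ 1] exI[of _ "\<lambda>s. [:w s:]"]) simp
  qed
next
  case (polyfun_add F G)
  then obtain d P e Q where "polyfam V d P" "\<forall>s x. F (s, x) = poly (P s) x"
    "polyfam V e Q" "\<forall>s x. G (s, x) = poly (Q s) x" by blast
  then show ?case
    by (intro exI[of _ "max d e"] exI[of _ "\<lambda>s. P s + Q s"]) (simp add: polyfam_add)
next
  case (polyfun_mult F G)
  then obtain d P e Q where "polyfam V d P" "\<forall>s x. F (s, x) = poly (P s) x"
    "polyfam V e Q" "\<forall>s x. G (s, x) = poly (Q s) x" by blast
  then show ?case
    by (intro exI[of _ "d + e"] exI[of _ "\<lambda>s. P s * Q s"]) (simp add: polyfam_mult)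
qed

text \<open>This stands in for a disjunctive normal form: an arbitrary function \<open>H\<close> of
  finitely many signs absorbs the boolean structure.\<close>

lemma semialg_sign_determined:
  assumes "semialg V P"
  shows "\<exists>Fs H. set Fs \<subseteq> polyfun V \<and> (\<forall>s. P s = H (map (\<lambda>F. sgn (F s)) Fs))"
  using assms
proof induction
  case (semialg_pos F)
  show ?case
    by (rule exI[of _ "[F]"], rule exI[of _ "\<lambda>l. hd l = 1"]) (use semialg_pos in \<open>auto simp: sgn_1_pos\<close>)
next
  case (semialg_not P)
  then obtain Fs H where "set Fs \<subseteq> polyfun V" "\<forall>s. P s = H (map (\<lambda>F. sgn (F s)) Fs)" by blast
  then show ?case by (intro exI[of _ Fs] exI[of _ "\<lambda>l. \<not> H l"]) simp
next
  case (semialg_conj P Q)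
  then obtain Fs H Gs K where "set Fs \<subseteq> polyfun V" "\<forall>s. P s = H (map (\<lambda>F. sgn (F s)) Fs)"
    "set Gs \<subseteq> polyfun V" "\<forall>s. Q s = K (map (\<lambda>F. sgn (F s)) Gs)" by blast
  then show ?case
    by (intro exI[of _ "Fs @ Gs"] exI[of _ "\<lambda>l. H (take (length Fs) l) \<and> K (drop (length Fs) l)"]) simp
qed

text \<open>Finitely many polynomials have finitely many possible sign vectors, so the existential
  statement splits into a finite disjunction; each disjunct prescribes one vector and is a system of
  equations and strict inequalities in the last variable.\<close>

theorem tarski_seidenberg:
  assumes "semialg (ext_real V) P"
  shows "semialg V (\<lambda>s. \<exists>x. P (s, x))"
proof -
  obtain Fs H where Fs: "set Fs \<subseteq> polyfun (ext_real V)" and H: "\<And>z. P z = H (map (\<lambda>F. sgn (F z)) Fs)"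
    using semialg_sign_determined[OF assms] by blast
  define k where "k = length Fs"
  have "\<forall>F\<in>polyfun (ext_real V). \<exists>P. (\<exists>d. polyfam V d P) \<and> (\<forall>s x. F (s, x) = poly (P s) x)"
    using polyfun_ext_real_polyfam[of _ V] by blast
  then obtain D where D: "\<And>F. F \<in> polyfun (ext_real V) \<Longrightarrow> \<exists>d. polyfam V d (D F)"
    "\<And>F s x. F \<in> polyfun (ext_real V) \<Longrightarrow> F (s, x) = poly (D F s) x"
    using bchoice[of "polyfun (ext_real V)"
        "\<lambda>F P. (\<exists>d. polyfam V d P) \<and> (\<forall>s x. F (s, x) = poly (P s) x)"] by blast
  define L where "L = {l :: real list. set l \<subseteq> {-1, 0, 1} \<and> length l = k \<and> H l}"
  have "finite L" unfolding L_def
    by (rule finite_subset[OF _ finite_lists_length_eq[of "{-1, 0, 1::real}" k]]) auto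
  have one: "semialg V (\<lambda>s. \<exists>x. map (\<lambda>F. sgn (F (s, x))) Fs = l)" if "l \<in> L" for l
  proof -
    define Ps where "Ps = map (\<lambda>i. D (Fs ! i)) (filter (\<lambda>i. l ! i = 0) [0..<k])"
    \<comment> \<open>Multiplication by the prescribed sign, which is 1 or -1 here, turns both kinds
      of sign condition into positivity.\<close>
    define Qs where "Qs = map (\<lambda>i s. smult (l ! i) (D (Fs ! i) s)) (filter (\<lambda>i. l ! i \<noteq> 0) [0..<k])"
    have Fi: "Fs ! i \<in> polyfun (ext_real V)" if "i < k" for i
      using that Fs by (auto simp: k_def)
    have 1: "\<forall>P\<in>set Ps. \<exists>d. polyfam V d P" using D(1) Fi by (auto simp: Ps_def)
    have 2: "\<forall>P\<in>set Qs. \<exists>d. polyfam V d P"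
      using D(1) Fi polyfam_smult[OF polyfun_const] by (fastforce simp: Qs_def)
    have eq: "map (\<lambda>F. sgn (F (s, x))) Fs = l \<longleftrightarrow>
      (\<forall>P\<in>set Ps. poly (P s) x = 0) \<and> (\<forall>Q\<in>set Qs. poly (Q s) x > 0)" for s x
    proof -
      have "map (\<lambda>F. sgn (F (s, x))) Fs = l \<longleftrightarrow> (\<forall>i<k. sgn (poly (D (Fs ! i) s) x) = l ! i)"
        using that D(2)[OF Fi] unfolding list_eq_iff_nth_eq L_def by (auto simp: k_def)
      also have "\<dots> \<longleftrightarrow> (\<forall>i<k. if l ! i = 0 then poly (D (Fs ! i) s) x = 0
          else poly (smult (l ! i) (D (Fs ! i) s)) x > 0)"
      proof (intro all_cong)
        fix i assume "i < k"
        then have "l ! i \<in> {-1, 0, 1}" using that unfolding L_def using nth_mem by blast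
        then consider "l ! i = -1" | "l ! i = 0" | "l ! i = 1" by blast
        then show "sgn (poly (D (Fs ! i) s) x) = l ! i \<longleftrightarrow> (if l ! i = 0 then poly (D (Fs ! i) s) x = 0
          else poly (smult (l ! i) (D (Fs ! i) s)) x > 0)"
          by cases (simp_all add: sgn_if)
      qed
      also have "\<dots> \<longleftrightarrow> (\<forall>P\<in>set Ps. poly (P s) x = 0) \<and> (\<forall>Q\<in>set Qs. poly (Q s) x > 0)"
      proof -
        have "(\<forall>P\<in>set Ps. poly (P s) x = 0) \<longleftrightarrow> (\<forall>i<k. l ! i = 0 \<longrightarrow> poly (D (Fs ! i) s) x = 0)"
          by (auto simp: Ps_def)
        moreover have "(\<forall>Q\<in>set Qs. poly (Q s) x > 0) \<longleftrightarrow>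
            (\<forall>i<k. l ! i \<noteq> 0 \<longrightarrow> poly (smult (l ! i) (D (Fs ! i) s)) x > 0)"
          by (auto simp: Qs_def)
        ultimately show ?thesis by (simp only: if_bool_eq_conj imp_conjL[symmetric]) blast
      qed
      finally show ?thesis .
    qed
    show ?thesis unfolding eq by (rule semialg_ex_basic[OF 1 2])
  qed
  have "semialg V (\<lambda>s. \<exists>l\<in>L. \<exists>x. map (\<lambda>F. sgn (F (s, x))) Fs = l)"
    using semialg_bex_finite[OF \<open>finite L\<close> one] .
  moreover have "(\<exists>x. P (s, x)) \<longleftrightarrow> (\<exists>l\<in>L. \<exists>x. map (\<lambda>F. sgn (F (s, x))) Fs = l)" for s
  proof -
    have "set (map (\<lambda>F. sgn (F (s, x))) Fs) \<subseteq> {-1, 0, 1}" for x by (auto simp: sgn_if)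
    then have "map (\<lambda>F. sgn (F (s, x))) Fs \<in> L" if "P (s, x)" for x
      using that unfolding H L_def k_def by simp
    then show ?thesis unfolding H L_def by blast
  qed
  ultimately show ?thesis by simp
qed

section \<open>Semialgebraic sets on the line and definable choice\<close>

lemma polyfun_ext_fst: "F \<in> polyfun V \<Longrightarrow> (\<lambda>z. F (fst z)) \<in> polyfun (ext_real V)"
  by (erule polyfun_comp) (auto simp: ext_real_def intro: polyfun_var)

lemma polyfun_ext_snd: "(\<lambda>z. snd z) \<in> polyfun (ext_real V)"
  by (rule polyfun_var) (simp add: ext_real_def)

lemma semialg_ex:
  "semialg (ext_real V) (\<lambda>z. P (fst z) (snd z)) \<Longrightarrow> semialg V (\<lambda>s. \<exists>x. P s x)"
  using tarski_seidenberg by fastforce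

lemma semialg_all:
  assumes "semialg (ext_real V) (\<lambda>z. P (fst z) (snd z))"
  shows "semialg V (\<lambda>s. \<forall>x. P s x)"
  using semialg_not[OF semialg_ex[of V "\<lambda>s x. \<not> P s x"], OF semialg_not[OF assms]] by simp

abbreviation real_tuples :: "nat \<Rightarrow> (nat \<Rightarrow> real) set" where
  "real_tuples N \<equiv> topspace (Euclidean_space N)"

definition coords :: "nat \<Rightarrow> ((nat \<Rightarrow> real) \<Rightarrow> real) set" where
  "coords N = (\<lambda>i x. x i) ` {..<N}"

definition ext_tuple :: "nat \<Rightarrow> ('s \<Rightarrow> real) set \<Rightarrow> ('s \<times> (nat \<Rightarrow> real) \<Rightarrow> real) set" where
  "ext_tuple N V = (\<lambda>v z. v (fst z)) ` V \<union> (\<lambda>i z. snd z i) ` {..<N}"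

lemma polyfun_tuple_fst: "F \<in> polyfun V \<Longrightarrow> (\<lambda>z. F (fst z)) \<in> polyfun (ext_tuple N V)"
  by (erule polyfun_comp) (auto simp: ext_tuple_def intro: polyfun_var)

lemma polyfun_tuple_snd: "i < N \<Longrightarrow> (\<lambda>z. snd z i) \<in> polyfun (ext_tuple N V)"
  by (rule polyfun_var) (simp add: ext_tuple_def)

lemma semialg_ex_tuple':
  "semialg (ext_tuple N V) P \<Longrightarrow> semialg V (\<lambda>s. \<exists>q\<in>real_tuples N. P (s, q))"
proof (induction N arbitrary: P)
  case 0
  have "real_tuples 0 = {\<lambda>_. 0}" by (auto simp: topspace_Euclidean_space)
  moreover have "semialg V (\<lambda>s. P (s, \<lambda>_. 0))"
    by (rule semialg_comp[OF 0, where g = "\<lambda>s. (s, \<lambda>_. 0)"]) (auto simp: ext_tuple_def intro: polyfun_var)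
  ultimately show ?case by simp
next
  case (Suc N)
  have "semialg (ext_real (ext_tuple N V)) (\<lambda>z. P (fst (fst z), (snd (fst z))(N := snd z)))"
  proof (rule semialg_comp[OF Suc.prems, where g = "\<lambda>z. (fst (fst z), (snd (fst z))(N := snd z))"])
    fix v assume "v \<in> ext_tuple (Suc N) V"
    then consider w where "w \<in> V" "v = (\<lambda>z. w (fst z))" | i where "i < Suc N" "v = (\<lambda>z. snd z i)"
      by (auto simp: ext_tuple_def)
    then show "(\<lambda>t. v (fst (fst t), (snd (fst t))(N := snd t))) \<in> polyfun (ext_real (ext_tuple N V))"
    proof cases
      case 1
      then show ?thesis
        using polyfun_ext_fst[OF polyfun_tuple_fst[OF polyfun_var[OF 1(1)]]] by simp
    next
      case 2
      then show ?thesis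
        using polyfun_ext_fst[OF polyfun_tuple_snd[of i N]] polyfun_ext_snd
        by (cases "i = N") (simp_all add: less_Suc_eq)
    qed
  qed
  from Suc.IH[OF semialg_ex[where P = "\<lambda>s x. P (fst s, (snd s)(N := x))", OF this]]
  have "semialg V (\<lambda>s. \<exists>q\<in>real_tuples N. \<exists>x. P (s, q(N := x)))" by simp
  moreover have "(\<exists>q\<in>real_tuples N. \<exists>x. P (s, q(N := x))) \<longleftrightarrow> (\<exists>q\<in>real_tuples (Suc N). P (s, q))" for s
  proof
    assume "\<exists>q\<in>real_tuples N. \<exists>x. P (s, q(N := x))"
    then obtain q x where "q \<in> real_tuples N" "P (s, q(N := x))" by blast
    then show "\<exists>q\<in>real_tuples (Suc N). P (s, q)"
      by (intro bexI[of _ "q(N := x)"]) (auto simp: topspace_Euclidean_space)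
  next
    assume "\<exists>q\<in>real_tuples (Suc N). P (s, q)"
    then obtain q where "q \<in> real_tuples (Suc N)" "P (s, q)" by blast
    then show "\<exists>q\<in>real_tuples N. \<exists>x. P (s, q(N := x))"
      by (intro bexI[of _ "q(N := 0)"] exI[of _ "q N"])
        (auto simp: topspace_Euclidean_space not_less_eq_eq)
  qed
  ultimately show ?case by simp
qed

lemma semialg_ex_tuple:
  "semialg (ext_tuple N V) (\<lambda>z. P (fst z) (snd z)) \<Longrightarrow> semialg V (\<lambda>s. \<exists>q\<in>real_tuples N. P s q)"
  using semialg_ex_tuple' by fastforce

text \<open>The condition that the coordinates beyond \<open>N\<close> vanish is not a finite conjunction, hence it
  is kept apart from the defining predicate.\<close>

definition semialg_set :: "nat \<Rightarrow> (nat \<Rightarrow> real) set \<Rightarrow> bool" where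
  "semialg_set N S \<longleftrightarrow> (\<exists>P. semialg (coords N) P \<and> S = {x \<in> real_tuples N. P x})"

lemma semialg_bex:
  assumes "semialg_set N S" "semialg (ext_tuple N V) (\<lambda>z. P (fst z) (snd z))"
  shows "semialg V (\<lambda>s. \<exists>q\<in>S. P s q)"
proof -
  obtain Q where Q: "semialg (coords N) Q" "S = {x \<in> real_tuples N. Q x}"
    using assms(1) by (auto simp: semialg_set_def)
  have "semialg (ext_tuple N V) (\<lambda>z. Q (snd z))"
    by (rule semialg_comp[OF Q(1)]) (auto simp: coords_def intro: polyfun_tuple_snd)
  from semialg_ex_tuple[where P = "\<lambda>s q. Q q \<and> P s q", OF semialg_conj[OF this assms(2)]]
  show ?thesis unfolding Q(2) by (simp add: Bex_def conj_assoc)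
qed

lemma semialg_ball:
  assumes "semialg_set N S" "semialg (ext_tuple N V) (\<lambda>z. P (fst z) (snd z))"
  shows "semialg V (\<lambda>s. \<forall>q\<in>S. P s q)"
  using semialg_not[OF semialg_bex[OF assms(1), of V "\<lambda>s x. \<not> P s x"], OF semialg_not[OF assms(2)]] by simp

lemmas polyfun_intros = polyfun_const polyfun_add polyfun_mult polyfun_diff polyfun_uminus
  polyfun_ext_snd polyfun_tuple_snd polyfun_ext_fst polyfun_tuple_fst

section \<open>Semialgebraic subsets of the line\<close>

lemma polyfun_id: "(\<lambda>t. t) \<in> polyfun {\<lambda>t. t}"
  by (rule polyfun_var) simp

lemma polyfun_id_poly:
  assumes "F \<in> polyfun {\<lambda>t. t}" shows "\<exists>p. \<forall>t. F t = poly p t"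
  using assms
proof induction
  case (polyfun_const c)
  show ?case by (rule exI[of _ "[:c:]"]) simp
next
  case (polyfun_var v)
  then show ?case by (intro exI[of _ "[:0, 1:]"]) simp
next
  case (polyfun_add F G)
  then obtain p q where "\<forall>t. F t = poly p t" "\<forall>t. G t = poly q t" by blast
  then show ?case by (intro exI[of _ "p + q"]) simp
next
  case (polyfun_mult F G)
  then obtain p q where "\<forall>t. F t = poly p t" "\<forall>t. G t = poly q t" by blast
  then show ?case by (intro exI[of _ "p * q"]) simp
qed

text \<open>A frontier point of \<open>0 < F\<close> is a root of the polynomial \<open>F\<close>,
  and for the zero polynomial the set is empty. A complement has the same frontier, and the frontier
  of an intersection lies in the union of the frontiers.\<close>

lemma semialg_finite_frontier:
  assumes "semialg {\<lambda>t. t} P" shows "finite (frontier {t. P t})"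
  using assms
proof induction
  case (semialg_pos F)
  then obtain p where p: "\<And>t. F t = poly p t" using polyfun_id_poly by blast
  show ?case
  proof (cases "p = 0")
    case True
    then show ?thesis by (simp add: p)
  next
    case False
    have op: "open {t. 0 < F t}" and cl: "closed {t. 0 \<le> F t}"
      unfolding p by (auto intro!: open_Collect_less closed_Collect_le continuous_intros)
    have "closure {t. 0 < F t} \<subseteq> {t. 0 \<le> F t}"
      by (rule closure_minimal[OF _ cl]) auto
    then have "frontier {t. 0 < F t} \<subseteq> {t. poly p t = 0}"
      unfolding frontier_def interior_open[OF op] by (auto simp: p)
    then show ?thesis using poly_roots_finite[OF False] finite_subset by blast
  qed
next
  case (semialg_not P)
  then show ?case using frontier_complement[of "{t. P t}"] by (simp add: Collect_neg_eq)
next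
  case (semialg_conj P Q)
  then show ?case unfolding Collect_conj_eq
    by (intro finite_subset[OF frontier_Int_subset]) simp
qed

lemma semialg_infinite_interior:
  assumes "semialg {\<lambda>t. t} P" "infinite {t. P t}"
  shows "\<exists>a b. a < b \<and> (\<forall>t. a < t \<longrightarrow> t < b \<longrightarrow> P t)"
proof -
  have "\<not> {t. P t} \<subseteq> frontier {t. P t}"
    using semialg_finite_frontier[OF assms(1)] assms(2) finite_subset by blast
  then obtain t where "P t" "t \<notin> frontier {t. P t}" by blast
  then have "t \<in> interior {t. P t}"
    using closure_subset[of "{t. P t}"] by (auto simp: frontier_def)
  then obtain e where "e > 0" "ball t e \<subseteq> {t. P t}" by (auto simp: mem_interior)
  then show ?thesis
    by (intro exI[of _ "t - e"] exI[of _ "t + e"]) (auto simp: subset_iff dist_real_def)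
qed

text \<open>A short interval to the right of \<open>t\<close> avoids the finite frontier and is
  connected, so it lies inside the set or outside it.\<close>

lemma semialg_eventually_right:
  assumes "semialg {\<lambda>t. t} P"
  shows "(\<exists>e>0. \<forall>h. 0 < h \<longrightarrow> h < e \<longrightarrow> P (t + h)) \<or> (\<exists>e>0. \<forall>h. 0 < h \<longrightarrow> h < e \<longrightarrow> \<not> P (t + h))"
proof -
  have "finite (frontier {t. P t})" by (rule semialg_finite_frontier[OF assms])
  from finite_set_avoid[OF this, of t]
  obtain e where e: "e > 0" "\<And>x. x \<in> frontier {t. P t} \<Longrightarrow> x \<noteq> t \<Longrightarrow> e \<le> dist t x" by metis
  have "{t<..<t + e} \<inter> frontier {t. P t} = {}"
    using e(2) by (fastforce simp: dist_real_def)
  then have "{t<..<t + e} \<inter> {t. P t} = {} \<or> {t<..<t + e} - {t. P t} = {}"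
    using connected_Int_frontier[of "{t<..<t + e}" "{t. P t}"] connected_Ioo[of t "t + e"] by blast
  then show ?thesis
  proof
    assume "{t<..<t + e} \<inter> {t. P t} = {}"
    then have "\<not> P (t + h)" if "0 < h" "h < e" for h using that by (auto simp: set_eq_iff)
    then show ?thesis using e(1) by blast
  next
    assume "{t<..<t + e} - {t. P t} = {}"
    then have "P (t + h)" if "0 < h" "h < e" for h using that by (auto simp: set_eq_iff)
    then show ?thesis using e(1) by blast
  qed
qed

text \<open>A Baire-type principle: countably many semialgebraic sets that cover uncountably many points
  cannot all be finite, so one of them contains an interval.\<close>

lemma semialg_uniform_interval:
  fixes P :: "'i::countable \<Rightarrow> real \<Rightarrow> bool"
  assumes "\<And>k. semialg {\<lambda>t. t} (P k)" "\<not> countable {t. a < t \<and> t < b \<and> (\<exists>k. P k t)}"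
  obtains k a' b' where "a \<le> a'" "a' < b'" "b' \<le> b" "\<And>t. a' < t \<Longrightarrow> t < b' \<Longrightarrow> P k t"
proof -
  have "{t. a < t \<and> t < b \<and> (\<exists>k. P k t)} = (\<Union>k. {t. a < t \<and> t < b \<and> P k t})" by auto
  moreover have "countable (\<Union>k. {t. a < t \<and> t < b \<and> P k t})"
    if "\<And>k. finite {t. a < t \<and> t < b \<and> P k t}"
    using that by (intro countable_UN) (auto intro: countable_finite)
  ultimately obtain k where k: "infinite {t. a < t \<and> t < b \<and> P k t}"
    using assms(2) by auto
  have "semialg {\<lambda>t. t} (\<lambda>t. a < t \<and> t < b \<and> P k t)"
    by (intro semialg_conj semialg_less polyfun_id polyfun_const assms(1))
  from semialg_infinite_interior[OF this k] obtain u v where uv: "u < v"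
    "\<And>t. u < t \<Longrightarrow> t < v \<Longrightarrow> a < t \<and> t < b \<and> P k t" by blast
  have "a \<le> u"
  proof (rule ccontr)
    assume "\<not> a \<le> u"
    then have "u < min ((u + v) / 2) a" "min ((u + v) / 2) a < v" using uv(1) by (auto simp: min_def field_simps)
    then show False using uv(2) by fastforce
  qed
  moreover have "v \<le> b"
  proof (rule ccontr)
    assume "\<not> v \<le> b"
    then have "u < max ((u + v) / 2) b" "max ((u + v) / 2) b < v" using uv(1) by (auto simp: max_def field_simps)
    then show False using uv(2) by fastforce
  qed
  ultimately show ?thesis using that uv by blast
qed

lemma uncountable_interval_minus_countable:
  fixes a b :: real
  assumes "a < b" "countable {t. a < t \<and> t < b \<and> \<not> Q t}"
  shows "\<not> countable {t. a < t \<and> t < b \<and> Q t}"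
proof
  assume "countable {t. a < t \<and> t < b \<and> Q t}"
  then have "countable ({t. a < t \<and> t < b \<and> Q t} \<union> {t. a < t \<and> t < b \<and> \<not> Q t})"
    using assms(2) by simp
  moreover have "{t. a < t \<and> t < b \<and> Q t} \<union> {t. a < t \<and> t < b \<and> \<not> Q t} = {a<..<b}" by auto
  ultimately show False using assms(1) uncountable_open_interval[of a b] by simp
qed

section \<open>Semialgebraic curves and definable choice\<close>

text \<open>The bounds are part of the predicate because nothing is known about \<open>g\<close>
  outside the interval. Whenever \<open>g\<close> is applied to a term inside a formula, the bounds
  for that term have to be carried along.\<close>

definition semialg_curve :: "real \<Rightarrow> real \<Rightarrow> (real \<Rightarrow> real) \<Rightarrow> bool" where
  "semialg_curve a b g \<longleftrightarrow>
     semialg (ext_real {\<lambda>t. t}) (\<lambda>z. a < fst z \<and> fst z < b \<and> snd z = g (fst z))"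

lemma semialg_curve_subinterval:
  assumes "semialg_curve a b g" "a \<le> a'" "b' \<le> b" shows "semialg_curve a' b' g"
proof -
  have "semialg (ext_real {\<lambda>t. t}) (\<lambda>z. (a' < fst z \<and> fst z < b') \<and> (a < fst z \<and> fst z < b \<and> snd z = g (fst z)))"
    by (intro semialg_conj[OF semialg_conj] semialg_less polyfun_intros polyfun_id
        assms(1)[unfolded semialg_curve_def])
  moreover have "(\<lambda>z. (a' < fst z \<and> fst z < b') \<and> (a < fst z \<and> fst z < b \<and> snd z = g (fst z)))
    = (\<lambda>z. a' < fst z \<and> fst z < b' \<and> snd z = g (fst z))" using assms(2,3) by (auto simp: fun_eq_iff)
  ultimately show ?thesis by (simp add: semialg_curve_def)
qed

lemma semialg_curve_graph:
  assumes "semialg_curve a b g" "T \<in> polyfun V" "Y \<in> polyfun V"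
  shows "semialg V (\<lambda>s. a < T s \<and> T s < b \<and> Y s = g (T s))"
proof -
  have "(\<lambda>s. v (T s, Y s)) \<in> polyfun V" if "v \<in> ext_real {\<lambda>t. t}" for v
    using that assms(2,3) by (auto simp: ext_real_def)
  from semialg_comp[OF assms(1)[unfolded semialg_curve_def], of "\<lambda>s. (T s, Y s)", OF this]
  show ?thesis by simp
qed

lemma semialg_relation:
  assumes "semialg (ext_real {\<lambda>t. t}) (\<lambda>z. S (fst z) (snd z))" "T \<in> polyfun V" "Y \<in> polyfun V"
  shows "semialg V (\<lambda>s. S (T s) (Y s))"
proof -
  have "(\<lambda>s. v (T s, Y s)) \<in> polyfun V" if "v \<in> ext_real {\<lambda>t. t}" for v
    using that assms(2,3) by (auto simp: ext_real_def)
  from semialg_comp[OF assms(1), of "\<lambda>s. (T s, Y s)", OF this]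
  show ?thesis by simp
qed

text \<open>On a subinterval either a constant rational value can be chosen, or the fibres have no interior
  and are therefore finite, and their least elements can be chosen.\<close>

lemma semialg_choice_real:
  assumes S: "semialg (ext_real {\<lambda>t. t}) (\<lambda>z. S (fst z) (snd z))" and "a < b"
    and ex: "\<And>t. a < t \<Longrightarrow> t < b \<Longrightarrow> \<exists>y. S t y"
  obtains a' b' g where "a \<le> a'" "a' < b'" "b' \<le> b" "\<And>t. a' < t \<Longrightarrow> t < b' \<Longrightarrow> S t (g t)"
    "semialg_curve a' b' g"
proof (cases "countable {t. a < t \<and> t < b \<and> (\<exists>q::rat. S t (real_of_rat q))}")
  case False
  have "semialg {\<lambda>t. t} (\<lambda>t. S t (real_of_rat q))" for q
    by (rule semialg_relation[OF S polyfun_id polyfun_const])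
  from semialg_uniform_interval[OF this False]
  obtain q a' b' where *: "a \<le> a'" "a' < b'" "b' \<le> b" "\<And>t. a' < t \<Longrightarrow> t < b' \<Longrightarrow> S t (real_of_rat q)"
    by metis
  have "semialg_curve a' b' (\<lambda>_. real_of_rat q)"
    unfolding semialg_curve_def
    by (intro semialg_conj semialg_less semialg_eq polyfun_intros polyfun_id)
  then show ?thesis using that[OF *(1-3), of "\<lambda>_. real_of_rat q"] *(4) by simp
next
  case True
  define M where "M t y \<longleftrightarrow> S t y \<and> (\<forall>y'. S t y' \<longrightarrow> y \<le> y')" for t y
  have Msa: "semialg (ext_real {\<lambda>t. t}) (\<lambda>z. M (fst z) (snd z))"
    unfolding M_def
    by (intro semialg_conj S semialg_all semialg_imp semialg_le polyfun_intros polyfun_id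
        semialg_relation[OF S])
  have "\<exists>y. M t y" if t: "a < t" "t < b" and nr: "\<not> (\<exists>q::rat. S t (real_of_rat q))" for t
  proof -
    have sa: "semialg {\<lambda>t. t} (S t)" by (rule semialg_relation[OF S polyfun_const polyfun_id])
    have "finite {y. S t y}"
    proof (rule ccontr)
      assume "infinite {y. S t y}"
      from semialg_infinite_interior[OF sa this] obtain u v where
        "u < v" "\<And>y. u < y \<Longrightarrow> y < v \<Longrightarrow> S t y" by blast
      then show False using nr of_rat_dense[of u v] by blast
    qed
    then have "M t (Min {y. S t y})"
      unfolding M_def using Min_in[of "{y. S t y}"] ex[OF t] by auto
    then show ?thesis by blast
  qed
  then have "countable {t. a < t \<and> t < b \<and> \<not> (\<exists>y. M t y)}"
    by (intro countable_subset[OF _ True]) blast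
  \<comment> \<open>The index type \<open>unit\<close> makes a single set into a family, so that the
    interval principle applies to it.\<close>
  then have unc: "\<not> countable {t. a < t \<and> t < b \<and> (\<exists>k::unit. \<exists>y. M t y)}"
    using uncountable_interval_minus_countable[OF \<open>a < b\<close>, of "\<lambda>t. \<exists>y. M t y"] by simp
  have "semialg {\<lambda>t. t} (\<lambda>t. \<exists>y. M t y)" by (rule semialg_ex[OF Msa])
  from semialg_uniform_interval[OF this unc]
  obtain a' b' where *: "a \<le> a'" "a' < b'" "b' \<le> b" "\<And>t. a' < t \<Longrightarrow> t < b' \<Longrightarrow> \<exists>y. M t y" by metis
  define g where "g t = (SOME y. M t y)" for t
  have g: "M t (g t)" if "a' < t" "t < b'" for t using *(4)[OF that] unfolding g_def by (rule someI_ex)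
  \<comment> \<open>A least element is unique, so over this interval the relation \<open>M\<close>
    is the graph of \<open>g\<close>, however \<open>g\<close> was picked.\<close>
  have "(\<lambda>z. a' < fst z \<and> fst z < b' \<and> M (fst z) (snd z)) = (\<lambda>z. a' < fst z \<and> fst z < b' \<and> snd z = g (fst z))"
    using g by (auto simp: fun_eq_iff M_def intro: antisym)
  moreover have "semialg (ext_real {\<lambda>t. t}) (\<lambda>z. a' < fst z \<and> fst z < b' \<and> M (fst z) (snd z))"
    by (intro semialg_conj semialg_less polyfun_intros polyfun_id Msa)
  ultimately have "semialg_curve a' b' g" by (simp add: semialg_curve_def)
  moreover have "S t (g t)" if "a' < t" "t < b'" for t using g[OF that] by (simp add: M_def)
  ultimately show ?thesis using that *(1-3) by blast
qed

text \<open>The coordinates are chosen one after another, each time on a smaller interval; the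
  chosen values of the earlier coordinates are semialgebraic curves and can be imposed in the
  formula for the next one.\<close>

lemma semialg_choice_tuple:
  assumes Z: "semialg (ext_tuple N {\<lambda>t. t}) (\<lambda>z. Z (fst z) (snd z))" and "a < b"
    and ex: "\<And>t. a < t \<Longrightarrow> t < b \<Longrightarrow> \<exists>q\<in>real_tuples N. Z t q"
  obtains a' b' \<gamma> where "a \<le> a'" "a' < b'" "b' \<le> b"
    "\<And>t. a' < t \<Longrightarrow> t < b' \<Longrightarrow> \<gamma> t \<in> real_tuples N \<and> Z t (\<gamma> t)"
    "\<And>i. i < N \<Longrightarrow> semialg_curve a' b' (\<lambda>t. \<gamma> t i)"
proof -
  have "\<exists>a' b' g. a \<le> a' \<and> a' < b' \<and> b' \<le> b \<and> (\<forall>i<k. semialg_curve a' b' (g i)) \<and>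
      (\<forall>t. a' < t \<longrightarrow> t < b' \<longrightarrow> (\<exists>q\<in>real_tuples N. Z t q \<and> (\<forall>i<k. q i = g i t)))" if "k \<le> N" for k
    using that
  proof (induction k)
    case 0
    then show ?case using \<open>a < b\<close> ex by (intro exI[of _ a] exI[of _ b]) auto
  next
    case (Suc k)
    from Suc.IH[OF Suc_leD[OF Suc.prems]] obtain a1 b1 g where
      1: "a \<le> a1" "a1 < b1" "b1 \<le> b" "\<And>i. i < k \<Longrightarrow> semialg_curve a1 b1 (g i)"
      "\<And>t. a1 < t \<Longrightarrow> t < b1 \<Longrightarrow> \<exists>q\<in>real_tuples N. Z t q \<and> (\<forall>i<k. q i = g i t)"
      by blast
    \<comment> \<open>The possible values of coordinate \<open>k\<close> among the points whose
      first \<open>k\<close> coordinates agree with the curves already chosen.\<close>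
    define S where "S t y \<longleftrightarrow> (\<exists>q\<in>real_tuples N. Z t q \<and>
      (\<forall>i\<in>{..<k}. a1 < t \<and> t < b1 \<and> q i = g i t) \<and> q k = y)" for t y
    have "semialg (ext_tuple N (ext_real {\<lambda>t. t})) (\<lambda>z. Z (fst (fst z)) (snd z))"
    proof -
      have "(\<lambda>z. v (fst (fst z), snd z)) \<in> polyfun (ext_tuple N (ext_real {\<lambda>t. t}))"
        if "v \<in> ext_tuple N {\<lambda>t. t}" for v
      proof -
        consider "v = fst" | i where "i < N" "v = (\<lambda>z. snd z i)"
          using \<open>v \<in> _\<close> by (auto simp: ext_tuple_def)
        then show ?thesis
          by cases (auto intro!: polyfun_tuple_fst polyfun_ext_fst polyfun_id polyfun_tuple_snd)
      qed
      from semialg_comp[OF Z, of "\<lambda>z. (fst (fst z), snd z)", OF this] show ?thesis by simp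
    qed
    moreover have "semialg (ext_tuple N (ext_real {\<lambda>t. t}))
        (\<lambda>z. a1 < fst (fst z) \<and> fst (fst z) < b1 \<and> snd z i = g i (fst (fst z)))" if "i \<in> {..<k}" for i
    proof -
      have "i < k" "i < N" using that Suc.prems by auto
      then show ?thesis
        by (intro semialg_curve_graph[OF 1(4)] polyfun_tuple_snd polyfun_tuple_fst polyfun_ext_fst polyfun_id)
    qed
    moreover have "semialg (ext_tuple N (ext_real {\<lambda>t. t})) (\<lambda>z. snd z k = snd (fst z))"
      using Suc.prems by (intro semialg_eq polyfun_tuple_snd polyfun_tuple_fst polyfun_ext_snd) simp
    ultimately have Ssa: "semialg (ext_real {\<lambda>t. t}) (\<lambda>z. S (fst z) (snd z))"
      unfolding S_def
      by - (rule semialg_ex_tuple, rule semialg_conj, assumption, rule semialg_conj,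
          rule semialg_ball_finite, rule finite_lessThan)
    have Sex: "\<exists>y. S t y" if "a1 < t" "t < b1" for t
      using 1(5)[OF that] that unfolding S_def by auto
    obtain a2 b2 g' where 2: "a1 \<le> a2" "a2 < b2" "b2 \<le> b1"
      "\<And>t. a2 < t \<Longrightarrow> t < b2 \<Longrightarrow> S t (g' t)" "semialg_curve a2 b2 g'"
      using semialg_choice_real[where S = S, OF Ssa 1(2) Sex] by blast
    have "\<exists>q\<in>real_tuples N. Z t q \<and> (\<forall>i<Suc k. q i = (g(k := g')) i t)" if "a2 < t" "t < b2" for t
      using 2(4)[OF that] unfolding S_def by (auto simp: less_Suc_eq)
    moreover have "semialg_curve a2 b2 ((g(k := g')) i)" if "i < Suc k" for i
      using that 2 1(4)[of i] semialg_curve_subinterval[of a1 b1 "g i" a2 b2] by (auto simp: less_Suc_eq)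
    ultimately show ?case using 1 2
      by (intro exI[of _ a2] exI[of _ b2] exI[of _ "g(k := g')"]) auto
  qed
  from this[OF order_refl] obtain a' b' g where *: "a \<le> a'" "a' < b'" "b' \<le> b"
    "\<And>i. i < N \<Longrightarrow> semialg_curve a' b' (g i)"
    "\<And>t. a' < t \<Longrightarrow> t < b' \<Longrightarrow> \<exists>q\<in>real_tuples N. Z t q \<and> (\<forall>i<N. q i = g i t)" by blast
  define \<gamma> where "\<gamma> t = (\<lambda>i. if i < N then g i t else 0)" for t
  have "\<gamma> t \<in> real_tuples N \<and> Z t (\<gamma> t)" if "a' < t" "t < b'" for t
  proof -
    from *(5)[OF that] obtain q where
      q: "q \<in> real_tuples N" "Z t q" "\<And>i. i < N \<Longrightarrow> q i = g i t" by blast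
    then have "q = \<gamma> t" by (auto simp: \<gamma>_def topspace_Euclidean_space fun_eq_iff)
    then show ?thesis using q by simp
  qed
  moreover have "semialg_curve a' b' (\<lambda>t. \<gamma> t i)" if "i < N" for i
    using *(4)[OF that] that by (simp add: \<gamma>_def)
  ultimately show ?thesis using that *(1-3) by blast
qed

section \<open>Differentiability of semialgebraic curves\<close>

lemma semialg_sgn: "F \<in> polyfun V \<Longrightarrow> semialg V (\<lambda>s. sgn (F s) = r)"
  by (rule simple_on_pred[OF simple_on_sgn])

text \<open>Within distance \<open>c\<close> of \<open>t\<close>, on the side \<open>e = 1\<close>
  or \<open>e = -1\<close>, the graph is compared with the line of slope \<open>K\<close> through
  \<open>(t, g t)\<close>: the sign \<open>r\<close> tells whether it is above, on or below that
  line.\<close>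

definition slope_sign :: "(real \<Rightarrow> real) \<Rightarrow> real \<Rightarrow> real \<Rightarrow> real \<Rightarrow> real \<Rightarrow> real \<Rightarrow> real \<Rightarrow> real \<Rightarrow> bool" where
  "slope_sign g a b e K c r t \<longleftrightarrow>
     (\<forall>h. 0 < h \<and> h < c \<longrightarrow> a < t + e * h \<and> t + e * h < b \<longrightarrow> sgn (g (t + e * h) - g t - K * (e * h)) = r)"

lemma slope_signD:
  "slope_sign g a b e K c r t \<Longrightarrow> 0 < h \<Longrightarrow> h < c \<Longrightarrow> a < t + e * h \<Longrightarrow> t + e * h < b \<Longrightarrow>
    sgn (g (t + e * h) - g t - K * (e * h)) = r"
  by (simp add: slope_sign_def)

lemma slope_sign_mono: "slope_sign g a b e K c r t \<Longrightarrow> c' \<le> c \<Longrightarrow> slope_sign g a b e K c' r t"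
  by (auto simp: slope_sign_def)

text \<open>Since \<open>g\<close> is accessible only through its graph, its two values enter the
  formula as universally quantified variables \<open>y\<close> and \<open>y'\<close> tied to the
  graph.\<close>

lemma semialg_slope_sign:
  assumes g: "semialg_curve a b g" and T: "T \<in> polyfun V" and K: "K \<in> polyfun V" and C: "C \<in> polyfun V"
  shows "semialg V (\<lambda>s. a < T s \<and> T s < b \<and> slope_sign g a b e (K s) (C s) r (T s))"
proof -
  let ?V = "ext_real (ext_real (ext_real V))"
  have T': "(\<lambda>z. T (fst (fst (fst z)))) \<in> polyfun ?V" and K': "(\<lambda>z. K (fst (fst (fst z)))) \<in> polyfun ?V"
    and C': "(\<lambda>z. C (fst (fst (fst z)))) \<in> polyfun ?V"
    by (intro polyfun_ext_fst T K C)+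
  have h: "(\<lambda>z. snd (fst (fst z))) \<in> polyfun ?V" and y: "(\<lambda>z. snd (fst z)) \<in> polyfun ?V"
    and y': "(\<lambda>z. snd z) \<in> polyfun ?V"
    by (intro polyfun_ext_fst polyfun_ext_snd)+
  have Te: "(\<lambda>z. T (fst (fst (fst z))) + e * snd (fst (fst z))) \<in> polyfun ?V"
    by (intro polyfun_add polyfun_mult polyfun_const T' h)
  have "semialg ?V (\<lambda>z. (0 < snd (fst (fst z)) \<and> snd (fst (fst z)) < C (fst (fst (fst z)))) \<and>
      (a < T (fst (fst (fst z))) \<and> T (fst (fst (fst z))) < b \<and> snd (fst z) = g (T (fst (fst (fst z))))) \<and>
      (a < T (fst (fst (fst z))) + e * snd (fst (fst z)) \<and> T (fst (fst (fst z))) + e * snd (fst (fst z)) < b \<and>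
        snd z = g (T (fst (fst (fst z))) + e * snd (fst (fst z)))) \<longrightarrow>
      sgn (snd z - snd (fst z) - K (fst (fst (fst z))) * (e * snd (fst (fst z)))) = r)"
    by (rule semialg_imp[OF semialg_conj[OF semialg_conj[OF semialg_less[OF polyfun_const h] semialg_less[OF h C']]
            semialg_conj[OF semialg_curve_graph[OF g T' y] semialg_curve_graph[OF g Te y']]]
          semialg_sgn[OF polyfun_diff[OF polyfun_diff[OF y' y] polyfun_mult[OF K' polyfun_mult[OF polyfun_const h]]]]])
  from semialg_all[where P = "\<lambda>s y'. (0 < snd (fst s) \<and> snd (fst s) < C (fst (fst s))) \<and>
      (a < T (fst (fst s)) \<and> T (fst (fst s)) < b \<and> snd s = g (T (fst (fst s)))) \<and>
      (a < T (fst (fst s)) + e * snd (fst s) \<and> T (fst (fst s)) + e * snd (fst s) < b \<and>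
        y' = g (T (fst (fst s)) + e * snd (fst s))) \<longrightarrow>
      sgn (y' - snd s - K (fst (fst s)) * (e * snd (fst s))) = r", OF this]
  have "semialg (ext_real (ext_real V)) (\<lambda>s. \<forall>y'. (0 < snd (fst s) \<and> snd (fst s) < C (fst (fst s))) \<and>
      (a < T (fst (fst s)) \<and> T (fst (fst s)) < b \<and> snd s = g (T (fst (fst s)))) \<and>
      (a < T (fst (fst s)) + e * snd (fst s) \<and> T (fst (fst s)) + e * snd (fst s) < b \<and>
        y' = g (T (fst (fst s)) + e * snd (fst s))) \<longrightarrow>
      sgn (y' - snd s - K (fst (fst s)) * (e * snd (fst s))) = r)" .
  from semialg_all[where P = "\<lambda>s y. \<forall>y'. (0 < snd s \<and> snd s < C (fst s)) \<and>
      (a < T (fst s) \<and> T (fst s) < b \<and> y = g (T (fst s))) \<and>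
      (a < T (fst s) + e * snd s \<and> T (fst s) + e * snd s < b \<and> y' = g (T (fst s) + e * snd s)) \<longrightarrow>
      sgn (y' - y - K (fst s) * (e * snd s)) = r", OF this]
  have "semialg (ext_real V) (\<lambda>s. \<forall>y y'. (0 < snd s \<and> snd s < C (fst s)) \<and>
      (a < T (fst s) \<and> T (fst s) < b \<and> y = g (T (fst s))) \<and>
      (a < T (fst s) + e * snd s \<and> T (fst s) + e * snd s < b \<and> y' = g (T (fst s) + e * snd s)) \<longrightarrow>
      sgn (y' - y - K (fst s) * (e * snd s)) = r)" .
  from semialg_all[where P = "\<lambda>s h. \<forall>y y'. (0 < h \<and> h < C s) \<and>
      (a < T s \<and> T s < b \<and> y = g (T s)) \<and>
      (a < T s + e * h \<and> T s + e * h < b \<and> y' = g (T s + e * h)) \<longrightarrow>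
      sgn (y' - y - K s * (e * h)) = r", OF this]
  have "semialg V (\<lambda>s. \<forall>h y y'. (0 < h \<and> h < C s) \<and>
      (a < T s \<and> T s < b \<and> y = g (T s)) \<and>
      (a < T s + e * h \<and> T s + e * h < b \<and> y' = g (T s + e * h)) \<longrightarrow>
      sgn (y' - y - K s * (e * h)) = r)" .
  from semialg_conj[OF semialg_conj[OF semialg_less[OF polyfun_const T] semialg_less[OF T polyfun_const]] this]
  have "semialg V (\<lambda>s. (a < T s \<and> T s < b) \<and> (\<forall>h y y'. (0 < h \<and> h < C s) \<and>
      (a < T s \<and> T s < b \<and> y = g (T s)) \<and>
      (a < T s + e * h \<and> T s + e * h < b \<and> y' = g (T s + e * h)) \<longrightarrow>
      sgn (y' - y - K s * (e * h)) = r))" .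
  moreover have "(\<lambda>s. (a < T s \<and> T s < b) \<and> (\<forall>h y y'. (0 < h \<and> h < C s) \<and>
      (a < T s \<and> T s < b \<and> y = g (T s)) \<and>
      (a < T s + e * h \<and> T s + e * h < b \<and> y' = g (T s + e * h)) \<longrightarrow>
      sgn (y' - y - K s * (e * h)) = r)) = (\<lambda>s. a < T s \<and> T s < b \<and> slope_sign g a b e (K s) (C s) r (T s))"
    unfolding slope_sign_def by (intro ext) blast
  ultimately show ?thesis by simp
qed

text \<open>For each of the three signs, the set of \<open>h\<close> where it occurs is
  semialgebraic and thus eventually holds or eventually fails as \<open>h\<close> tends to 0 from
  the right. Not all three can fail.\<close>

lemma slope_sign_exists:
  assumes g: "semialg_curve a b g" and t: "a < t" "t < b"
  shows "\<exists>r\<in>{-1, 0, 1 :: int}. \<exists>c>0. slope_sign g a b e K c (real_of_int r) t"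
proof -
  define D where "D r h \<longleftrightarrow> (\<exists>y. (a < t + e * h \<and> t + e * h < b \<and> y = g (t + e * h)) \<and>
    sgn (y - g t - K * (e * h)) = r)" for r h
  have D: "semialg {\<lambda>t. t} (D r)" for r
  proof -
    have h: "(\<lambda>z. fst z) \<in> polyfun (ext_real {\<lambda>t. t})" by (intro polyfun_ext_fst polyfun_id)
    have te: "(\<lambda>z. t + e * fst z) \<in> polyfun (ext_real {\<lambda>t. t})"
      by (intro polyfun_add polyfun_mult polyfun_const h)
    show ?thesis unfolding D_def
      by (rule semialg_ex[OF semialg_conj[OF semialg_curve_graph[OF g te polyfun_ext_snd]
        semialg_sgn[OF polyfun_diff[OF polyfun_diff[OF polyfun_ext_snd polyfun_const]
          polyfun_mult[OF polyfun_const polyfun_mult[OF polyfun_const h]]]]]])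
  qed
  have "\<exists>r\<in>{-1, 0, 1 :: int}. \<exists>c>0. \<forall>h. 0 < h \<longrightarrow> h < c \<longrightarrow> D (real_of_int r) h"
  proof (rule ccontr)
    assume n: "\<not> ?thesis"
    have "\<exists>c>0. \<forall>h. 0 < h \<longrightarrow> h < c \<longrightarrow> \<not> D (real_of_int r) h" if "r \<in> {-1, 0, 1}" for r
    proof -
      from semialg_eventually_right[OF D[of "real_of_int r"], of 0] n that show ?thesis by auto
    qed
    then obtain c where c: "\<And>r. r \<in> {-1, 0, 1} \<Longrightarrow> c r > 0 \<and> (\<forall>h. 0 < h \<longrightarrow> h < c r \<longrightarrow> \<not> D (real_of_int r) h)"
      by metis
    \<comment> \<open>The last two entries keep \<open>t + e * m\<close> inside the interval; the
      summand 1 makes the denominators positive for every \<open>e\<close>.\<close>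
    define L where "L = Min {c (-1), c 0, c 1, (t - a) / (\<bar>e\<bar> + 1), (b - t) / (\<bar>e\<bar> + 1)}"
    define m where "m = L / 2"
    have cp: "c (-1) > 0" "c 0 > 0" "c 1 > 0" using c by auto
    have "L > 0" using cp t by (simp add: L_def add_nonneg_pos)
    moreover have "L \<le> c (-1)" "L \<le> c 0" "L \<le> c 1" "L \<le> (t - a) / (\<bar>e\<bar> + 1)" "L \<le> (b - t) / (\<bar>e\<bar> + 1)"
      unfolding L_def by (rule Min_le; simp)+
    ultimately have m: "0 < m" "m < c (-1)" "m < c 0" "m < c 1" "m < (t - a) / (\<bar>e\<bar> + 1)" "m < (b - t) / (\<bar>e\<bar> + 1)"
      unfolding m_def by linarith+
    have "\<bar>e * m\<bar> \<le> (\<bar>e\<bar> + 1) * m" using m(1) by (simp add: abs_mult)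
    moreover have "(\<bar>e\<bar> + 1) * m < t - a" "(\<bar>e\<bar> + 1) * m < b - t"
      using m(5,6) by (simp_all add: pos_less_divide_eq mult.commute add_pos_nonneg)
    ultimately have "a < t + e * m" "t + e * m < b" by linarith+
    then have "D (sgn (g (t + e * m) - g t - K * (e * m))) m" by (simp add: D_def)
    moreover have "\<not> D (-1) m" "\<not> D 0 m" "\<not> D 1 m" using c[of "-1"] c[of 0] c[of 1] m by auto
    ultimately show False by (auto simp: sgn_if split: if_splits)
  qed
  then show ?thesis unfolding D_def slope_sign_def by (auto 0 4)
qed

lemma archimedean_inverse_Suc: "0 < c \<Longrightarrow> \<exists>n. 1 / real (Suc n) \<le> c"
  using reals_Archimedean[of c] by (auto simp: inverse_eq_divide intro: less_imp_le)

text \<open>With rational \<open>K\<close> and scales \<open>1 / (n + 1)\<close> there are countably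
  many cases, so uncountably many exceptions would give an interval with common data. There one
  increment of \<open>g - K * id\<close>, read from its left and from its right end, has the signs
  \<open>r\<close> and \<open>r'\<close>, which must be opposite.\<close>

lemma countable_slope_mismatch:
  assumes g: "semialg_curve a b g"
  shows "countable {t. a < t \<and> t < b \<and> (\<exists>K::rat. \<exists>r r'::int. \<exists>c>0. r' \<noteq> - r \<and>
    slope_sign g a b 1 (of_rat K) c (of_int r) t \<and> slope_sign g a b (-1) (of_rat K) c (of_int r') t)}"
    (is "countable ?B")
proof (rule ccontr)
  define P :: "rat \<times> int \<times> int \<times> nat \<Rightarrow> real \<Rightarrow> bool" where
    "P = (\<lambda>(K, r, r', n) t. r' \<noteq> - r \<and>
      (a < t \<and> t < b \<and> slope_sign g a b 1 (of_rat K) (1 / real (Suc n)) (of_int r) t) \<and>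
      (a < t \<and> t < b \<and> slope_sign g a b (-1) (of_rat K) (1 / real (Suc n)) (of_int r') t))"
  have sa: "semialg {\<lambda>t. t} (P k)" for k
    unfolding P_def case_prod_beta
    by (rule semialg_conj[OF semialg_const semialg_conj[OF semialg_slope_sign[OF g polyfun_id polyfun_const polyfun_const]
          semialg_slope_sign[OF g polyfun_id polyfun_const polyfun_const]]])
  assume "\<not> countable ?B"
  moreover have "?B \<subseteq> {t. a < t \<and> t < b \<and> (\<exists>k. P k t)}"
  proof
    fix t assume "t \<in> ?B"
    then obtain K r r' c where t: "a < t" "t < b" "c > 0" "r' \<noteq> - r"
      "slope_sign g a b 1 (of_rat K) c (of_int r) t" "slope_sign g a b (-1) (of_rat K) c (of_int r') t" by blast
    obtain n where "1 / real (Suc n) \<le> c" using archimedean_inverse_Suc[OF t(3)] by blast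
    then have "P (K, r, r', n) t" unfolding P_def using t by (auto intro: slope_sign_mono)
    then show "t \<in> {t. a < t \<and> t < b \<and> (\<exists>k. P k t)}" using t by blast
  qed
  ultimately have "\<not> countable {t. a < t \<and> t < b \<and> (\<exists>k. P k t)}"
    using countable_subset by blast
  from semialg_uniform_interval[OF sa this] obtain k u v where
    uv: "a \<le> u" "u < v" "v \<le> b" "\<And>t. u < t \<Longrightarrow> t < v \<Longrightarrow> P k t" by metis
  obtain K r r' n where k: "k = (K, r, r', n)" by (cases k) auto
  define h where "h = min (1 / real (Suc n)) (v - u) / 3"
  have hc: "0 < h" "h < 1 / real (Suc n)" and h2: "h < (v - u) / 2"
    using uv(2) by (auto simp: h_def min_def field_simps)
  \<comment> \<open>The points satisfy \<open>t = s + h\<close>: the forward step from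
    \<open>s\<close> and the backward step from \<open>t\<close> span the same segment.\<close>
  define s t where "s = u + h" and "t = u + h + h"
  have st: "u < s" "s < v" "u < t" "t < v" using hc h2 by (auto simp: s_def t_def field_simps)
  have "sgn (g (s + 1 * h) - g s - of_rat K * (1 * h)) = of_int r"
    by (rule slope_signD[of g a b 1 "of_rat K" "1 / real (Suc n)"])
      (use uv(4)[OF st(1,2)] k st uv hc in \<open>auto simp: P_def s_def t_def\<close>)
  moreover have "sgn (g (t + (-1) * h) - g t - of_rat K * ((-1) * h)) = of_int r'"
    by (rule slope_signD[of g a b "-1" "of_rat K" "1 / real (Suc n)"])
      (use uv(4)[OF st(3,4)] k st uv hc in \<open>auto simp: P_def s_def t_def\<close>)
  moreover have "g (t + (-1) * h) - g t - of_rat K * ((-1) * h) = - (g (s + 1 * h) - g s - of_rat K * (1 * h))"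
    by (simp add: s_def t_def algebra_simps)
  ultimately have "real_of_int r' = - real_of_int r" by (metis sgn_minus)
  then have "r' = - r" by linarith
  then show False using uv(4)[OF st(1,2)] k by (simp add: P_def)
qed

text \<open>The exceptional points have right derivative plus infinity. If there were uncountably
  many, they would fill an interval, on a part of which \<open>g\<close> is strictly increasing.
  Then the graph, rising faster than any line at each point, would overtake a chord of finite
  slope.\<close>

lemma countable_slope_infinite:
  assumes g: "semialg_curve a b g"
  shows "countable {t. a < t \<and> t < b \<and> (\<forall>K. \<exists>c>0. slope_sign g a b 1 K c 1 t)}" (is "countable ?B")
proof (rule ccontr)
  define Q where "Q t \<longleftrightarrow> (\<forall>K. \<exists>c. 0 < c \<and> (a < t \<and> t < b \<and> slope_sign g a b 1 K c 1 t))" for t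
  have "semialg {\<lambda>t. t} Q" unfolding Q_def
    by (intro semialg_all semialg_ex) (rule semialg_conj[OF semialg_less semialg_slope_sign[OF g]];
      intro polyfun_const polyfun_ext_snd polyfun_ext_fst polyfun_id)
  then have sa: "semialg {\<lambda>t. t} (\<lambda>t. Q t)" for k :: unit by simp
  assume "\<not> countable ?B"
  moreover have "?B = {t. a < t \<and> t < b \<and> (\<exists>k::unit. Q t)}" by (auto simp: Q_def)
  ultimately have "\<not> countable {t. a < t \<and> t < b \<and> (\<exists>k::unit. Q t)}" by simp
  from semialg_uniform_interval[OF sa this] obtain a1 b1 where
    1: "a \<le> a1" "a1 < b1" "b1 \<le> b" "\<And>t. a1 < t \<Longrightarrow> t < b1 \<Longrightarrow> Q t" by metis
  define P where "P n t \<longleftrightarrow> a < t \<and> t < b \<and> slope_sign g a b 1 0 (1 / real (Suc n)) 1 t" for n :: nat and t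
  have P: "semialg {\<lambda>t. t} (P n)" for n unfolding P_def
    by (rule semialg_slope_sign[OF g polyfun_id polyfun_const polyfun_const])
  have "\<exists>n. P n t" if t: "a1 < t" "t < b1" for t
  proof -
    obtain c where c: "c > 0" "slope_sign g a b 1 0 c 1 t" using 1(4)[OF t] unfolding Q_def by blast
    obtain n where "1 / real (Suc n) \<le> c" using archimedean_inverse_Suc[OF c(1)] by blast
    then show ?thesis using slope_sign_mono[OF c(2)] t 1 unfolding P_def by (intro exI[of _ n]) auto
  qed
  then have "{t. a1 < t \<and> t < b1 \<and> (\<exists>n. P n t)} = {a1<..<b1}" by auto
  then have "\<not> countable {t. a1 < t \<and> t < b1 \<and> (\<exists>n. P n t)}"
    using 1(2) uncountable_open_interval[of a1 b1] by simp
  from semialg_uniform_interval[OF P this] obtain n a2 b2 where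
    2: "a1 \<le> a2" "a2 < b2" "b2 \<le> b1" "\<And>t. a2 < t \<Longrightarrow> t < b2 \<Longrightarrow> P n t" by metis
  define h where "h = min (1 / real (Suc n)) (b2 - a2) / 3"
  have hc: "0 < h" "h < 1 / real (Suc n)" and h2: "h < (b2 - a2) / 2"
    using 2(2) by (auto simp: h_def min_def field_simps)
  define u v where "u = a2 + h" and "v = a2 + h + h"
  have uv: "a2 < u" "u < v" "v < b2" using hc h2 by (auto simp: u_def v_def field_simps)
  \<comment> \<open>The distance of \<open>u\<close> and \<open>v\<close> is below the common scale
    \<open>1 / (n + 1)\<close>, so the comparison with slope 0 applies to any two points between
    them.\<close>
  have incr: "g x < g y" if "u \<le> x" "x < y" "y \<le> v" for x y
  proof -
    have "sgn (g (x + 1 * (y - x)) - g x - 0 * (1 * (y - x))) = 1"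
      by (rule slope_signD[of g a b 1 0 "1 / real (Suc n)"])
        (use 2(4)[of x] that uv hc 1 2(1,3) in \<open>auto simp: P_def u_def v_def\<close>)
    then show ?thesis by (simp add: sgn_1_pos)
  qed
  \<comment> \<open>A slope larger than that of the chord from \<open>u\<close> to \<open>v\<close>,
    so the line of slope \<open>K\<close> through \<open>(u, g u)\<close> is above the graph at
    \<open>v\<close>. The last point \<open>m\<close> of \<open>Y\<close> is then sought for a
    contradiction.\<close>
  define K where "K = (g v - g u) / (v - u) + 1"
  have Kuv: "g v - g u < K * (v - u)" using uv by (simp add: K_def distrib_right)
  have Kpos: "K > 0" using incr[of u v] uv by (simp add: K_def add_pos_pos)
  define Y where "Y = {x. u \<le> x \<and> x \<le> v \<and> g x - g u \<ge> K * (x - u)}"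
  define m where "m = Sup Y"
  have uY: "u \<in> Y" using uv by (simp add: Y_def)
  have bdd: "bdd_above Y" by (rule bdd_aboveI[of _ v]) (simp add: Y_def)
  have m: "u \<le> m" "m \<le> v"
  proof -
    show "u \<le> m" unfolding m_def by (rule cSup_upper[OF uY bdd])
    show "m \<le> v" unfolding m_def
    proof (rule cSup_least)
      show "Y \<noteq> {}" using uY by blast
      show "x \<le> v" if "x \<in> Y" for x using that by (simp add: Y_def)
    qed
  qed
  \<comment> \<open>The supremum belongs to \<open>Y\<close>: monotonicity of \<open>g\<close> takes
    the place of continuity, since \<open>g x \<le> g m\<close> for the points \<open>x\<close> of
    \<open>Y\<close> close to \<open>m\<close>.\<close>
  have gm: "g m - g u \<ge> K * (m - u)"
  proof (rule ccontr)
    assume "\<not> ?thesis"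
    then have lt: "(g m - g u) / K < m - u" using Kpos by (simp add: field_simps)
    then have "u + (g m - g u) / K < Sup Y" by (simp add: m_def)
    then obtain x where x: "x \<in> Y" "u + (g m - g u) / K < x"
      using less_cSup_iff[of Y] uY bdd by blast
    have "x \<le> m" unfolding m_def by (rule cSup_upper[OF x(1) bdd])
    then have "g x \<le> g m" using incr[of x m] x(1) m by (cases "x = m") (auto simp: Y_def)
    moreover have "g m - g u < K * (x - u)" using x(2) Kpos by (simp add: field_simps)
    moreover have "K * (x - u) \<le> g x - g u" using x(1) by (simp add: Y_def)
    ultimately show False by linarith
  qed
  show False
  proof (cases "m = v")
    case True
    then show False using gm Kuv by simp
  next
    case False
    then have mv: "m < v" using m by simp
    have "Q m" using 1(4)[of m] m uv 2 by simp
    then obtain c where c: "c > 0" "slope_sign g a b 1 K c 1 m" unfolding Q_def by blast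
    define d where "d = min c (v - m) / 2"
    have d: "0 < d" "d < c" "d < v - m" using c(1) mv by (auto simp: d_def min_def field_simps)
    have "sgn (g (m + 1 * d) - g m - K * (1 * d)) = 1"
      by (rule slope_signD[OF c(2)]) (use d m uv 1 2 in auto)
    then have "g (m + d) - g m > K * d" by (simp add: sgn_1_pos)
    then have "m + d \<in> Y" using gm d m by (auto simp: Y_def algebra_simps)
    then show False using cSup_upper[OF _ bdd, of "m + d"] d(1) by (simp add: m_def)
  qed
qed

lemma semialg_curve_uminus:
  assumes "semialg_curve a b g" shows "semialg_curve a b (\<lambda>t. - g t)"
proof -
  have "semialg (ext_real {\<lambda>t. t}) (\<lambda>z. a < fst z \<and> fst z < b \<and> - snd z = g (fst z))"
    by (rule semialg_curve_graph[OF assms]) (intro polyfun_uminus polyfun_ext_fst polyfun_ext_snd polyfun_id)+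
  moreover have "(\<lambda>z. a < fst z \<and> fst z < b \<and> - snd z = g (fst z)) = (\<lambda>z. a < fst z \<and> fst z < b \<and> snd z = - g (fst z))"
    by (auto simp: fun_eq_iff)
  ultimately show ?thesis by (simp add: semialg_curve_def)
qed

lemma slope_sign_antimono:
  assumes "slope_sign g a b 1 K c 1 t" "K' \<le> K" shows "slope_sign g a b 1 K' c 1 t"
  unfolding slope_sign_def
proof (intro allI impI)
  fix h assume h: "0 < h \<and> h < c" "a < t + 1 * h \<and> t + 1 * h < b"
  have "sgn (g (t + 1 * h) - g t - K * (1 * h)) = 1"
    by (rule slope_signD[OF assms(1)]) (use h in auto)
  then have "g (t + h) - g t - K * h > 0" by (simp add: sgn_1_pos)
  moreover have "K' * h \<le> K * h" using assms(2) h by (intro mult_right_mono) auto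
  ultimately show "sgn (g (t + 1 * h) - g t - K' * (1 * h)) = 1" by (simp add: sgn_1_pos)
qed

text \<open>The derivative at \<open>t\<close> is a Dedekind cut of slopes, decided by comparison
  with lines on the right. Three countable sets are excluded: a side-dependent comparison, right
  slope plus infinity, and right slope minus infinity.\<close>

lemma semialg_curve_differentiable:
  assumes g: "semialg_curve a b g"
  shows "countable {t. a < t \<and> t < b \<and> \<not> (\<exists>d. (g has_real_derivative d) (at t))}"
proof -
  define B1 where "B1 = {t. a < t \<and> t < b \<and> (\<exists>K::rat. \<exists>r r'::int. \<exists>c>0. r' \<noteq> - r \<and>
    slope_sign g a b 1 (of_rat K) c (of_int r) t \<and> slope_sign g a b (-1) (of_rat K) c (of_int r') t)}"
  define B2 where "B2 = {t. a < t \<and> t < b \<and> (\<forall>K. \<exists>c>0. slope_sign g a b 1 K c 1 t)}"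
  define B3 where "B3 = {t. a < t \<and> t < b \<and> (\<forall>K. \<exists>c>0. slope_sign (\<lambda>t. - g t) a b 1 K c 1 t)}"
  have "countable (B1 \<union> B2 \<union> B3)"
    using countable_slope_mismatch[OF g] countable_slope_infinite[OF g]
      countable_slope_infinite[OF semialg_curve_uminus[OF g]]
    by (simp add: B1_def B2_def B3_def)
  moreover have "\<exists>d. (g has_real_derivative d) (at t)"
    if t: "a < t" "t < b" and nB: "t \<notin> B1" "t \<notin> B2" "t \<notin> B3" for t
  proof -
    \<comment> \<open>The slopes that the graph eventually exceeds to the right of \<open>t\<close>.
      This set is downward closed, and its supremum will be the derivative.\<close>
    define R where "R = {K. \<exists>c>0. slope_sign g a b 1 K c 1 t}"
    have both: "\<exists>r\<in>{-1, 0, 1::int}. \<exists>c>0. slope_sign g a b 1 (of_rat K) c (of_int r) t \<and>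
        slope_sign g a b (-1) (of_rat K) c (- of_int r) t" for K :: rat
    proof -
      obtain r c where 1: "r \<in> {-1, 0, 1::int}" "c > 0" "slope_sign g a b 1 (of_rat K) c (of_int r) t"
        using slope_sign_exists[OF g t] by blast
      obtain r' c' where 2: "c' > 0" "slope_sign g a b (-1) (of_rat K) c' (of_int r') t"
        using slope_sign_exists[OF g t] by blast
      have 3: "slope_sign g a b 1 (of_rat K) (min c c') (of_int r) t"
        "slope_sign g a b (-1) (of_rat K) (min c c') (of_int r') t" "min c c' > 0"
        using 1 2 by (auto intro: slope_sign_mono)
      then have "r' = - r" using nB(1) t unfolding B1_def by blast
      then show ?thesis using 1(1) 3 by (intro bexI[of _ r] exI[of _ "min c c'"]) auto
    qed
    obtain K0 where K0: "K0 \<notin> R" using nB(2) t unfolding B2_def R_def by blast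
    have down: "K' \<in> R" if "K \<in> R" "K' \<le> K" for K K'
      using that slope_sign_antimono unfolding R_def by blast
    have bdd: "bdd_above R" using K0 down by (intro bdd_aboveI[of _ K0]) (meson linear)
    have ne: "R \<noteq> {}"
    proof -
      obtain K where K: "\<And>c. c > 0 \<Longrightarrow> \<not> slope_sign (\<lambda>t. - g t) a b 1 K c 1 t"
        using nB(3) t unfolding B3_def by blast
      \<comment> \<open>A rational slope so low that lying on or below its line would exhibit slope
        minus infinity with respect to the witness \<open>K\<close>.\<close>
      obtain K' where K': "of_rat K' < - K" using of_rat_dense[of "- K - 1" "- K"] by auto
      obtain r c where rc: "r \<in> {-1, 0, 1::int}" "c > 0" "slope_sign g a b 1 (of_rat K') c (of_int r) t"
        using both[of K'] by blast
      have "r = 1"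
      proof (rule ccontr)
        assume "r \<noteq> 1"
        have "slope_sign (\<lambda>t. - g t) a b 1 K c 1 t" unfolding slope_sign_def
        proof (intro allI impI)
          fix h assume h: "0 < h \<and> h < c" "a < t + 1 * h \<and> t + 1 * h < b"
          have "sgn (g (t + 1 * h) - g t - of_rat K' * (1 * h)) = of_int r"
            by (rule slope_signD[OF rc(3)]) (use h in auto)
          then have "g (t + h) - g t - of_rat K' * h \<le> 0"
            using rc(1) \<open>r \<noteq> 1\<close> by (auto simp: sgn_if split: if_splits)
          moreover have "of_rat K' * h < - K * h" using K' h by (intro mult_strict_right_mono) auto
          ultimately show "sgn (- g (t + 1 * h) - - g t - K * (1 * h)) = 1" by (simp add: sgn_1_pos)
        qed
        then show False using K rc(2) by blast
      qed
      then show ?thesis using rc unfolding R_def by auto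
    qed
    define d where "d = Sup R"
    have "((\<lambda>h. (g (t + h) - g t) / h) \<longlongrightarrow> d) (at 0)"
    proof (rule LIM_I)
      fix \<eta> :: real assume "\<eta> > 0"
      \<comment> \<open>The slopes squeezing \<open>d\<close> are rational because the agreement of
        the two sides, which transfers the estimates to \<open>h < 0\<close>, is available for
        rational slopes.\<close>
      obtain K1 where K1: "d - \<eta> < of_rat K1" "of_rat K1 < d" using of_rat_dense[of "d - \<eta>" d] \<open>\<eta> > 0\<close> by auto
      obtain K2 where K2: "d < of_rat K2" "of_rat K2 < d + \<eta>" using of_rat_dense[of d "d + \<eta>"] \<open>\<eta> > 0\<close> by auto
      have "of_rat K1 \<in> R" using less_cSup_iff[OF ne bdd] K1(2) down unfolding d_def by (meson less_imp_le)
      then obtain c0 where c0: "c0 > 0" "slope_sign g a b 1 (of_rat K1) c0 1 t" unfolding R_def by blast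
      obtain r1 c1 where c1: "c1 > 0" "slope_sign g a b (-1) (of_rat K1) c1 (- of_int r1) t"
        using both[of K1] by blast
      \<comment> \<open>The graph is above the line of slope \<open>K1\<close> on the right; were
        the sign on the left not the opposite one, \<open>t\<close> would be in
        \<open>B1\<close>.\<close>
      have "r1 = 1"
      proof (rule ccontr)
        assume "r1 \<noteq> 1"
        moreover have "slope_sign g a b 1 (of_rat K1) (min c0 c1) (of_int 1) t"
          "slope_sign g a b (-1) (of_rat K1) (min c0 c1) (of_int (- r1)) t"
          using c0 c1 by (auto intro: slope_sign_mono)
        moreover have "min c0 c1 > 0" "- r1 \<noteq> - 1" using c0 c1 \<open>r1 \<noteq> 1\<close> by auto
        ultimately show False using nB(1) t unfolding B1_def by blast
      qed
      have "of_rat K2 \<notin> R" using cSup_upper[OF _ bdd] K2(1) unfolding d_def by (meson not_le)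
      obtain r2 c2 where c2: "r2 \<in> {-1, 0, 1::int}" "c2 > 0"
        "slope_sign g a b 1 (of_rat K2) c2 (of_int r2) t"
        "slope_sign g a b (-1) (of_rat K2) c2 (- of_int r2) t"
        using both[of K2] by blast
      have "r2 \<noteq> 1" using \<open>of_rat K2 \<notin> R\<close> c2 unfolding R_def by auto
      define c where "c = Min {c0, c1, c2, t - a, b - t}"
      have "0 < c" using c0 c1 c2 t by (simp add: c_def)
      moreover have "c \<le> c0" "c \<le> c1" "c \<le> c2" "c \<le> t - a" "c \<le> b - t"
        unfolding c_def by (rule Min_le; simp)+
      ultimately have c: "0 < c" "c \<le> c0" "c \<le> c1" "c \<le> c2" "c \<le> t - a" "c \<le> b - t" .
      have "norm ((g (t + h) - g t) / h - d) < \<eta>" if h: "h \<noteq> 0" "norm (h - 0) < c" for h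
      proof (cases "h > 0")
        case True
        have "sgn (g (t + 1 * h) - g t - of_rat K1 * (1 * h)) = 1"
          by (rule slope_signD[OF c0(2)]) (use h True c t in auto)
        moreover have "sgn (g (t + 1 * h) - g t - of_rat K2 * (1 * h)) = of_int r2"
          by (rule slope_signD[OF c2(3)]) (use h True c t in auto)
        ultimately have "of_rat K1 * h < g (t + h) - g t" "g (t + h) - g t \<le> of_rat K2 * h"
          using c2(1) \<open>r2 \<noteq> 1\<close> by (auto simp: sgn_if split: if_splits)
        then have "of_rat K1 < (g (t + h) - g t) / h" "(g (t + h) - g t) / h \<le> of_rat K2"
          using True by (auto simp: field_simps)
        then show ?thesis using K1 K2 by auto
      next
        case False
        then have hn: "h < 0" using h by simp
        have "sgn (g (t + (-1) * (-h)) - g t - of_rat K1 * ((-1) * (-h))) = - of_int r1"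
          by (rule slope_signD[OF c1(2)]) (use h hn c t in auto)
        moreover have "sgn (g (t + (-1) * (-h)) - g t - of_rat K2 * ((-1) * (-h))) = - of_int r2"
          by (rule slope_signD[OF c2(4)]) (use h hn c t in auto)
        ultimately have "g (t + h) - g t < of_rat K1 * h" "of_rat K2 * h \<le> g (t + h) - g t"
          using c2(1) \<open>r2 \<noteq> 1\<close> \<open>r1 = 1\<close> by (auto simp: sgn_1_neg sgn_1_pos sgn_eq_0_iff)
        then have "of_rat K1 < (g (t + h) - g t) / h" "(g (t + h) - g t) / h \<le> of_rat K2"
          using hn by (auto simp: field_simps)
        then show ?thesis using K1 K2 by auto
      qed
      then show "\<exists>s>0. \<forall>x. x \<noteq> 0 \<and> norm (x - 0) < s \<longrightarrow> norm ((g (t + x) - g t) / x - d) < \<eta>"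
        using c(1) by blast
    qed
    then show ?thesis unfolding DERIV_def by blast
  qed
  ultimately show ?thesis
    by (elim countable_subset[rotated]) blast
qed

section \<open>A semialgebraic Sard theorem\<close>

lemma semialg_abs_le:
  assumes "F \<in> polyfun V" "G \<in> polyfun V" shows "semialg V (\<lambda>s. \<bar>F s\<bar> \<le> G s)"
  using semialg_conj[OF semialg_le[OF assms] semialg_le[OF polyfun_uminus[OF assms(1)] assms(2)]]
  by (simp add: abs_le_iff)

lemma semialg_abs_less:
  assumes "F \<in> polyfun V" "G \<in> polyfun V" shows "semialg V (\<lambda>s. \<bar>F s\<bar> < G s)"
  using semialg_conj[OF semialg_less[OF assms] semialg_less[OF polyfun_uminus[OF assms(1)] assms(2)]]
  by (simp add: abs_less_iff)

text \<open>A point \<open>q\<close> carries the position in its first \<open>N\<close> coordinates,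
  the value of \<open>f\<close> in coordinate \<open>N\<close> and that of \<open>1 / \<tau>\<close>
  in coordinate \<open>Suc N\<close>. Thus the pencil is \<open>f + \<epsilon> / \<tau>\<close>, and
  for \<open>\<epsilon> = 0\<close> a single function.\<close>

definition pencil :: "nat \<Rightarrow> real \<Rightarrow> (nat \<Rightarrow> real) \<Rightarrow> real" where
  "pencil N \<epsilon> q = q N + \<epsilon> * q (Suc N)"

text \<open>A derivative-free notion of critical point, which is visibly semialgebraic: to first order,
  the pencil does not change along pairs of points \<open>q, q'\<close> that approach \<open>p\<close> from opposite
  directions.  On a manifold with corners such directions are tangent to the stratum of \<open>p\<close>.\<close>

definition near_pair :: "nat \<Rightarrow> (nat \<Rightarrow> real) \<Rightarrow> real \<Rightarrow> real \<Rightarrow> real \<Rightarrow> (nat \<Rightarrow> real) \<Rightarrow> (nat \<Rightarrow> real) \<Rightarrow> bool" where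
  "near_pair N p K \<delta> h q q' \<longleftrightarrow>
     (\<forall>i\<in>{..<N}. \<bar>q i - p i\<bar> \<le> K * h \<and> \<bar>q i + q' i - 2 * p i\<bar> \<le> \<delta> * h)"

definition pencil_critical :: "nat \<Rightarrow> (nat \<Rightarrow> real) set \<Rightarrow> real \<Rightarrow> (nat \<Rightarrow> real) \<Rightarrow> bool" where
  "pencil_critical N W \<epsilon> p \<longleftrightarrow>
     (\<forall>K. \<forall>\<eta>. 0 < K \<and> 0 < \<eta> \<longrightarrow> (\<exists>\<delta>. 0 < \<delta> \<and> (\<forall>q\<in>W. \<forall>q'\<in>W. \<forall>h.
        0 < h \<and> h < \<delta> \<longrightarrow> near_pair N p K \<delta> h q q' \<longrightarrow> \<bar>pencil N \<epsilon> q - pencil N \<epsilon> p\<bar> \<le> \<eta> * h)))"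

lemma polyfun_pencil:
  assumes "E \<in> polyfun V" "(\<lambda>s. Q s N) \<in> polyfun V" "(\<lambda>s. Q s (Suc N)) \<in> polyfun V"
  shows "(\<lambda>s. pencil N (E s) (Q s)) \<in> polyfun V"
  unfolding pencil_def by (intro polyfun_add polyfun_mult assms)

lemma semialg_pencil_critical:
  assumes W: "semialg_set (Suc (Suc N)) W" and E: "E \<in> polyfun V"
    and Q: "\<And>i. i < Suc (Suc N) \<Longrightarrow> (\<lambda>s. Q s i) \<in> polyfun V"
  shows "semialg V (\<lambda>s. pencil_critical N W (E s) (Q s))"
proof -
  let ?T = "ext_tuple (Suc (Suc N))"
  let ?V = "ext_real (?T (?T (ext_real (ext_real (ext_real V)))))"
  have h: "(\<lambda>z. snd z) \<in> polyfun ?V"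
    by (intro polyfun_ext_snd)
  have q': "(\<lambda>z. snd (fst z) i) \<in> polyfun ?V" if "i < Suc (Suc N)" for i
    by (intro polyfun_ext_fst polyfun_tuple_snd that)
  have q: "(\<lambda>z. snd (fst (fst z)) i) \<in> polyfun ?V" if "i < Suc (Suc N)" for i
    by (intro polyfun_ext_fst polyfun_tuple_fst polyfun_tuple_snd that)
  have \<delta>: "(\<lambda>z. snd (fst (fst (fst z)))) \<in> polyfun ?V"
    by (intro polyfun_ext_fst polyfun_tuple_fst polyfun_ext_snd)
  have \<eta>: "(\<lambda>z. snd (fst (fst (fst (fst z))))) \<in> polyfun ?V"
    by (intro polyfun_ext_fst polyfun_tuple_fst polyfun_ext_snd)
  have K: "(\<lambda>z. snd (fst (fst (fst (fst (fst z)))))) \<in> polyfun ?V"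
    by (intro polyfun_ext_fst polyfun_tuple_fst polyfun_ext_snd)
  have E': "(\<lambda>z. E (fst (fst (fst (fst (fst (fst z))))))) \<in> polyfun ?V"
    by (intro polyfun_ext_fst polyfun_tuple_fst E)
  have p: "(\<lambda>z. Q (fst (fst (fst (fst (fst (fst z)))))) i) \<in> polyfun ?V" if "i < Suc (Suc N)" for i
    using polyfun_ext_fst[OF polyfun_tuple_fst[OF polyfun_tuple_fst[OF polyfun_ext_fst[OF polyfun_ext_fst[OF
      polyfun_ext_fst[OF Q[OF that]]]]]]] .
  have near: "semialg ?V (\<lambda>z. near_pair N (Q (fst (fst (fst (fst (fst (fst z)))))))
      (snd (fst (fst (fst (fst (fst z)))))) (snd (fst (fst (fst z)))) (snd z) (snd (fst (fst z))) (snd (fst z)))"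
    unfolding near_pair_def
    by (rule semialg_ball_finite[OF finite_lessThan])
      (rule semialg_conj; rule semialg_abs_le; intro polyfun_diff polyfun_add polyfun_mult polyfun_const h q q' \<delta> K p; simp)
  have val: "semialg ?V (\<lambda>z. \<bar>pencil N (E (fst (fst (fst (fst (fst (fst z))))))) (snd (fst (fst z)))
      - pencil N (E (fst (fst (fst (fst (fst (fst z))))))) (Q (fst (fst (fst (fst (fst (fst z)))))))\<bar>
      \<le> snd (fst (fst (fst (fst z)))) * snd z)"
    by (rule semialg_abs_le; intro polyfun_diff polyfun_mult polyfun_pencil E' q p \<eta> h; simp)
  have 1: "semialg ?V (\<lambda>z. 0 < snd z \<and> snd z < snd (fst (fst (fst z))) \<longrightarrow>
      near_pair N (Q (fst (fst (fst (fst (fst (fst z))))))) (snd (fst (fst (fst (fst (fst z))))))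
        (snd (fst (fst (fst z)))) (snd z) (snd (fst (fst z))) (snd (fst z)) \<longrightarrow>
      \<bar>pencil N (E (fst (fst (fst (fst (fst (fst z))))))) (snd (fst (fst z)))
      - pencil N (E (fst (fst (fst (fst (fst (fst z))))))) (Q (fst (fst (fst (fst (fst (fst z)))))))\<bar>
      \<le> snd (fst (fst (fst (fst z)))) * snd z)"
    by (rule semialg_imp[OF semialg_conj[OF semialg_less[OF polyfun_const h] semialg_less[OF h \<delta>]]
        semialg_imp[OF near val]])
  have 2: "semialg (ext_real (ext_real (ext_real V))) (\<lambda>z. 0 < snd z)"
    by (intro semialg_less polyfun_const polyfun_ext_snd)
  have 3: "semialg (ext_real (ext_real V)) (\<lambda>z. 0 < snd (fst z) \<and> 0 < snd z)"
    by (intro semialg_conj semialg_less polyfun_const polyfun_ext_fst polyfun_ext_snd)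
  show ?thesis unfolding pencil_critical_def
    by (rule semialg_all, rule semialg_all, rule semialg_imp, rule 3, rule semialg_ex, rule semialg_conj, rule 2,
        rule semialg_ball[OF W], rule semialg_ball[OF W], rule semialg_all, rule 1)
qed

definition pencil_critical_values :: "nat \<Rightarrow> (nat \<Rightarrow> real) set \<Rightarrow> real \<Rightarrow> real set" where
  "pencil_critical_values N W \<epsilon> = {c. \<exists>p\<in>W. pencil_critical N W \<epsilon> p \<and> c = pencil N \<epsilon> p}"

lemma semialg_pencil_critical_values:
  assumes W: "semialg_set (Suc (Suc N)) W" and E: "E \<in> polyfun V" and C: "C \<in> polyfun V"
  shows "semialg V (\<lambda>s. C s \<in> pencil_critical_values N W (E s))"
  unfolding pencil_critical_values_def mem_Collect_eq
  by (rule semialg_bex[OF W], rule semialg_conj, rule semialg_pencil_critical[OF W])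
    (intro semialg_eq polyfun_pencil polyfun_tuple_fst E C polyfun_tuple_snd; simp)+

theorem finite_pencil_critical_values:
  assumes W: "semialg_set (Suc (Suc N)) W"
  shows "finite (pencil_critical_values N W \<epsilon>)"
proof (rule ccontr)
  assume inf: "infinite (pencil_critical_values N W \<epsilon>)"
  have "semialg {\<lambda>t. t} (\<lambda>c. c \<in> pencil_critical_values N W \<epsilon>)"
    by (rule semialg_pencil_critical_values[OF W polyfun_const polyfun_id])
  from semialg_infinite_interior[OF this] inf obtain a b where ab: "a < b"
    and vals: "\<And>t. a < t \<Longrightarrow> t < b \<Longrightarrow> t \<in> pencil_critical_values N W \<epsilon>" by auto
  obtain Q where Q: "semialg (coords (Suc (Suc N))) Q" "W = {x \<in> real_tuples (Suc (Suc N)). Q x}"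
    using W by (auto simp: semialg_set_def)
  define Z where "Z t p \<longleftrightarrow> Q p \<and> pencil_critical N W \<epsilon> p \<and> t = pencil N \<epsilon> p" for t p
  have Qs: "semialg (ext_tuple (Suc (Suc N)) {\<lambda>t. t}) (\<lambda>z. Q (snd z))"
    by (rule semialg_comp[OF Q(1)]) (auto simp: coords_def intro: polyfun_tuple_snd)
  have Zs: "semialg (ext_tuple (Suc (Suc N)) {\<lambda>t. t}) (\<lambda>z. Z (fst z) (snd z))"
    unfolding Z_def
    by (rule semialg_conj, rule Qs, rule semialg_conj, rule semialg_pencil_critical[OF W])
      (intro semialg_eq polyfun_pencil polyfun_tuple_fst polyfun_id polyfun_const polyfun_tuple_snd; simp)+
  have ex: "\<exists>q\<in>real_tuples (Suc (Suc N)). Z t q" if "a < t" "t < b" for t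
    using vals[OF that] unfolding pencil_critical_values_def Z_def Q(2) by blast
  obtain u v \<gamma> where uv: "a \<le> u" "u < v" "v \<le> b"
    and \<gamma>: "\<And>t. u < t \<Longrightarrow> t < v \<Longrightarrow> \<gamma> t \<in> real_tuples (Suc (Suc N)) \<and> Z t (\<gamma> t)"
    and curve: "\<And>i. i < Suc (Suc N) \<Longrightarrow> semialg_curve u v (\<lambda>t. \<gamma> t i)"
    using semialg_choice_tuple[where Z = Z, OF Zs ab ex] by blast
  have "countable (\<Union>i<N. {t. u < t \<and> t < v \<and> \<not> (\<exists>d. ((\<lambda>t. \<gamma> t i) has_real_derivative d) (at t))})"
    by (intro countable_UN semialg_curve_differentiable curve) auto
  then have "\<not> {u<..<v} \<subseteq> (\<Union>i<N. {t. u < t \<and> t < v \<and> \<not> (\<exists>d. ((\<lambda>t. \<gamma> t i) has_real_derivative d) (at t))})"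
    using uncountable_open_interval[of u v] uv(2) countable_subset by blast
  then obtain t where "t \<in> {u<..<v}"
    and nt: "t \<notin> (\<Union>i<N. {t. u < t \<and> t < v \<and> \<not> (\<exists>d. ((\<lambda>t. \<gamma> t i) has_real_derivative d) (at t))})"
    by blast
  then have t: "u < t" "t < v" by auto
  then have "\<forall>i<N. \<exists>d. ((\<lambda>t. \<gamma> t i) has_real_derivative d) (at t)" using nt by blast
  then obtain d where d: "\<And>i. i < N \<Longrightarrow> ((\<lambda>t. \<gamma> t i) has_real_derivative d i) (at t)" by metis
  \<comment> \<open>Larger than the speed of every coordinate of the curve, so that short pieces of
    it satisfy the bound \<open>K * h\<close> in \<open>near_pair\<close>.\<close>
  define K where "K = 1 + (\<Sum>i<N. \<bar>d i\<bar>)"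
  have dK: "\<bar>d i\<bar> < K" if "i < N" for i
    using member_le_sum[of i "{..<N}" "\<lambda>i. \<bar>d i\<bar>"] that by (simp add: K_def)
  have K: "K > 0" unfolding K_def by (simp add: add_pos_nonneg sum_nonneg)
  have crit: "pencil_critical N W \<epsilon> (\<gamma> t)" using \<gamma>[OF t] by (simp add: Z_def)
  \<comment> \<open>Any \<open>\<eta>\<close> below 1 would serve, because along the curve the
    pencil changes at unit speed.\<close>
  have "0 < K \<and> (0::real) < 1 / 2" using K by simp
  from crit[unfolded pencil_critical_def, rule_format, OF this]
  obtain \<delta> where \<delta>: "\<delta> > 0" "\<And>q q' h. q \<in> W \<Longrightarrow> q' \<in> W \<Longrightarrow> 0 < h \<and> h < \<delta> \<Longrightarrow>
      near_pair N (\<gamma> t) K \<delta> h q q' \<Longrightarrow> \<bar>pencil N \<epsilon> q - pencil N \<epsilon> (\<gamma> t)\<bar> \<le> 1 / 2 * h" by blast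
  \<comment> \<open>Difference quotients within \<open>K - \<bar>d i\<bar>\<close> of
    \<open>d i\<close> have size at most \<open>K\<close>; two of them within
    \<open>\<delta> / 2\<close>, taken forwards and backwards, cancel up to
    \<open>\<delta>\<close>.\<close>
  have "\<exists>s>0. \<forall>h. h \<noteq> 0 \<and> \<bar>h\<bar> < s \<longrightarrow> \<bar>(\<gamma> (t + h) i - \<gamma> t i) / h - d i\<bar> < min (K - \<bar>d i\<bar>) (\<delta> / 2)"
    if "i < N" for i
    using LIM_D[OF d[OF that, unfolded DERIV_def], of "min (K - \<bar>d i\<bar>) (\<delta> / 2)"] dK[OF that] \<delta>(1) by simp
  then obtain s where s: "\<And>i. i < N \<Longrightarrow> s i > 0" "\<And>i h. i < N \<Longrightarrow> h \<noteq> 0 \<Longrightarrow> \<bar>h\<bar> < s i \<Longrightarrow>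
      \<bar>(\<gamma> (t + h) i - \<gamma> t i) / h - d i\<bar> < min (K - \<bar>d i\<bar>) (\<delta> / 2)" by metis
  define S where "S = Min ({\<delta>, t - u, v - t} \<union> s ` {..<N})"
  have "S > 0" using s(1) \<delta>(1) t by (simp add: S_def)
  have Sle: "S \<le> x" if "x \<in> {\<delta>, t - u, v - t} \<union> s ` {..<N}" for x
    unfolding S_def by (rule Min_le) (use that in auto)
  define h where "h = S / 2"
  have h: "0 < h" "h < \<delta>" "h < t - u" "h < v - t" and hs: "\<And>i. i < N \<Longrightarrow> h < s i"
    using \<open>S > 0\<close> Sle[of \<delta>] Sle[of "t - u"] Sle[of "v - t"] Sle[of "s _"] by (force simp: h_def)+
  have mem: "\<gamma> (t + h) \<in> W" "\<gamma> (t - h) \<in> W" "Z (t + h) (\<gamma> (t + h))"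
    using \<gamma>[of "t + h"] \<gamma>[of "t - h"] h t unfolding Q(2) Z_def by auto
  have "near_pair N (\<gamma> t) K \<delta> h (\<gamma> (t + h)) (\<gamma> (t - h))"
    unfolding near_pair_def
  proof (intro ballI)
    fix i assume "i \<in> {..<N}"
    then have i: "i < N" by simp
    have 1: "\<bar>(\<gamma> (t + h) i - \<gamma> t i) / h - d i\<bar> < min (K - \<bar>d i\<bar>) (\<delta> / 2)"
      by (rule s(2)[OF i]) (use h hs[OF i] in auto)
    have 2: "\<bar>(\<gamma> (t + - h) i - \<gamma> t i) / - h - d i\<bar> < min (K - \<bar>d i\<bar>) (\<delta> / 2)"
      by (rule s(2)[OF i]) (use h hs[OF i] in auto)
    define A B where "A = (\<gamma> (t + h) i - \<gamma> t i) / h" and "B = (\<gamma> (t - h) i - \<gamma> t i) / h"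
    have A: "\<gamma> (t + h) i - \<gamma> t i = A * h" and B: "\<gamma> (t - h) i - \<gamma> t i = B * h"
      using h(1) by (simp_all add: A_def B_def)
    have "\<bar>A - d i\<bar> < min (K - \<bar>d i\<bar>) (\<delta> / 2)" "\<bar>- B - d i\<bar> < min (K - \<bar>d i\<bar>) (\<delta> / 2)"
      using 1 2 by (simp_all add: A_def B_def)
    then have "\<bar>A\<bar> \<le> K" "\<bar>A + B\<bar> \<le> \<delta>" by linarith+
    then have "\<bar>A * h\<bar> \<le> K * h" "\<bar>(A + B) * h\<bar> \<le> \<delta> * h"
      unfolding abs_mult using h(1) by (auto intro!: mult_right_mono)
    then show "\<bar>\<gamma> (t + h) i - \<gamma> t i\<bar> \<le> K * h \<and> \<bar>\<gamma> (t + h) i + \<gamma> (t - h) i - 2 * \<gamma> t i\<bar> \<le> \<delta> * h"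
      using A B by (simp add: algebra_simps)
  qed
  from \<delta>(2)[OF mem(1,2) _ this] h have "\<bar>pencil N \<epsilon> (\<gamma> (t + h)) - pencil N \<epsilon> (\<gamma> t)\<bar> \<le> 1 / 2 * h" by simp
  moreover have "pencil N \<epsilon> (\<gamma> (t + h)) = t + h" "pencil N \<epsilon> (\<gamma> t) = t"
    using mem(3) \<gamma>[OF t] by (auto simp: Z_def)
  ultimately show False using h(1) by simp
qed

section \<open>Limit values of families with finite fibres\<close>

text \<open>The numbers \<open>c\<close> such that \<open>(0, c)\<close> is in the closure of the
  plane set of pairs \<open>(\<epsilon>, c')\<close> with \<open>c' \<in> E \<epsilon>\<close>.
  Unlike a statement about sequences, this condition is first-order.\<close>

definition limit_values :: "(real \<Rightarrow> real set) \<Rightarrow> real set" where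
  "limit_values E = {c. \<forall>\<delta>. 0 < \<delta> \<longrightarrow> (\<exists>\<epsilon> c'. \<bar>\<epsilon>\<bar> < \<delta> \<and> \<bar>c' - c\<bar> < \<delta> \<and> c' \<in> E \<epsilon>)}"

text \<open>The plane set has dimension at most 1 over the \<open>\<epsilon>\<close>-axis, so an
  interval of limit points on the vertical line \<open>\<epsilon> = 0\<close> is impossible. If
  there were one, most of its points \<open>c\<close> would persist in \<open>E \<epsilon>\<close>
  for all small \<open>\<epsilon>\<close> of one sign, and a uniform choice would put an interval
  into one finite fibre.\<close>

lemma finite_limit_values:
  assumes E: "semialg (ext_real {\<lambda>t. t}) (\<lambda>z. snd z \<in> E (fst z))" and fin: "\<And>\<epsilon>. finite (E \<epsilon>)"
  shows "finite (limit_values E)"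
proof (rule ccontr)
  assume inf: "infinite (limit_values E)"
  have EV: "semialg V (\<lambda>s. Y s \<in> E (T s))" if "T \<in> polyfun V" "Y \<in> polyfun V" for T Y and V :: "('s \<Rightarrow> real) set"
    by (rule semialg_relation[where S = "\<lambda>\<epsilon> c. c \<in> E \<epsilon>", OF E that])
  have "semialg {\<lambda>t. t} (\<lambda>c. \<forall>\<delta>. 0 < \<delta> \<longrightarrow> (\<exists>\<epsilon> c'. \<bar>\<epsilon>\<bar> < \<delta> \<and> \<bar>c' - c\<bar> < \<delta> \<and> c' \<in> E \<epsilon>))"
    by (rule semialg_all, rule semialg_imp, intro semialg_less polyfun_const polyfun_ext_snd,
        rule semialg_ex, rule semialg_ex, rule semialg_conj, rule semialg_abs_less)
      (intro semialg_conj semialg_abs_less EV polyfun_diff polyfun_ext_snd polyfun_ext_fst polyfun_id)+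
  from semialg_infinite_interior[OF this] inf obtain a b where ab: "a < b"
    and lim: "\<And>t. a < t \<Longrightarrow> t < b \<Longrightarrow> t \<in> limit_values E" unfolding limit_values_def by auto
  \<comment> \<open>The finite fibre over 0 is removed, so that limit points must come from fibres
    over nonzero parameters.\<close>
  have fr: "semialg {\<lambda>t. t} (\<lambda>c. (a < c \<and> c < b) \<and> c \<notin> E 0)"
    by (intro semialg_conj semialg_not semialg_less EV polyfun_id polyfun_const)
  have "infinite ({a<..<b} - E 0)" using ab fin[of 0] by (simp add: Diff_infinite_finite infinite_Ioo)
  moreover have "{a<..<b} - E 0 = {c. (a < c \<and> c < b) \<and> c \<notin> E 0}" by auto
  ultimately have "infinite {c. (a < c \<and> c < b) \<and> c \<notin> E 0}" by simp
  from semialg_infinite_interior[OF fr this] obtain a1 b1 where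
    1: "a1 < b1" "\<And>t. a1 < t \<Longrightarrow> t < b1 \<Longrightarrow> a < t \<and> t < b \<and> t \<notin> E 0"
    by blast
  \<comment> \<open>Here \<open>c\<close> is missing from all fibres over small nonzero parameters.
    This can hold for countably many \<open>c\<close> only: on an interval with a common
    \<open>n\<close> it would contradict the limit property.\<close>
  define G where "G n c \<longleftrightarrow> (\<forall>\<epsilon>. \<epsilon> \<noteq> 0 \<and> \<bar>\<epsilon>\<bar> < 1 / real (Suc n) \<longrightarrow> c \<notin> E \<epsilon>)" for n c
  have G: "semialg {\<lambda>t. t} (G n)" for n unfolding G_def
    by (rule semialg_all, rule semialg_imp, rule semialg_conj)
      (intro semialg_not semialg_eq semialg_abs_less EV polyfun_const polyfun_ext_snd polyfun_ext_fst polyfun_id)+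
  have "countable {t. a1 < t \<and> t < b1 \<and> (\<exists>n. G n t)}"
  proof (rule ccontr)
    assume "\<not> ?thesis"
    from semialg_uniform_interval[OF G this] obtain n a2 b2 where
      2: "a1 \<le> a2" "a2 < b2" "b2 \<le> b1" "\<And>t. a2 < t \<Longrightarrow> t < b2 \<Longrightarrow> G n t" by metis
    define c where "c = (a2 + b2) / 2"
    define \<delta> where "\<delta> = min (1 / real (Suc n)) ((b2 - a2) / 2)"
    have "\<delta> > 0" using 2 by (simp add: \<delta>_def)
    have "c \<in> limit_values E" using lim[of c] 1(2)[of c] 2 by (auto simp: c_def)
    then obtain \<epsilon> c' where *: "\<bar>\<epsilon>\<bar> < \<delta>" "\<bar>c' - c\<bar> < \<delta>" "c' \<in> E \<epsilon>"
      using \<open>\<delta> > 0\<close> unfolding limit_values_def by blast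
    have "\<bar>c' - c\<bar> < (b2 - a2) / 2" using *(2) by (simp add: \<delta>_def)
    then have c': "a2 < c'" "c' < b2" unfolding c_def by (auto simp: abs_less_iff field_simps)
    show False
    proof (cases "\<epsilon> = 0")
      case True
      then show False using *(3) 1(2)[of c'] c' 2 by simp
    next
      case False
      then show False using 2(4)[OF c'] * unfolding G_def \<delta>_def by auto
    qed
  qed
  then have unc: "\<not> countable {t. a1 < t \<and> t < b1 \<and> \<not> (\<exists>n. G n t)}"
    using uncountable_interval_minus_countable[OF 1(1), of "\<lambda>t. \<not> (\<exists>n. G n t)"] by simp
  \<comment> \<open>The flag \<open>e\<close> selects the side of 0 on which \<open>c\<close>
    belongs to every nearby fibre. For fixed \<open>c\<close> the fibres containing \<open>c\<close>
    form a semialgebraic set of parameters, so the failure of every \<open>G n c\<close> yields such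
    a side.\<close>
  define H where "H = (\<lambda>(e::bool, n) c. \<forall>\<epsilon>. 0 < \<epsilon> \<and> \<epsilon> < 1 / real (Suc n) \<longrightarrow> c \<in> E (if e then \<epsilon> else - \<epsilon>))"
  have H: "semialg {\<lambda>t. t} (H k)" for k
  proof -
    obtain e n where k: "k = (e, n)" by (cases k)
    have sgn: "(\<lambda>z. if e then snd z else - snd z) \<in> polyfun (ext_real {\<lambda>t. t})"
      by (cases e) (simp_all add: polyfun_ext_snd polyfun_uminus[OF polyfun_ext_snd])
    show ?thesis unfolding H_def k prod.case
      by (rule semialg_all, rule semialg_imp, intro semialg_conj semialg_less polyfun_const polyfun_ext_snd)
        (intro EV sgn polyfun_ext_fst polyfun_id)
  qed
  have "\<exists>k. H k c" if "\<not> (\<exists>n. G n c)" for c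
  proof (rule ccontr)
    assume n: "\<nexists>k. H k c"
    have "\<exists>s>0. \<forall>\<epsilon>. 0 < \<epsilon> \<longrightarrow> \<epsilon> < s \<longrightarrow> c \<notin> E (if e then \<epsilon> else - \<epsilon>)" for e
    proof -
      have sgn: "(\<lambda>\<epsilon>. if e then \<epsilon> else - \<epsilon>) \<in> polyfun {\<lambda>t. t}"
        by (cases e) (simp_all add: polyfun_id polyfun_uminus[OF polyfun_id])
      have "semialg {\<lambda>t. t} (\<lambda>\<epsilon>. c \<in> E (if e then \<epsilon> else - \<epsilon>))" by (rule EV[OF sgn polyfun_const])
      from semialg_eventually_right[OF this, of 0, unfolded add_0]
      consider s where "s > 0" "\<forall>h. 0 < h \<longrightarrow> h < s \<longrightarrow> c \<in> E (if e then h else - h)"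
        | "\<exists>s>0. \<forall>h. 0 < h \<longrightarrow> h < s \<longrightarrow> c \<notin> E (if e then h else - h)" by blast
      then show ?thesis
      proof cases
        case (1 s)
        obtain m where "1 / real (Suc m) \<le> s" using archimedean_inverse_Suc[OF 1(1)] by blast
        then have "H (e, m) c" unfolding H_def using 1(2) by auto
        then show ?thesis using n by blast
      qed
    qed
    from this[of True] this[of False] obtain s1 s2 where
      s: "s1 > 0" "\<And>\<epsilon>. 0 < \<epsilon> \<Longrightarrow> \<epsilon> < s1 \<Longrightarrow> c \<notin> E \<epsilon>" "s2 > 0" "\<And>\<epsilon>. 0 < \<epsilon> \<Longrightarrow> \<epsilon> < s2 \<Longrightarrow> c \<notin> E (- \<epsilon>)" by auto
    obtain m where m: "1 / real (Suc m) \<le> min s1 s2" using archimedean_inverse_Suc[of "min s1 s2"] s by auto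
    have "G m c" unfolding G_def
    proof (intro allI impI)
      fix \<epsilon> :: real assume e: "\<epsilon> \<noteq> 0 \<and> \<bar>\<epsilon>\<bar> < 1 / real (Suc m)"
      show "c \<notin> E \<epsilon>"
      proof (cases "\<epsilon> > 0")
        case True
        then show ?thesis using s(2)[of \<epsilon>] e m by auto
      next
        case False
        then show ?thesis using s(4)[of "- \<epsilon>"] e m by auto
      qed
    qed
    then show False using that by blast
  qed
  then have "{t. a1 < t \<and> t < b1 \<and> \<not> (\<exists>n. G n t)} \<subseteq> {t. a1 < t \<and> t < b1 \<and> (\<exists>k. H k t)}" by blast
  from countable_subset[OF this] have unc': "\<not> countable {t. a1 < t \<and> t < b1 \<and> (\<exists>k. H k t)}"
    by (rule contrapos_nn[OF unc])
  obtain k a2 b2 where 2: "a2 < b2" "\<And>t. a2 < t \<Longrightarrow> t < b2 \<Longrightarrow> H k t"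
    by (rule semialg_uniform_interval[OF H unc'], rule that; assumption)
  obtain e n where k: "k = (e, n)" by (cases k)
  define \<epsilon> where "\<epsilon> = 1 / real (Suc n) / 2"
  have \<epsilon>: "0 < \<epsilon>" "\<epsilon> < 1 / real (Suc n)" by (simp_all add: \<epsilon>_def field_simps)
  have "t \<in> E (if e then \<epsilon> else - \<epsilon>)" if "a2 < t" "t < b2" for t
    using 2(2)[OF that] \<epsilon> unfolding H_def k by auto
  then have "{a2<..<b2} \<subseteq> E (if e then \<epsilon> else - \<epsilon>)" by auto
  then show False using fin finite_subset infinite_Ioo[OF 2(1)] by blast
qed

lemma finite_limit_pencil_critical_values:
  assumes "semialg_set (Suc (Suc N)) W"
  shows "finite (limit_values (pencil_critical_values N W))"
  by (rule finite_limit_values)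
    (intro semialg_pencil_critical_values[OF assms] polyfun_ext_fst polyfun_ext_snd polyfun_id
      finite_pencil_critical_values[OF assms])+

section \<open>Differentiation in corner charts\<close>

definition l1 :: "nat \<Rightarrow> (nat \<Rightarrow> real) \<Rightarrow> (nat \<Rightarrow> real) \<Rightarrow> real" where
  "l1 n x y = (\<Sum>i<n. \<bar>x i - y i\<bar>)"

lemma l1_nonneg [simp]: "0 \<le> l1 n x y"
  by (simp add: l1_def sum_nonneg)

lemma abs_le_l1: "i < n \<Longrightarrow> \<bar>x i - y i\<bar> \<le> l1 n x y"
  unfolding l1_def by (rule member_le_sum[of i "{..<n}" "\<lambda>i. \<bar>x i - y i\<bar>"]) auto

lemma l1_upd: "k < n \<Longrightarrow> l1 n (x(k := t)) x = \<bar>t - x k\<bar>"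
proof -
  assume k: "k < n"
  have "l1 n (x(k := t)) x = (\<Sum>i<n. if i = k then \<bar>t - x k\<bar> else 0)"
    unfolding l1_def by (rule sum.cong) auto
  then show ?thesis using k by simp
qed

text \<open>In the product topology a basic open set restricts each coordinate separately. The
  coordinates from \<open>n\<close> on vanish at all points concerned, so the finitely many others
  determine a common box size.\<close>

lemma openin_Euclidean_space_box:
  assumes "openin (Euclidean_space n) W" "x \<in> W"
  shows "\<exists>\<delta>>0. \<forall>z\<in>real_tuples n. (\<forall>i<n. \<bar>z i - x i\<bar> < \<delta>) \<longrightarrow> z \<in> W"
proof -
  obtain T where T: "openin (powertop_real UNIV) T" "W = T \<inter> {x. \<forall>i\<ge>n. x i = 0}"
    using assms(1) unfolding Euclidean_space_def openin_subtopology by auto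
  have "x \<in> T" using assms(2) T(2) by blast
  then obtain U where UO: "\<forall>i\<in>UNIV. openin euclideanreal (U i)" and U': "x \<in> PiE UNIV U" "PiE UNIV U \<subseteq> T"
    using T(1) unfolding openin_product_topology_alt by blast
  have U1: "open (U i)" for i using UO open_openin[of "U i"] by blast
  have U2: "x i \<in> U i" for i using U'(1) by (auto simp: PiE_iff)
  have U3: "z \<in> T" if "\<And>i. z i \<in> U i" for z using U'(2) that by (auto simp: PiE_iff subset_iff)
  note U = U1 U2 U3
  have "\<exists>e>0. ball (x i) e \<subseteq> U i" for i
    using U(1)[of i] U(2)[of i] open_contains_ball by blast
  then obtain e where e: "\<And>i. e i > 0" "\<And>i. ball (x i) (e i) \<subseteq> U i" by metis
  define \<delta> where "\<delta> = Min (insert 1 (e ` {..<n}))"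
  have "\<delta> > 0" using e(1) by (simp add: \<delta>_def)
  moreover have "z \<in> W" if z: "z \<in> real_tuples n" "\<And>i. i < n \<Longrightarrow> \<bar>z i - x i\<bar> < \<delta>" for z
  proof -
    have "z i \<in> U i" for i
    proof (cases "i < n")
      case True
      then have "\<delta> \<le> e i" unfolding \<delta>_def by (intro Min_le) auto
      then have "z i \<in> ball (x i) (e i)" using z(2)[OF True] by (auto simp: dist_real_def)
      then show ?thesis using e(2) by blast
    next
      case False
      have "x \<in> {x. \<forall>i\<ge>n. x i = 0}" using assms(2) unfolding T(2) by blast
      then have "z i = x i" using z(1) False by (simp add: topspace_Euclidean_space)
      then have "z i \<in> ball (x i) (e i)" using e(1)[of i] by simp
      then show ?thesis using e(2) by blast
    qed
    then have "z \<in> T" by (rule U(3))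
    then show ?thesis using z(1) unfolding T(2) by (simp add: topspace_Euclidean_space)
  qed
  ultimately show ?thesis by blast
qed

lemma continuous_map_coordinate:
  "continuous_map X (Euclidean_space n) f \<Longrightarrow> continuous_map X euclideanreal (\<lambda>x. f x i)"
  unfolding Euclidean_space_def continuous_map_in_subtopology continuous_map_componentwise_UNIV by simp

lemma continuous_map_l1:
  "continuous_map X (Euclidean_space n) f \<Longrightarrow> continuous_map X euclideanreal (\<lambda>x. l1 n (f x) y)"
  unfolding l1_def
  by (intro continuous_map_sum continuous_map_real_abs continuous_map_diff continuous_map_coordinate
      continuous_map_canonical_const) simp

text \<open>The classical passage from continuous partial derivatives to a total derivative:
  \<open>z\<close> is reached from \<open>x\<close> by changing one coordinate at a time, with the
  mean value inequality on each segment.\<close>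

lemma C_diff_open_frechet:
  assumes W: "openin (Euclidean_space n) W" and h: "C_diff_open 1 n W h" and x: "x \<in> W"
  obtains d where "\<And>\<eta>. \<eta> > 0 \<Longrightarrow> \<exists>\<delta>>0. \<forall>z\<in>W. l1 n z x < \<delta> \<longrightarrow>
    \<bar>h z - h x - (\<Sum>i<n. d i * (z i - x i))\<bar> \<le> \<eta> * l1 n z x"
proof -
  have "\<exists>g'. (\<forall>y\<in>W. has_partial_derivative h i (g' y) y W) \<and>
      continuous_map (subtopology (Euclidean_space n) W) euclideanreal g'" if "i < n" for i
    using h that by (simp add: numeral_1_eq_Suc_0 One_nat_def)
  then obtain g' where g': "\<And>i y. i < n \<Longrightarrow> y \<in> W \<Longrightarrow> has_partial_derivative h i (g' i y) y W"
    "\<And>i. i < n \<Longrightarrow> continuous_map (subtopology (Euclidean_space n) W) euclideanreal (g' i)" by metis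
  have Wt: "W \<subseteq> real_tuples n" using openin_subset[OF W] .
  obtain \<delta>0 where \<delta>0: "\<delta>0 > 0" "\<And>z. z \<in> real_tuples n \<Longrightarrow> (\<forall>i<n. \<bar>z i - x i\<bar> < \<delta>0) \<Longrightarrow> z \<in> W"
    using openin_Euclidean_space_box[OF W x] by blast
  have "\<exists>\<delta>>0. \<forall>z\<in>W. l1 n z x < \<delta> \<longrightarrow> \<bar>h z - h x - (\<Sum>i<n. g' i x * (z i - x i))\<bar> \<le> \<eta> * l1 n z x"
    if "\<eta> > 0" for \<eta>
  proof -
    have "\<exists>\<delta>>0. \<forall>z\<in>real_tuples n. (\<forall>j<n. \<bar>z j - x j\<bar> < \<delta>) \<longrightarrow> \<bar>g' i z - g' i x\<bar> < \<eta>" if i: "i < n" for i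
    proof -
      have "openin (subtopology (Euclidean_space n) W)
          {z \<in> topspace (subtopology (Euclidean_space n) W). g' i z \<in> ball (g' i x) \<eta>}"
        by (rule openin_continuous_map_preimage[OF g'(2)[OF i]]) simp
      then have op: "openin (Euclidean_space n) {z \<in> W. g' i z \<in> ball (g' i x) \<eta>}"
        using openin_trans_full[OF _ W] Wt by (simp add: Int_absorb1 topspace_subtopology)
      have "x \<in> {z \<in> W. g' i z \<in> ball (g' i x) \<eta>}" using x \<open>\<eta> > 0\<close> by simp
      from openin_Euclidean_space_box[OF op this] show ?thesis
        by (simp add: dist_real_def abs_minus_commute) blast
    qed
    then obtain \<delta>' where \<delta>': "\<And>i. i < n \<Longrightarrow> \<delta>' i > 0" "\<And>i z. i < n \<Longrightarrow> z \<in> real_tuples n \<Longrightarrow>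
        (\<forall>j<n. \<bar>z j - x j\<bar> < \<delta>' i) \<Longrightarrow> \<bar>g' i z - g' i x\<bar> < \<eta>" by metis
    define \<delta> where "\<delta> = Min (insert \<delta>0 (\<delta>' ` {..<n}))"
    have "\<delta> > 0" using \<delta>0(1) \<delta>'(1) by (simp add: \<delta>_def)
    have \<delta>le: "\<delta> \<le> \<delta>0" "\<And>i. i < n \<Longrightarrow> \<delta> \<le> \<delta>' i" unfolding \<delta>_def by (rule Min_le; simp)+
    have "\<bar>h z - h x - (\<Sum>i<n. g' i x * (z i - x i))\<bar> \<le> \<eta> * l1 n z x" if z: "z \<in> W" "l1 n z x < \<delta>" for z
    proof -
      have zx: "\<bar>z i - x i\<bar> < \<delta>" if "i < n" for i using abs_le_l1[OF that, of z x] z(2) by simp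
      \<comment> \<open>The corner after \<open>k\<close> coordinates have been moved from
        \<open>x\<close> to \<open>z\<close>; the path has \<open>n\<close> segments.\<close>
      define zs where "zs k = (\<lambda>i. if i < k then z i else x i)" for k
      have zt: "z \<in> real_tuples n" "x \<in> real_tuples n" using Wt z(1) x by auto
      have zs0: "zs 0 = x" and zsn: "zs n = z"
        using zt by (auto simp: zs_def fun_eq_iff topspace_Euclidean_space)
      have step: "\<bar>(h (zs (Suc k)) - h (zs k)) - g' k x * (z k - x k)\<bar> \<le> \<eta> * \<bar>z k - x k\<bar>" if k: "k < n" for k
      proof -
        define S where "S = cball (x k) \<bar>z k - x k\<bar>"
        define F where "F s = h ((zs k)(k := s)) - g' k x * s" for s
        have tup: "(zs k)(k := s) \<in> real_tuples n" for s
          using zt k by (auto simp: zs_def topspace_Euclidean_space)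
        have near: "\<bar>((zs k)(k := s)) j - x j\<bar> < \<delta>" if "s \<in> S" "j < n" for s j
          using zx[OF k] zx[OF that(2)] that(1) \<open>\<delta> > 0\<close> by (auto simp: zs_def S_def dist_real_def)
        have inW: "(zs k)(k := s) \<in> W" if "s \<in> S" for s
          by (rule \<delta>0(2)[OF tup]) (intro allI impI less_le_trans[OF near[OF that] \<delta>le(1)])
        have "norm (F (z k) - F (x k)) \<le> \<eta> * norm (z k - x k)"
        proof (rule field_differentiable_bound[where S = S and f' = "\<lambda>s. g' k ((zs k)(k := s)) - g' k x"])
          show "convex S" by (simp add: S_def)
          show "z k \<in> S" "x k \<in> S" by (auto simp: S_def dist_real_def)
          fix s assume s: "s \<in> S"
          have "((\<lambda>t. h ((zs k)(k := t))) has_real_derivative g' k ((zs k)(k := s)))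
              (at s within {t. (zs k)(k := t) \<in> W})"
            using g'(1)[OF k inW[OF s]] by (simp add: has_partial_derivative_def)
          then have "((\<lambda>t. h ((zs k)(k := t))) has_real_derivative g' k ((zs k)(k := s))) (at s within S)"
            by (rule DERIV_subset) (use inW in blast)
          then show "(F has_field_derivative g' k ((zs k)(k := s)) - g' k x) (at s within S)"
            unfolding F_def by (auto intro!: derivative_eq_intros)
          have "\<bar>g' k ((zs k)(k := s)) - g' k x\<bar> < \<eta>"
            by (rule \<delta>'(2)[OF k tup]) (intro allI impI less_le_trans[OF near[OF s] \<delta>le(2)[OF k]])
          then show "norm (g' k ((zs k)(k := s)) - g' k x) \<le> \<eta>" by simp
        qed
        moreover have "(zs k)(k := z k) = zs (Suc k)" "(zs k)(k := x k) = zs k"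
          by (auto simp: zs_def fun_eq_iff)
        ultimately show ?thesis by (simp add: F_def algebra_simps)
      qed
      have "h z - h x = (\<Sum>k<n. h (zs (Suc k)) - h (zs k))"
        using sum_lessThan_telescope[of "\<lambda>k. h (zs k)" n] unfolding zs0 zsn by simp
      then have "h z - h x - (\<Sum>i<n. g' i x * (z i - x i))
          = (\<Sum>k<n. (h (zs (Suc k)) - h (zs k)) - g' k x * (z k - x k))"
        by (simp add: sum_subtractf)
      also have "\<bar>\<dots>\<bar> \<le> (\<Sum>k<n. \<eta> * \<bar>z k - x k\<bar>)"
        by (rule order_trans[OF sum_abs sum_mono]) (use step in auto)
      finally show ?thesis by (simp add: l1_def sum_distrib_left)
    qed
    then show ?thesis using \<open>\<delta> > 0\<close> by blast
  qed
  then show ?thesis by (rule that)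
qed

text \<open>Charts and the semialgebraic embedding are both topological embeddings of open sets.
  Through this equivalence smallness in either kind of coordinates becomes a property of the filter
  \<open>nhdsin X p\<close>, and the two can be compared.\<close>

lemma embedding_nhdsin:
  assumes emb: "embedding_map (subtopology X U) (Euclidean_space N) \<phi>" and U: "openin X U" and p: "p \<in> U"
  shows "(\<forall>\<^sub>F r in nhdsin X p. P r) \<longleftrightarrow> (\<exists>\<delta>>0. \<forall>r\<in>U. l1 N (\<phi> r) (\<phi> p) < \<delta> \<longrightarrow> P r)"
proof
  have UX: "U \<subseteq> topspace X" using openin_subset[OF U] .
  then have tU: "topspace (subtopology X U) = U" by auto
  have hom: "homeomorphic_map (subtopology X U) (subtopology (Euclidean_space N) (\<phi> ` U)) \<phi>"
    using emb unfolding embedding_map_def tU .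
  have cont: "continuous_map (subtopology X U) (Euclidean_space N) \<phi>"
    using hom homeomorphic_imp_continuous_map continuous_map_in_subtopology by blast
  have inj: "inj_on \<phi> U" using homeomorphic_imp_injective_map[OF hom] unfolding tU .
  {
    assume "\<forall>\<^sub>F r in nhdsin X p. P r"
    then obtain S where S: "openin X S" "p \<in> S" "\<And>r. r \<in> S \<Longrightarrow> P r"
      using p UX unfolding eventually_nhdsin by blast
    have "openin (subtopology X U) (S \<inter> U)" using S(1) by (auto simp: openin_subtopology)
    then have "openin (subtopology (Euclidean_space N) (\<phi> ` U)) (\<phi> ` (S \<inter> U))"
      using homeomorphic_imp_open_map[OF hom] by (simp add: open_map_def)
    then obtain T where T: "openin (Euclidean_space N) T" "\<phi> ` (S \<inter> U) = T \<inter> \<phi> ` U"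
      by (auto simp: openin_subtopology)
    have "\<phi> p \<in> T" using T(2) S(2) p by blast
    from openin_Euclidean_space_box[OF T(1) this] obtain \<delta> where \<delta>: "\<delta> > 0"
      "\<And>z. z \<in> real_tuples N \<Longrightarrow> (\<forall>i<N. \<bar>z i - \<phi> p i\<bar> < \<delta>) \<Longrightarrow> z \<in> T" by blast
    have "P r" if r: "r \<in> U" "l1 N (\<phi> r) (\<phi> p) < \<delta>" for r
    proof -
      have "\<phi> r \<in> real_tuples N"
        using continuous_map_image_subset_topspace[OF cont] r(1) unfolding tU by auto
      then have "\<phi> r \<in> T"
        by (rule \<delta>(2)) (intro allI impI le_less_trans[OF abs_le_l1 r(2)])
      then have "\<phi> r \<in> \<phi> ` (S \<inter> U)" using T(2) r(1) by blast
      then have "r \<in> S" using inj r(1) by (auto dest: inj_onD)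
      then show ?thesis by (rule S(3))
    qed
    then show "\<exists>\<delta>>0. \<forall>r\<in>U. l1 N (\<phi> r) (\<phi> p) < \<delta> \<longrightarrow> P r" using \<delta>(1) by blast
  next
    assume "\<exists>\<delta>>0. \<forall>r\<in>U. l1 N (\<phi> r) (\<phi> p) < \<delta> \<longrightarrow> P r"
    then obtain \<delta> where \<delta>: "\<delta> > 0" "\<And>r. r \<in> U \<Longrightarrow> l1 N (\<phi> r) (\<phi> p) < \<delta> \<Longrightarrow> P r" by blast
    have "openin (subtopology X U) {r \<in> topspace (subtopology X U). l1 N (\<phi> r) (\<phi> p) \<in> {..<\<delta>}}"
      by (rule openin_continuous_map_preimage[OF continuous_map_l1[OF cont]]) simp
    then have "openin X {r \<in> U. l1 N (\<phi> r) (\<phi> p) < \<delta>}"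
      unfolding tU using openin_trans_full[OF _ U] by simp
    moreover have "p \<in> {r \<in> U. l1 N (\<phi> r) (\<phi> p) < \<delta>}" using p \<delta>(1) by (simp add: l1_def)
    ultimately show "\<forall>\<^sub>F r in nhdsin X p. P r"
      unfolding eventually_nhdsin using \<delta>(2) by (intro disjI2 exI[of _ "{r \<in> U. l1 N (\<phi> r) (\<phi> p) < \<delta>}"]) auto
  }
qed

lemma eventually_at_right_0_iff:
  "(\<forall>\<^sub>F t in at_right (0::real). P t) \<longleftrightarrow> (\<exists>\<delta>>0. \<forall>t. 0 < t \<longrightarrow> t < \<delta> \<longrightarrow> P t)"
  by (simp add: eventually_at_right_field)

section \<open>Derivatives along subsets of a manifold with corners\<close>

lemma corner_chartD:
  assumes "corner_chart n X (V, m, \<psi>)"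
  shows "m \<le> n" "openin X V" "embedding_map (subtopology X V) (Euclidean_space n) \<psi>"
    "openin (subtopology (Euclidean_space n) (corner_space n m)) (\<psi> ` V)" "inj_on \<psi> V"
    "\<psi> ` V \<subseteq> corner_space n m"
proof -
  have c: "m \<le> n" "openin X V" "openin (subtopology (Euclidean_space n) (corner_space n m)) (\<psi> ` V)"
    "homeomorphic_map (subtopology X V) (subtopology (Euclidean_space n) (\<psi> ` V)) \<psi>"
    using assms by (auto simp: corner_chart_def)
  have tV: "topspace (subtopology X V) = V" using openin_subset[OF c(2)] by auto
  show "m \<le> n" "openin X V" "openin (subtopology (Euclidean_space n) (corner_space n m)) (\<psi> ` V)"
    by (rule c)+
  show "embedding_map (subtopology X V) (Euclidean_space n) \<psi>"
    unfolding embedding_map_def tV by (rule c(4))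
  show "inj_on \<psi> V" using homeomorphic_imp_injective_map[OF c(4)] unfolding tV .
  show "\<psi> ` V \<subseteq> corner_space n m" using openin_subset[OF c(3)] by auto
qed

lemma chart_nhdsin:
  assumes "corner_chart n X (V, m, \<psi>)" "p \<in> V"
  shows "(\<forall>\<^sub>F r in nhdsin X p. P r) \<longleftrightarrow> (\<exists>\<delta>>0. \<forall>r\<in>V. l1 n (\<psi> r) (\<psi> p) < \<delta> \<longrightarrow> P r)"
  by (rule embedding_nhdsin[OF corner_chartD(3,2)[OF assms(1)] assms(2)])

lemma eventually_nhdsin_mem:
  "openin X U \<Longrightarrow> p \<in> U \<Longrightarrow> \<forall>\<^sub>F r in nhdsin X p. r \<in> U"
  by (auto simp: eventually_nhdsin)

text \<open>A total derivative in the chart \<open>\<psi>\<close>, along \<open>Y\<close>. The error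
  is measured eventually in \<open>nhdsin X p\<close> rather than on a ball of the chart, so that
  several maps, other charts and membership in open sets can be combined by filter
  reasoning.\<close>

definition chart_deriv :: "'a topology \<Rightarrow> nat \<Rightarrow> ('a \<Rightarrow> nat \<Rightarrow> real) \<Rightarrow> 'a set \<Rightarrow> ('a \<Rightarrow> real) \<Rightarrow> 'a \<Rightarrow> (nat \<Rightarrow> real) \<Rightarrow> bool" where
  "chart_deriv X n \<psi> Y g p d \<longleftrightarrow> (\<forall>\<eta>>0. \<forall>\<^sub>F r in nhdsin X p. r \<in> Y \<longrightarrow>
     \<bar>g r - g p - (\<Sum>i<n. d i * (\<psi> r i - \<psi> p i))\<bar> \<le> \<eta> * l1 n (\<psi> r) (\<psi> p))"

lemma C_diff_on_chart_deriv:
  assumes c: "corner_chart n X (V, m, \<psi>)" and p: "p \<in> V" "p \<in> Y" and k: "1 \<le> k"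
    and g: "C_diff_on k n (\<psi> ` (V \<inter> Y)) (\<lambda>x. g (inv_into V \<psi> x))"
  shows "\<exists>d. chart_deriv X n \<psi> Y g p d"
proof -
  note inj = corner_chartD(5)[OF c]
  obtain W h where W: "openin (Euclidean_space n) W" "\<psi> p \<in> W" "C_diff_open 1 n W h"
    "\<And>x. x \<in> W \<inter> \<psi> ` (V \<inter> Y) \<Longrightarrow> h x = g (inv_into V \<psi> x)"
    using g p k unfolding C_diff_on_def by (metis IntI imageI one_enat_def)
  have hg: "h (\<psi> r) = g r" if "r \<in> V" "r \<in> Y" "\<psi> r \<in> W" for r
    using W(4)[of "\<psi> r"] that inj by (simp add: inv_into_f_f)
  obtain d where d: "\<And>\<eta>. \<eta> > 0 \<Longrightarrow> \<exists>\<delta>>0. \<forall>z\<in>W. l1 n z (\<psi> p) < \<delta> \<longrightarrow>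
    \<bar>h z - h (\<psi> p) - (\<Sum>i<n. d i * (z i - \<psi> p i))\<bar> \<le> \<eta> * l1 n z (\<psi> p)"
    using C_diff_open_frechet[OF W(1,3,2)] by blast
  obtain \<delta>0 where \<delta>0: "\<delta>0 > 0" "\<And>z. z \<in> real_tuples n \<Longrightarrow> (\<forall>i<n. \<bar>z i - \<psi> p i\<bar> < \<delta>0) \<Longrightarrow> z \<in> W"
    using openin_Euclidean_space_box[OF W(1,2)] by blast
  have "chart_deriv X n \<psi> Y g p d" unfolding chart_deriv_def chart_nhdsin[OF c p(1)]
  proof (intro allI impI)
    fix \<eta> :: real assume "\<eta> > 0"
    then obtain \<delta> where \<delta>: "\<delta> > 0" "\<And>z. z \<in> W \<Longrightarrow> l1 n z (\<psi> p) < \<delta> \<Longrightarrow>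
      \<bar>h z - h (\<psi> p) - (\<Sum>i<n. d i * (z i - \<psi> p i))\<bar> \<le> \<eta> * l1 n z (\<psi> p)" using d by blast
    have "\<bar>g r - g p - (\<Sum>i<n. d i * (\<psi> r i - \<psi> p i))\<bar> \<le> \<eta> * l1 n (\<psi> r) (\<psi> p)"
      if r: "r \<in> V" "l1 n (\<psi> r) (\<psi> p) < min \<delta> \<delta>0" "r \<in> Y" for r
    proof -
      have "\<psi> r \<in> real_tuples n" using corner_chartD(6)[OF c] r(1) by (auto simp: corner_space_def)
      then have "\<psi> r \<in> W"
        by (rule \<delta>0(2)) (use r(2) in \<open>auto intro: le_less_trans[OF abs_le_l1]\<close>)
      then show ?thesis using \<delta>(2)[of "\<psi> r"] r hg p W(2) by simp
    qed
    then show "\<exists>\<delta>>0. \<forall>r\<in>V. l1 n (\<psi> r) (\<psi> p) < \<delta> \<longrightarrow> r \<in> Y \<longrightarrow>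
        \<bar>g r - g p - (\<Sum>i<n. d i * (\<psi> r i - \<psi> p i))\<bar> \<le> \<eta> * l1 n (\<psi> r) (\<psi> p)"
      using \<delta>(1) \<delta>0(1) by (intro exI[of _ "min \<delta> \<delta>0"]) auto
  qed
  then show ?thesis by blast
qed

text \<open>The model corner allows a forward step in every coordinate, and a backward step in each
  coordinate that is free or still positive at \<open>p\<close>.\<close>

lemma chart_curve:
  assumes c: "corner_chart n X (V, m, \<psi>)" and p: "p \<in> V" and k: "k < n"
    and e: "e = 1 \<or> e = -1 \<and> k \<notin> vanishing n m (\<psi> p)"
  obtains \<rho> where "filterlim \<rho> (nhdsin X p) (at_right 0)"
    "\<forall>\<^sub>F t in at_right 0. \<rho> t \<in> V \<and> \<psi> (\<rho> t) = (\<psi> p)(k := \<psi> p k + e * t)"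
proof -
  obtain T where T: "openin (Euclidean_space n) T" "\<psi> ` V = T \<inter> corner_space n m"
    using corner_chartD(4)[OF c] by (auto simp: openin_subtopology)
  have pT: "\<psi> p \<in> T" "\<psi> p \<in> corner_space n m" using T(2) p by auto
  obtain \<delta>0 where \<delta>0: "\<delta>0 > 0" "\<And>z. z \<in> real_tuples n \<Longrightarrow> (\<forall>i<n. \<bar>z i - \<psi> p i\<bar> < \<delta>0) \<Longrightarrow> z \<in> T"
    using openin_Euclidean_space_box[OF T(1) pT(1)] by blast
  define z where "z t = (\<psi> p)(k := \<psi> p k + e * t)" for t
  define \<rho> where "\<rho> t = inv_into V \<psi> (z t)" for t
  \<comment> \<open>A backward step shorter than a positive coordinate keeps it nonnegative; the
    value 1 is a filler for the remaining cases.\<close>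
  define \<delta>1 where "\<delta>1 = min \<delta>0 (if \<psi> p k > 0 then \<psi> p k else 1)"
  have "\<delta>1 > 0" using \<delta>0(1) by (simp add: \<delta>1_def)
  have zV: "z t \<in> \<psi> ` V" if t: "0 < t" "t < \<delta>1" for t
  proof -
    have et: "\<bar>e * t\<bar> = t" using e t by (auto simp: abs_mult)
    have tup: "z t \<in> real_tuples n"
      using pT(2) k by (auto simp: z_def corner_space_def topspace_Euclidean_space)
    moreover have "\<forall>i<n. \<bar>z t i - \<psi> p i\<bar> < \<delta>0" using et t \<delta>0(1) by (auto simp: z_def \<delta>1_def)
    ultimately have "z t \<in> T" by (rule \<delta>0(2))
    moreover have "0 \<le> z t i" if i: "i \<in> {n - m..<n}" for i
    proof (cases "i = k")
      case True
      have "0 \<le> \<psi> p k" using pT(2) i True by (auto simp: corner_space_def)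
      show ?thesis
      proof (cases "e = 1")
        case False
        then have "e = -1" "k \<notin> vanishing n m (\<psi> p)" using e by auto
        then have "\<psi> p k \<noteq> 0" using i True by (auto simp: vanishing_def)
        then have "t < \<psi> p k" using t \<open>0 \<le> \<psi> p k\<close> by (auto simp: \<delta>1_def split: if_splits)
        then show ?thesis using True \<open>e = -1\<close> by (simp add: z_def)
      qed (use True t \<open>0 \<le> \<psi> p k\<close> in \<open>simp add: z_def\<close>)
    qed (use pT(2) i in \<open>auto simp: z_def corner_space_def\<close>)
    ultimately show ?thesis using tup unfolding T(2) by (auto simp: corner_space_def)
  qed
  have ev: "\<forall>\<^sub>F t in at_right 0. \<rho> t \<in> V \<and> \<psi> (\<rho> t) = z t"
    unfolding eventually_at_right_0_iff
    using zV \<open>\<delta>1 > 0\<close> by (intro exI[of _ \<delta>1]) (auto simp: \<rho>_def f_inv_into_f inv_into_into)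
  have "filterlim \<rho> (nhdsin X p) (at_right 0)" unfolding filterlim_iff
  proof (intro allI impI)
    fix P assume "\<forall>\<^sub>F r in nhdsin X p. P r"
    then obtain \<delta> where \<delta>: "\<delta> > 0" "\<And>r. r \<in> V \<Longrightarrow> l1 n (\<psi> r) (\<psi> p) < \<delta> \<Longrightarrow> P r"
      unfolding chart_nhdsin[OF c p] by blast
    have "\<forall>\<^sub>F t in at_right 0. 0 < t \<and> t < \<delta>"
      unfolding eventually_at_right_0_iff using \<delta>(1) by blast
    then show "\<forall>\<^sub>F t in at_right 0. P (\<rho> t)" using ev
    proof eventually_elim
      case (elim t)
      have "l1 n (\<psi> (\<rho> t)) (\<psi> p) = \<bar>e * t\<bar>"
        using elim(2) l1_upd[OF k, of "\<psi> p" "\<psi> p k + e * t"] by (simp add: z_def)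
      also have "\<bar>e * t\<bar> = t" using e elim(1) by (auto simp: abs_mult)
      finally show ?case using \<delta>(2) elim by simp
    qed
  qed
  then show ?thesis using that ev unfolding z_def by blast
qed

lemma chart_chain:
  assumes d: "chart_deriv X n \<psi> Y g p d" and \<rho>: "filterlim \<rho> (nhdsin X p) (at_right 0)"
    and Y: "\<forall>\<^sub>F t in at_right 0. \<rho> t \<in> Y"
    and w: "\<And>i. i < n \<Longrightarrow> ((\<lambda>t. (\<psi> (\<rho> t) i - \<psi> p i) / t) \<longlongrightarrow> w i) (at_right 0)"
  shows "((\<lambda>t. (g (\<rho> t) - g p) / t) \<longlongrightarrow> (\<Sum>i<n. d i * w i)) (at_right 0)"
proof -
  define L where "L = (\<Sum>i<n. \<bar>w i\<bar>)"
  have L: "L \<ge> 0" by (simp add: L_def sum_nonneg)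
  have pos: "\<forall>\<^sub>F t in at_right (0::real). 0 < t" by (rule eventually_at_right_less)
  have "((\<lambda>t. \<Sum>i<n. \<bar>(\<psi> (\<rho> t) i - \<psi> p i) / t\<bar>) \<longlongrightarrow> L) (at_right 0)"
    unfolding L_def by (intro tendsto_sum tendsto_rabs w) auto
  then have bd: "\<forall>\<^sub>F t in at_right 0. (\<Sum>i<n. \<bar>(\<psi> (\<rho> t) i - \<psi> p i) / t\<bar>) < L + 1"
    by (rule order_tendstoD(2)) simp
  have "((\<lambda>t. (g (\<rho> t) - g p) / t - (\<Sum>i<n. d i * ((\<psi> (\<rho> t) i - \<psi> p i) / t))) \<longlongrightarrow> 0) (at_right 0)"
  proof (rule tendstoI)
    fix \<epsilon> :: real assume "\<epsilon> > 0"
    \<comment> \<open>The difference quotients of the chart coordinates have total size below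
      \<open>L + 1\<close>, so this bounds the error by \<open>\<epsilon> / 2\<close>.\<close>
    define \<eta> where "\<eta> = \<epsilon> / (2 * (L + 1))"
    have \<eta>: "\<eta> > 0" "\<eta> * (L + 1) < \<epsilon>" using \<open>\<epsilon> > 0\<close> L by (simp_all add: \<eta>_def divide_simps)
    have "\<forall>\<^sub>F t in at_right 0. \<rho> t \<in> Y \<longrightarrow> \<bar>g (\<rho> t) - g p - (\<Sum>i<n. d i * (\<psi> (\<rho> t) i - \<psi> p i))\<bar>
        \<le> \<eta> * l1 n (\<psi> (\<rho> t)) (\<psi> p)"
      using d \<eta>(1) \<rho> unfolding chart_deriv_def filterlim_iff by blast
    then show "\<forall>\<^sub>F t in at_right 0.
      dist ((g (\<rho> t) - g p) / t - (\<Sum>i<n. d i * ((\<psi> (\<rho> t) i - \<psi> p i) / t))) 0 < \<epsilon>"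
      using Y bd pos
    proof eventually_elim
      case (elim t)
      have "(g (\<rho> t) - g p) / t - (\<Sum>i<n. d i * ((\<psi> (\<rho> t) i - \<psi> p i) / t))
        = (g (\<rho> t) - g p - (\<Sum>i<n. d i * (\<psi> (\<rho> t) i - \<psi> p i))) / t"
        unfolding times_divide_eq_right sum_divide_distrib[symmetric] diff_divide_distrib[symmetric] ..
      also have "\<bar>\<dots>\<bar> \<le> \<eta> * l1 n (\<psi> (\<rho> t)) (\<psi> p) / t"
        using elim by (simp add: abs_divide divide_right_mono)
      also have "\<dots> = \<eta> * (\<Sum>i<n. \<bar>(\<psi> (\<rho> t) i - \<psi> p i) / t\<bar>)"
        using elim(4) by (simp add: l1_def abs_divide flip: sum_divide_distrib)
      also have "\<dots> \<le> \<eta> * (L + 1)" using elim(3) \<eta>(1) by (intro mult_left_mono) auto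
      also have "\<dots> < \<epsilon>" by (rule \<eta>(2))
      finally show ?case by simp
    qed
  qed
  moreover have "((\<lambda>t. \<Sum>i<n. d i * ((\<psi> (\<rho> t) i - \<psi> p i) / t)) \<longlongrightarrow> (\<Sum>i<n. d i * w i)) (at_right 0)"
    by (intro tendsto_sum tendsto_mult tendsto_const w) auto
  ultimately show ?thesis using tendsto_add by fastforce
qed

lemma chart_curve_coord:
  fixes \<psi> :: "'a \<Rightarrow> nat \<Rightarrow> real" and e :: real
  assumes "\<forall>\<^sub>F t in at_right 0. \<rho> t \<in> V \<and> \<psi> (\<rho> t) = (\<psi> p)(k := \<psi> p k + e * t)"
  shows "((\<lambda>t. (\<psi> (\<rho> t) i - \<psi> p i) / t) \<longlongrightarrow> (if i = k then e else 0)) (at_right 0)"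
proof (rule tendsto_eventually)
  show "\<forall>\<^sub>F t in at_right 0. (\<psi> (\<rho> t) i - \<psi> p i) / t = (if i = k then e else 0)"
    by (rule eventually_mono[OF eventually_conj[OF assms eventually_at_right_less]]) auto
qed

lemma chart_deriv_coord:
  assumes "chart_deriv X n \<psi> Y g p d" "filterlim \<rho> (nhdsin X p) (at_right 0)" "k < n"
    and "\<forall>\<^sub>F t in at_right 0. \<rho> t \<in> Y"
    and "\<forall>\<^sub>F t in at_right 0. \<rho> t \<in> V \<and> \<psi> (\<rho> t) = (\<psi> p)(k := \<psi> p k + e * t)"
  shows "((\<lambda>t. (g (\<rho> t) - g p) / t) \<longlongrightarrow> e * d k) (at_right 0)"
proof -
  have "(\<Sum>i<n. d i * (if i = k then e else 0)) = e * d k"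
    using assms(3) by (simp add: if_distrib cong: if_cong)
  then show ?thesis using chart_chain[OF assms(1,2,4) chart_curve_coord[OF assms(5)]] by simp
qed

text \<open>The partial derivative and the total derivative are compared along the forward
  coordinate curve, which exists at every point of a corner. Its points must belong both to
  \<open>Y\<close>, where \<open>g\<close> is differentiated, and to \<open>Y'\<close>, where the
  partial derivative is taken.\<close>

lemma chart_deriv_partial:
  assumes c: "corner_chart n X (V, m, \<psi>)" and p: "p \<in> V" and d: "chart_deriv X n \<psi> Y g p d" and k: "k < n"
    and part: "has_partial_derivative (\<lambda>x. g (inv_into V \<psi> x)) k d' (\<psi> p) (\<psi> ` Y')"
    and Y': "Y' \<subseteq> V" "\<forall>\<^sub>F r in nhdsin X p. r \<in> V \<and> (\<forall>i. i \<noteq> k \<longrightarrow> \<psi> r i = \<psi> p i) \<longrightarrow> r \<in> Y \<inter> Y'"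
  shows "d k = d'"
proof -
  note inj = corner_chartD(5)[OF c]
  obtain \<rho> where \<rho>: "filterlim \<rho> (nhdsin X p) (at_right 0)"
    "\<forall>\<^sub>F t in at_right 0. \<rho> t \<in> V \<and> \<psi> (\<rho> t) = (\<psi> p)(k := \<psi> p k + 1 * t)"
    using chart_curve[OF c p k, of 1] by blast
  have "\<forall>\<^sub>F t in at_right 0. \<rho> t \<in> V \<and> (\<forall>i. i \<noteq> k \<longrightarrow> \<psi> (\<rho> t) i = \<psi> p i) \<longrightarrow> \<rho> t \<in> Y \<inter> Y'"
    using Y'(2) \<rho>(1) unfolding filterlim_iff by blast
  then have inY: "\<forall>\<^sub>F t in at_right 0. \<rho> t \<in> Y \<inter> Y'"
    using \<rho>(2) by eventually_elim simp
  then have "\<forall>\<^sub>F t in at_right 0. \<rho> t \<in> Y" by eventually_elim simp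
  from chart_deriv_coord[OF d \<rho>(1) k this \<rho>(2)]
  have 1: "((\<lambda>t. (g (\<rho> t) - g p) / t) \<longlongrightarrow> d k) (at_right 0)" by simp
  define S where "S = {t. (\<psi> p)(k := t) \<in> \<psi> ` Y'}"
  define G where "G t = g (inv_into V \<psi> ((\<psi> p)(k := t)))" for t
  have "(G has_real_derivative d') (at (\<psi> p k) within S)"
    using part unfolding has_partial_derivative_def G_def S_def .
  then have lim: "((\<lambda>s. (G s - G (\<psi> p k)) / (s - \<psi> p k)) \<longlongrightarrow> d') (at (\<psi> p k) within S)"
    by (simp add: has_field_derivative_iff)
  have fl: "filterlim (\<lambda>t. \<psi> p k + t) (at (\<psi> p k) within S) (at_right 0)"
    unfolding filterlim_at
  proof
    show "\<forall>\<^sub>F t in at_right 0. \<psi> p k + t \<in> S \<and> \<psi> p k + t \<noteq> \<psi> p k"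
      using inY \<rho>(2) eventually_at_right_less[of "0::real"]
    proof eventually_elim
      case (elim t)
      then have "(\<psi> p)(k := \<psi> p k + t) \<in> \<psi> ` Y'" by (metis IntD2 imageI mult_1)
      then show ?case using elim by (simp add: S_def)
    qed
    have "((\<lambda>t. \<psi> p k + t) \<longlongrightarrow> \<psi> p k + 0) (at_right 0)"
      by (intro tendsto_intros)
    then show "((\<lambda>t. \<psi> p k + t) \<longlongrightarrow> \<psi> p k) (at_right 0)" by simp
  qed
  have "((\<lambda>t. (G (\<psi> p k + t) - G (\<psi> p k)) / (\<psi> p k + t - \<psi> p k)) \<longlongrightarrow> d') (at_right 0)"
    by (rule filterlim_compose[OF lim fl])
  moreover have "\<forall>\<^sub>F t in at_right 0. (G (\<psi> p k + t) - G (\<psi> p k)) / (\<psi> p k + t - \<psi> p k) = (g (\<rho> t) - g p) / t"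
    using \<rho>(2)
  proof eventually_elim
    case (elim t)
    have "(\<psi> p)(k := \<psi> p k + t) = \<psi> (\<rho> t)" using elim by simp
    then have "G (\<psi> p k + t) = g (inv_into V \<psi> (\<psi> (\<rho> t)))" by (simp only: G_def)
    moreover have "inv_into V \<psi> (\<psi> (\<rho> t)) = \<rho> t" using inv_into_f_f[OF inj] elim by blast
    ultimately have "G (\<psi> p k + t) = g (\<rho> t)" by (simp only:)
    moreover have "G (\<psi> p k) = g p" using inj p by (simp add: G_def)
    ultimately show ?case by simp
  qed
  ultimately have "((\<lambda>t. (g (\<rho> t) - g p) / t) \<longlongrightarrow> d') (at_right 0)"
    using tendsto_cong by fast
  then show ?thesis using 1 tendsto_unique trivial_limit_at_right_real by blast
qed

section \<open>Invariance of the depth\<close>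

lemma smooth_transition_deriv:
  assumes c: "corner_chart n X (U, m, \<phi>)" and s: "smooth_transition n (U, m, \<phi>) (V, l, \<psi>)" and p: "p \<in> U" "p \<in> V"
  obtains B where "\<And>j. j < n \<Longrightarrow> chart_deriv X n \<phi> V (\<lambda>r. \<psi> r j) p (B j)"
proof -
  have "\<exists>d. chart_deriv X n \<phi> V (\<lambda>r. \<psi> r j) p d" if "j < n" for j
    by (rule C_diff_on_chart_deriv[OF c p, of "\<infinity>"])
      (use s that in \<open>auto simp: smooth_transition_def C_diff_map_on_def\<close>)
  then show ?thesis using that by metis
qed

text \<open>The \<open>k\<close>-th coordinate curve of \<open>\<phi>\<close> has velocity 1 in
  coordinate \<open>k\<close>; computing that velocity by the chain rule through
  \<open>\<psi>\<close> gives the diagonal entry of the product of the Jacobians. The diagonal is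
  what a trace requires.\<close>

lemma transition_inverse:
  assumes c: "corner_chart n X (U, m, \<phi>)" and V: "openin X V" and p: "p \<in> U" "p \<in> V"
    and B: "\<And>j. j < n \<Longrightarrow> chart_deriv X n \<phi> V (\<lambda>r. \<psi> r j) p (B j)"
    and B': "\<And>i. i < n \<Longrightarrow> chart_deriv X n \<psi> U (\<lambda>r. \<phi> r i) p (B' i)"
    and k: "k < n"
  shows "(\<Sum>j<n. B' k j * B j k) = 1"
proof -
  obtain \<rho> where \<rho>: "filterlim \<rho> (nhdsin X p) (at_right 0)"
    "\<forall>\<^sub>F t in at_right 0. \<rho> t \<in> U \<and> \<phi> (\<rho> t) = (\<phi> p)(k := \<phi> p k + 1 * t)"
    using chart_curve[OF c p(1) k, of 1] by blast
  have \<rho>V: "\<forall>\<^sub>F t in at_right 0. \<rho> t \<in> V"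
    using \<rho>(1) eventually_nhdsin_mem[OF V p(2)] unfolding filterlim_iff by blast
  have \<rho>U: "\<forall>\<^sub>F t in at_right 0. \<rho> t \<in> U" using \<rho>(2) by eventually_elim simp
  have "((\<lambda>t. (\<psi> (\<rho> t) j - \<psi> p j) / t) \<longlongrightarrow> B j k) (at_right 0)" if "j < n" for j
    using chart_deriv_coord[OF B[OF that] \<rho>(1) k \<rho>V \<rho>(2)] by simp
  from chart_chain[OF B'[OF k] \<rho>(1) \<rho>U this]
  have "((\<lambda>t. (\<phi> (\<rho> t) k - \<phi> p k) / t) \<longlongrightarrow> (\<Sum>j<n. B' k j * B j k)) (at_right 0)" by simp
  moreover have "((\<lambda>t. (\<phi> (\<rho> t) k - \<phi> p k) / t) \<longlongrightarrow> 1) (at_right 0)"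
    using chart_curve_coord[OF \<rho>(2), of k] by simp
  ultimately show ?thesis using tendsto_unique trivial_limit_at_right_real by blast
qed

text \<open>A \<open>y\<close>-coordinate of \<open>\<psi>\<close> that is 0 at \<open>p\<close>
  cannot decrease there. Moving both ways along a free direction of \<open>\<phi>\<close> makes its
  derivative both nonnegative and nonpositive.\<close>

lemma transition_tangent:
  assumes c: "corner_chart n X (U, m, \<phi>)" and c': "corner_chart n X (V, l, \<psi>)" and p: "p \<in> U" "p \<in> V"
    and B: "chart_deriv X n \<phi> V (\<lambda>r. \<psi> r j) p d"
    and k: "k < n" "k \<notin> vanishing n m (\<phi> p)" and j: "j \<in> vanishing n l (\<psi> p)"
  shows "d k = 0"
proof -
  have "0 \<le> e * d k" if e: "e = 1 \<or> e = -1" for e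
  proof -
    obtain \<rho> where \<rho>: "filterlim \<rho> (nhdsin X p) (at_right 0)"
      "\<forall>\<^sub>F t in at_right 0. \<rho> t \<in> U \<and> \<phi> (\<rho> t) = (\<phi> p)(k := \<phi> p k + e * t)"
      using chart_curve[OF c p(1) k(1), of e] e k(2) by blast
    have \<rho>V: "\<forall>\<^sub>F t in at_right 0. \<rho> t \<in> V"
      using \<rho>(1) eventually_nhdsin_mem[OF corner_chartD(2)[OF c'] p(2)] unfolding filterlim_iff by blast
    have "\<forall>\<^sub>F t in at_right 0. 0 \<le> (\<psi> (\<rho> t) j - \<psi> p j) / t"
      using \<rho>V eventually_at_right_less[of "0::real"]
    proof eventually_elim
      case (elim t)
      then have "\<psi> (\<rho> t) \<in> corner_space n l" using corner_chartD(6)[OF c'] by blast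
      then show ?case using j elim by (auto simp: corner_space_def vanishing_def)
    qed
    then show ?thesis
      using tendsto_lowerbound[OF chart_deriv_coord[OF B \<rho>(1) k(1) \<rho>V \<rho>(2)]] trivial_limit_at_right_real
      by blast
  qed
  from this[of 1] this[of "-1"] show ?thesis by simp
qed

text \<open>The depth is a trace: with \<open>B, B'\<close> the mutually inverse Jacobians of the transition maps,
  \<open>n - depth\<close> equals \<open>\<Sum> B' k j B j k\<close> over the free indices \<open>j, k\<close> of both charts, because \<open>B\<close>
  maps the tangent space of one stratum into the other.\<close>

lemma depth_unique:
  assumes c: "corner_chart n X (U, m, \<phi>)" and c': "corner_chart n X (V, l, \<psi>)"
    and s: "smooth_transition n (U, m, \<phi>) (V, l, \<psi>)" and s': "smooth_transition n (V, l, \<psi>) (U, m, \<phi>)"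
    and p: "p \<in> U" "p \<in> V"
  shows "card (vanishing n m (\<phi> p)) = card (vanishing n l (\<psi> p))"
proof -
  obtain B where B: "\<And>j. j < n \<Longrightarrow> chart_deriv X n \<phi> V (\<lambda>r. \<psi> r j) p (B j)"
    using smooth_transition_deriv[OF c s p] by blast
  obtain B' where B': "\<And>j. j < n \<Longrightarrow> chart_deriv X n \<psi> U (\<lambda>r. \<phi> r j) p (B' j)"
    using smooth_transition_deriv[OF c' s' p(2,1)] by blast
  define I J where "I = {..<n} - vanishing n m (\<phi> p)" and "J = {..<n} - vanishing n l (\<psi> p)"
  have sub: "vanishing n m (\<phi> p) \<subseteq> {..<n}" "vanishing n l (\<psi> p) \<subseteq> {..<n}" by (auto simp: vanishing_def)
  have tr: "real (card I) = (\<Sum>k\<in>I. \<Sum>j\<in>J. B' k j * B j k)"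
  proof -
    have "(\<Sum>j\<in>J. B' k j * B j k) = 1" if k: "k \<in> I" for k
    proof -
      have "(\<Sum>j<n. B' k j * B j k) = 1"
        by (rule transition_inverse[OF c corner_chartD(2)[OF c'] p B B']) (use k in \<open>auto simp: I_def\<close>)
      moreover have "(\<Sum>j\<in>J. B' k j * B j k) = (\<Sum>j<n. B' k j * B j k)"
      proof (rule sum.mono_neutral_left)
        show "\<forall>j\<in>{..<n} - J. B' k j * B j k = 0"
        proof
          fix j assume "j \<in> {..<n} - J"
          then have "j < n" "j \<in> vanishing n l (\<psi> p)" by (auto simp: J_def)
          then have "B j k = 0" using transition_tangent[OF c c' p B[of j], of k] k by (simp add: I_def)
          then show "B' k j * B j k = 0" by simp
        qed
      qed (auto simp: J_def)
      ultimately show ?thesis by simp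
    qed
    then show ?thesis by simp
  qed
  have tr': "real (card J) = (\<Sum>j\<in>J. \<Sum>k\<in>I. B j k * B' k j)"
  proof -
    have "(\<Sum>k\<in>I. B j k * B' k j) = 1" if j: "j \<in> J" for j
    proof -
      have "(\<Sum>k<n. B j k * B' k j) = 1"
        by (rule transition_inverse[OF c' corner_chartD(2)[OF c] p(2,1) B' B]) (use j in \<open>auto simp: J_def\<close>)
      moreover have "(\<Sum>k\<in>I. B j k * B' k j) = (\<Sum>k<n. B j k * B' k j)"
      proof (rule sum.mono_neutral_left)
        show "\<forall>k\<in>{..<n} - I. B j k * B' k j = 0"
        proof
          fix k assume "k \<in> {..<n} - I"
          then have "k < n" "k \<in> vanishing n m (\<phi> p)" by (auto simp: I_def)
          then have "B' k j = 0" using transition_tangent[OF c' c p(2,1) B'[of k], of j] j by (simp add: J_def)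
          then show "B j k * B' k j = 0" by simp
        qed
      qed (auto simp: I_def)
      ultimately show ?thesis by simp
    qed
    then show ?thesis by simp
  qed
  have "real (card I) = real (card J)"
    unfolding tr tr' by (subst sum.swap) (simp add: mult.commute)
  moreover have "card I = n - card (vanishing n m (\<phi> p))" "card J = n - card (vanishing n l (\<psi> p))"
    unfolding I_def J_def using sub by (simp_all add: card_Diff_subset finite_subset)
  moreover have "card (vanishing n m (\<phi> p)) \<le> n" "card (vanishing n l (\<psi> p)) \<le> n"
    using card_mono[OF _ sub(1)] card_mono[OF _ sub(2)] by auto
  ultimately show ?thesis by linarith
qed

section \<open>A bound for injective matrices and rules for chart derivatives\<close>

text \<open>The continuous function \<open>F\<close> attains a minimum on the compact unit sphere of
  the \<open>l1\<close> norm, positive by injectivity; homogeneity extends the estimate to all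
  vectors.\<close>

lemma injective_matrix_lower_bound:
  fixes J :: "nat \<Rightarrow> nat \<Rightarrow> real"
  assumes inj: "\<And>v :: nat \<Rightarrow> real. (\<And>j. j < N \<Longrightarrow> (\<Sum>i<n. J j i * v i) = 0) \<Longrightarrow> (\<forall>i<n. v i = 0)"
  obtains c where "c > 0" "\<And>v. c * (\<Sum>i<n. \<bar>v i\<bar>) \<le> (\<Sum>j<N. \<bar>\<Sum>i<n. J j i * v i\<bar>)"
proof -
  define F where "F v = (\<Sum>j<N. \<bar>\<Sum>i<n. J j i * v i\<bar>)" for v :: "nat \<Rightarrow> real"
  \<comment> \<open>Coordinates from \<open>n\<close> on are confined to 0, which makes the product
    over all indices compact by Tychonoff's theorem.\<close>
  define K where "K = PiE UNIV (\<lambda>i. if i < n then {-1..1} else {0::real}) \<inter> {v. (\<Sum>i<n. \<bar>v i\<bar>) = 1}"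
  have "compactin (product_topology (\<lambda>_. euclideanreal) UNIV) (PiE UNIV (\<lambda>i. if i < n then {-1..1} else {0::real}))"
    unfolding compactin_PiE by auto
  then have "compact (PiE UNIV (\<lambda>i. if i < n then {-1..1} else {0::real}))"
    by (simp add: euclidean_product_topology)
  moreover have "closed {v. (\<Sum>i<n. \<bar>v i\<bar>) = (1::real)}"
    by (intro closed_Collect_eq continuous_intros continuous_on_product_coordinates)
  ultimately have "compact K" unfolding K_def by (rule compact_Int_closed)
  have cont: "continuous_on K F" unfolding F_def
    by (intro continuous_intros continuous_on_subset[OF continuous_on_product_coordinates]) auto
  have scale: "\<exists>u\<in>K. F v = (\<Sum>i<n. \<bar>v i\<bar>) * F u" if "(\<Sum>i<n. \<bar>v i\<bar>) > 0" for v
  proof -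
    define s where "s = (\<Sum>i<n. \<bar>v i\<bar>)"
    define u where "u i = (if i < n then v i / s else 0)" for i
    have s: "s > 0" using that by (simp add: s_def)
    have "\<bar>v i\<bar> \<le> s" if "i < n" for i
      unfolding s_def by (rule member_le_sum[of i "{..<n}" "\<lambda>i. \<bar>v i\<bar>"]) (use that in auto)
    then have "\<bar>u i\<bar> \<le> 1" if "i < n" for i using that s by (simp add: u_def abs_divide)
    moreover have "(\<Sum>i<n. \<bar>u i\<bar>) = 1"
      using s by (simp add: u_def abs_divide s_def flip: sum_divide_distrib)
    moreover have "u i = 0" if "\<not> i < n" for i using that by (simp add: u_def)
    ultimately have "u \<in> K" by (auto simp: K_def PiE_iff abs_le_iff)
    moreover have "F v = s * F u"
    proof -
      have "(\<Sum>i<n. J j i * v i) = s * (\<Sum>i<n. J j i * u i)" for j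
        unfolding sum_distrib_left by (rule sum.cong) (use s in \<open>auto simp: u_def\<close>)
      then have "F v = (\<Sum>j<N. \<bar>s * (\<Sum>i<n. J j i * u i)\<bar>)" by (simp only: F_def)
      also have "\<dots> = s * F u"
        unfolding F_def sum_distrib_left[of s "\<lambda>j. \<bar>\<Sum>i<n. J j i * u i\<bar>"]
        using s by (simp only: abs_mult abs_of_pos)
      finally show ?thesis .
    qed
    ultimately show ?thesis unfolding s_def by blast
  qed
  show ?thesis
  proof (cases "K = {}")
    \<comment> \<open>This is the case \<open>n = 0\<close>, in which the unit sphere is empty and
      all sums vanish.\<close>
    case True
    have "(\<Sum>i<n. \<bar>v i\<bar>) = 0" for v :: "nat \<Rightarrow> real"
    proof (rule ccontr)
      assume "(\<Sum>i<n. \<bar>v i\<bar>) \<noteq> 0"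
      moreover have "(\<Sum>i<n. \<bar>v i\<bar>) \<ge> 0" by (rule sum_nonneg) simp
      ultimately have "(\<Sum>i<n. \<bar>v i\<bar>) > 0" by linarith
      from scale[OF this] show False using True by blast
    qed
    then show ?thesis by (intro that[of 1]) (auto intro: sum_nonneg)
  next
    case False
    obtain u where u: "u \<in> K" "\<And>v. v \<in> K \<Longrightarrow> F u \<le> F v"
      using continuous_attains_inf[OF \<open>compact K\<close> False cont] by blast
    have "F u \<noteq> 0"
    proof
      assume "F u = 0"
      then have "(\<Sum>i<n. J j i * u i) = 0" if "j < N" for j
        using that by (simp add: F_def sum_nonneg_eq_0_iff)
      then have "\<forall>i<n. u i = 0" by (rule inj)
      then show False using u(1) by (simp add: K_def)
    qed
    moreover have "F u \<ge> 0" by (simp add: F_def sum_nonneg)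
    moreover have "F u * (\<Sum>i<n. \<bar>v i\<bar>) \<le> F v" for v
    proof (cases "(\<Sum>i<n. \<bar>v i\<bar>) > 0")
      case True
      from scale[OF this] obtain w where "w \<in> K" "F v = (\<Sum>i<n. \<bar>v i\<bar>) * F w" by blast
      then show ?thesis using u(2)[of w] True by (simp add: mult.commute)
    next
      case False
      moreover have "(\<Sum>i<n. \<bar>v i\<bar>) \<ge> 0" by (rule sum_nonneg) simp
      ultimately have "(\<Sum>i<n. \<bar>v i\<bar>) = 0" by linarith
      then show ?thesis by (simp add: F_def sum_nonneg)
    qed
    moreover have "F u > 0" using \<open>F u \<noteq> 0\<close> \<open>F u \<ge> 0\<close> by linarith
    ultimately show ?thesis using that[of "F u"] unfolding F_def by blast
  qed
qed

lemma chart_deriv_continuous: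
  assumes c: "corner_chart n X (V, m, \<psi>)" and p: "p \<in> V" and d: "chart_deriv X n \<psi> Y g p d" and \<epsilon>: "\<epsilon> > 0"
  shows "\<forall>\<^sub>F r in nhdsin X p. r \<in> Y \<longrightarrow> \<bar>g r - g p\<bar> < \<epsilon>"
proof -
  define M where "M = (\<Sum>i<n. \<bar>d i\<bar>)"
  have M: "M \<ge> 0" by (simp add: M_def sum_nonneg)
  have "\<forall>\<^sub>F r in nhdsin X p. l1 n (\<psi> r) (\<psi> p) < \<epsilon> / (M + 2)"
    unfolding chart_nhdsin[OF c p] using \<epsilon> M by (intro exI[of _ "\<epsilon> / (M + 2)"]) auto
  moreover have "\<forall>\<^sub>F r in nhdsin X p. r \<in> Y \<longrightarrow>
      \<bar>g r - g p - (\<Sum>i<n. d i * (\<psi> r i - \<psi> p i))\<bar> \<le> 1 * l1 n (\<psi> r) (\<psi> p)"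
    using d unfolding chart_deriv_def by (meson zero_less_one)
  ultimately show ?thesis
  proof eventually_elim
    case (elim r)
    show ?case
    proof
      assume "r \<in> Y"
      have "\<bar>\<Sum>i<n. d i * (\<psi> r i - \<psi> p i)\<bar> \<le> (\<Sum>i<n. \<bar>d i\<bar> * l1 n (\<psi> r) (\<psi> p))"
        by (rule order_trans[OF sum_abs sum_mono]) (auto simp: abs_mult intro!: mult_left_mono abs_le_l1)
      also have "\<dots> = M * l1 n (\<psi> r) (\<psi> p)" by (simp add: M_def sum_distrib_right)
      finally have "\<bar>g r - g p\<bar> \<le> (M + 1) * l1 n (\<psi> r) (\<psi> p)"
        using elim(2) \<open>r \<in> Y\<close> by (simp add: distrib_right)
      also have "\<dots> \<le> (M + 1) * (\<epsilon> / (M + 2))" using elim(1) M by (intro mult_left_mono) auto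
      also have "\<dots> < \<epsilon>" using \<epsilon> M by (simp add: field_simps)
      finally show "\<bar>g r - g p\<bar> < \<epsilon>" .
    qed
  qed
qed

lemma chart_deriv_add:
  assumes "chart_deriv X n \<psi> Y g p d" "chart_deriv X n \<psi> Y h p e"
  shows "chart_deriv X n \<psi> Y (\<lambda>r. g r + h r) p (\<lambda>i. d i + e i)"
  unfolding chart_deriv_def
proof (intro allI impI)
  fix \<eta> :: real assume "\<eta> > 0"
  then have "\<eta> / 2 > 0" by simp
  with assms have "\<forall>\<^sub>F r in nhdsin X p. r \<in> Y \<longrightarrow>
      \<bar>g r - g p - (\<Sum>i<n. d i * (\<psi> r i - \<psi> p i))\<bar> \<le> \<eta> / 2 * l1 n (\<psi> r) (\<psi> p)"
    "\<forall>\<^sub>F r in nhdsin X p. r \<in> Y \<longrightarrow>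
      \<bar>h r - h p - (\<Sum>i<n. e i * (\<psi> r i - \<psi> p i))\<bar> \<le> \<eta> / 2 * l1 n (\<psi> r) (\<psi> p)"
    unfolding chart_deriv_def by blast+
  then show "\<forall>\<^sub>F r in nhdsin X p. r \<in> Y \<longrightarrow> \<bar>g r + h r - (g p + h p) -
      (\<Sum>i<n. (d i + e i) * (\<psi> r i - \<psi> p i))\<bar> \<le> \<eta> * l1 n (\<psi> r) (\<psi> p)"
  proof eventually_elim
    case (elim r)
    then show ?case unfolding distrib_right sum.distrib by (simp only: abs_le_iff) linarith
  qed
qed

lemma chart_deriv_compose:
  fixes u :: "real \<Rightarrow> real"
  assumes c: "corner_chart n X (V, m, \<psi>)" and p: "p \<in> V" and d: "chart_deriv X n \<psi> Y g p d"
    and u: "(u has_real_derivative u') (at (g p))"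
  shows "chart_deriv X n \<psi> Y (\<lambda>r. u (g r)) p (\<lambda>i. u' * d i)"
  unfolding chart_deriv_def
proof (intro allI impI)
  fix \<eta> :: real assume \<eta>: "\<eta> > 0"
  define M where "M = (\<Sum>i<n. \<bar>d i\<bar>)"
  have M: "M \<ge> 0" by (simp add: M_def sum_nonneg)
  \<comment> \<open>Two errors of \<open>\<eta> / 2\<close> each: \<open>\<eta>1\<close> is for the
    remainder of \<open>u\<close> over an increment of \<open>g\<close> of size at most
    \<open>(M + 1) * L\<close>, and \<open>\<eta>2\<close> for the remainder of \<open>g\<close>,
    scaled by \<open>u'\<close>. The bound \<open>\<eta>2 \<le> 1\<close> yields the size of that
    increment.\<close>
  define \<eta>1 where "\<eta>1 = \<eta> / (2 * (M + 1))"
  define \<eta>2 where "\<eta>2 = min 1 (\<eta> / (2 * (\<bar>u'\<bar> + 1)))"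
  have \<eta>1: "\<eta>1 > 0" "\<eta>1 * (M + 1) = \<eta> / 2" using \<eta> M by (simp_all add: \<eta>1_def field_simps)
  have \<eta>2: "\<eta>2 > 0" "\<eta>2 \<le> 1" using \<eta> by (simp_all add: \<eta>2_def add_nonneg_pos)
  have "\<bar>u'\<bar> * \<eta>2 \<le> (\<bar>u'\<bar> + 1) * (\<eta> / (2 * (\<bar>u'\<bar> + 1)))"
    using \<eta>2(1) by (intro mult_mono) (auto simp: \<eta>2_def)
  also have "\<dots> = \<eta> / 2" using abs_ge_zero[of u'] by (simp add: field_simps add_nonneg_eq_0_iff)
  finally have u\<eta>2: "\<bar>u'\<bar> * \<eta>2 \<le> \<eta> / 2" .
  obtain s where s: "s > 0" "\<And>y. \<bar>y - g p\<bar> < s \<Longrightarrow> \<bar>u y - u (g p) - u' * (y - g p)\<bar> \<le> \<eta>1 * \<bar>y - g p\<bar>"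
  proof -
    have "(u has_derivative (\<lambda>h. u' * h)) (at (g p))"
      using u by (simp add: has_field_derivative_def)
    then obtain s where "s > 0" "\<forall>y. norm (y - g p) < s \<longrightarrow>
        norm (u y - u (g p) - u' * (y - g p)) \<le> \<eta>1 * norm (y - g p)"
      using \<eta>1(1) unfolding has_derivative_at_alt by blast
    then show ?thesis using that by simp
  qed
  have "\<forall>\<^sub>F r in nhdsin X p. r \<in> Y \<longrightarrow>
      \<bar>g r - g p - (\<Sum>i<n. d i * (\<psi> r i - \<psi> p i))\<bar> \<le> \<eta>2 * l1 n (\<psi> r) (\<psi> p)"
    using d \<eta>2(1) unfolding chart_deriv_def by blast
  then show "\<forall>\<^sub>F r in nhdsin X p. r \<in> Y \<longrightarrow> \<bar>u (g r) - u (g p) -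
      (\<Sum>i<n. u' * d i * (\<psi> r i - \<psi> p i))\<bar> \<le> \<eta> * l1 n (\<psi> r) (\<psi> p)"
    using chart_deriv_continuous[OF c p d s(1)]
  proof eventually_elim
    case (elim r)
    show ?case
    proof
      assume r: "r \<in> Y"
      define L where "L = l1 n (\<psi> r) (\<psi> p)"
      have L: "L \<ge> 0" by (simp add: L_def)
      define D where "D = (\<Sum>i<n. d i * (\<psi> r i - \<psi> p i))"
      have "\<bar>D\<bar> \<le> (\<Sum>i<n. \<bar>d i\<bar> * L)" unfolding D_def L_def
        by (rule order_trans[OF sum_abs sum_mono]) (auto simp: abs_mult intro!: mult_left_mono abs_le_l1)
      also have "\<dots> = M * L" by (simp add: M_def sum_distrib_right)
      finally have D: "\<bar>D\<bar> \<le> M * L" .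
      have 1: "\<bar>g r - g p - D\<bar> \<le> \<eta>2 * L" using elim(1) r by (simp add: D_def L_def)
      have "\<eta>2 * L \<le> 1 * L" using \<eta>2(2) L by (rule mult_right_mono)
      then have 2: "\<bar>g r - g p\<bar> \<le> (M + 1) * L" using 1 D by (simp add: distrib_right)
      have "\<bar>u (g r) - u (g p) - u' * (g r - g p)\<bar> \<le> \<eta>1 * \<bar>g r - g p\<bar>"
        by (rule s(2)) (use elim(2) r in auto)
      also have "\<dots> \<le> \<eta>1 * ((M + 1) * L)" using 2 \<eta>1(1) by (intro mult_left_mono) auto
      also have "\<dots> = \<eta> / 2 * L" by (simp only: mult.assoc[symmetric] \<eta>1(2))
      finally have 3: "\<bar>u (g r) - u (g p) - u' * (g r - g p)\<bar> \<le> \<eta> / 2 * L" .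
      have "\<bar>u' * (g r - g p - D)\<bar> \<le> \<bar>u'\<bar> * (\<eta>2 * L)"
        unfolding abs_mult using 1 by (intro mult_left_mono) auto
      also have "\<dots> \<le> \<eta> / 2 * L" using mult_right_mono[OF u\<eta>2 L] by (simp add: mult.assoc)
      finally have 4: "\<bar>u' * (g r - g p - D)\<bar> \<le> \<eta> / 2 * L" .
      have 5: "(\<Sum>i<n. u' * d i * (\<psi> r i - \<psi> p i)) = u' * D"
        by (simp add: D_def sum_distrib_left mult.assoc)
      have "u (g r) - u (g p) - u' * D =
          (u (g r) - u (g p) - u' * (g r - g p)) + u' * (g r - g p - D)" by (simp add: algebra_simps)
      then show "\<bar>u (g r) - u (g p) - (\<Sum>i<n. u' * d i * (\<psi> r i - \<psi> p i))\<bar> \<le> \<eta> * l1 n (\<psi> r) (\<psi> p)"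
        unfolding 5 L_def[symmetric] using 3 4 by linarith
    qed
  qed
qed

lemma chart_deriv_cong:
  assumes "chart_deriv X n \<psi> Y g p d" "g p = h p" "\<forall>\<^sub>F r in nhdsin X p. r \<in> Y \<longrightarrow> g r = h r"
  shows "chart_deriv X n \<psi> Y h p d"
  unfolding chart_deriv_def
proof (intro allI impI)
  fix \<eta> :: real assume "\<eta> > 0"
  then have "\<forall>\<^sub>F r in nhdsin X p. r \<in> Y \<longrightarrow>
      \<bar>g r - g p - (\<Sum>i<n. d i * (\<psi> r i - \<psi> p i))\<bar> \<le> \<eta> * l1 n (\<psi> r) (\<psi> p)"
    using assms(1) unfolding chart_deriv_def by blast
  then show "\<forall>\<^sub>F r in nhdsin X p. r \<in> Y \<longrightarrow>
      \<bar>h r - h p - (\<Sum>i<n. d i * (\<psi> r i - \<psi> p i))\<bar> \<le> \<eta> * l1 n (\<psi> r) (\<psi> p)"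
    using assms(3) by eventually_elim (simp add: assms(2))
qed

text \<open>In a chart, a pair \<open>q, q'\<close> that is almost symmetric about \<open>p\<close> moves the \<open>y\<close>-coordinates that
  vanish at \<open>p\<close> only to higher order, since both displacements are nonnegative and their sum is
  small.  So only the tangential derivative contributes.\<close>

lemma critical_near_pair:
  assumes c: "corner_chart n X (V, m, \<psi>)" and p: "p \<in> U" "p \<in> V" and U: "openin X U"
    and emb: "embedding_map (subtopology X U) (Euclidean_space N) \<phi>"
    and J: "\<And>j. j < N \<Longrightarrow> chart_deriv X n \<psi> U (\<lambda>r. \<phi> r j) p (J j)"
    and inj: "\<And>v :: nat \<Rightarrow> real. (\<And>j. j < N \<Longrightarrow> (\<Sum>i<n. J j i * v i) = 0) \<Longrightarrow> (\<forall>i<n. v i = 0)"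
    and d: "chart_deriv X n \<psi> Y g p d" and d0: "\<And>i. i < n \<Longrightarrow> i \<notin> vanishing n m (\<psi> p) \<Longrightarrow> d i = 0"
    and K: "K > 0" and \<eta>: "\<eta> > 0"
  shows "\<exists>\<delta>>0. \<forall>r\<in>U \<inter> Y. \<forall>r'\<in>U \<inter> Y. \<forall>h. 0 < h \<and> h < \<delta> \<longrightarrow>
    near_pair N (\<phi> p) K \<delta> h (\<phi> r) (\<phi> r') \<longrightarrow> \<bar>g r - g p\<bar> \<le> \<eta> * h"
proof -
  obtain c0 where c0: "c0 > 0" "\<And>v. c0 * (\<Sum>i<n. \<bar>v i\<bar>) \<le> (\<Sum>j<N. \<bar>\<Sum>i<n. J j i * v i\<bar>)"
    using injective_matrix_lower_bound[where J = J and N = N and n = n, OF inj] by blast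
  \<comment> \<open>Replaces \<open>N\<close> in denominators, where \<open>N = 0\<close> would be
    harmful.\<close>
  define NN where "NN = real N + 1"
  have NN: "NN > 0" "real N \<le> NN" by (simp_all add: NN_def)
  define M where "M = (\<Sum>i<n. \<bar>d i\<bar>)"
  have M: "M \<ge> 0" by (simp add: M_def sum_nonneg)
  \<comment> \<open>Points whose image is within \<open>(K + 1) * h\<close> of
    \<open>\<phi> p\<close> in each coordinate will be within \<open>C * h\<close> in the chart; the
    factor 2 pays for absorbing the linearization error of the embedding.\<close>
  define C where "C = 2 * NN * (K + 1) / c0"
  have C: "C > 0" using NN K c0 by (simp add: C_def)
  define \<kappa> where "\<kappa> = \<eta> / (2 * (M + 1))"
  have \<kappa>: "\<kappa> > 0" "M * \<kappa> \<le> \<eta> / 2" using \<eta> M by (simp_all add: \<kappa>_def field_simps)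
  \<comment> \<open>The first entry allows the linearization error to be absorbed into
    \<open>c0 / 2\<close> times the chart distance. The second makes the errors of the two
    displacements together cost at most half of the bound \<open>\<kappa> * c0 * h\<close>.\<close>
  define \<eta>1 where "\<eta>1 = min (c0 / (2 * NN)) (\<kappa> * c0 / (4 * NN * C))"
  have \<eta>1: "\<eta>1 > 0" "NN * \<eta>1 \<le> c0 / 2" "NN * (2 * \<eta>1 * C) \<le> \<kappa> * c0 / 2"
  proof -
    show "\<eta>1 > 0" using c0 NN \<kappa> C by (simp add: \<eta>1_def)
    have "\<eta>1 \<le> c0 / (2 * NN)" "\<eta>1 \<le> \<kappa> * c0 / (4 * NN * C)" by (simp_all add: \<eta>1_def)
    then show "NN * \<eta>1 \<le> c0 / 2" "NN * (2 * \<eta>1 * C) \<le> \<kappa> * c0 / 2"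
      using NN C by (simp_all add: field_simps)
  qed
  define \<eta>2 where "\<eta>2 = \<eta> / (2 * C)"
  have \<eta>2: "\<eta>2 > 0" "\<eta>2 * C = \<eta> / 2" using \<eta> C by (simp_all add: \<eta>2_def)
  define close where "close r \<longleftrightarrow> r \<in> V \<and> (\<forall>j\<in>{..<N}. r \<in> U \<longrightarrow>
      \<bar>\<phi> r j - \<phi> p j - (\<Sum>i<n. J j i * (\<psi> r i - \<psi> p i))\<bar> \<le> \<eta>1 * l1 n (\<psi> r) (\<psi> p)) \<and>
    (r \<in> Y \<longrightarrow> \<bar>g r - g p - (\<Sum>i<n. d i * (\<psi> r i - \<psi> p i))\<bar> \<le> \<eta>2 * l1 n (\<psi> r) (\<psi> p))" for r
  have "\<forall>\<^sub>F r in nhdsin X p. close r" unfolding close_def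
    using J d \<eta>1(1) \<eta>2(1) unfolding chart_deriv_def
    by (intro eventually_conj eventually_ball_finite eventually_nhdsin_mem[OF corner_chartD(2)[OF c] p(2)]) auto
  then obtain \<delta>e where \<delta>e: "\<delta>e > 0" "\<And>r. r \<in> U \<Longrightarrow> l1 N (\<phi> r) (\<phi> p) < \<delta>e \<Longrightarrow> close r"
    unfolding embedding_nhdsin[OF emb U p(1)] by blast
  \<comment> \<open>The entries ensure, in turn, that the second point is within
    \<open>(K + 1) * h\<close>, that the asymmetry of the pair costs the other half of
    \<open>\<kappa> * c0 * h\<close>, and that both points are close enough for the
    linearizations.\<close>
  define \<delta> where "\<delta> = Min {1, \<kappa> * c0 / (2 * NN), \<delta>e / (NN * (K + 1))}"
  have \<delta>pos: "\<delta> > 0" using \<kappa> c0 NN \<delta>e K by (simp add: \<delta>_def)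
  have "\<delta> \<le> 1" "\<delta> \<le> \<kappa> * c0 / (2 * NN)" "\<delta> \<le> \<delta>e / (NN * (K + 1))"
    unfolding \<delta>_def by (rule Min_le; simp)+
  moreover have "\<delta> * (NN * (K + 1)) \<le> \<delta>e"
    using \<open>\<delta> \<le> \<delta>e / (NN * (K + 1))\<close> NN K pos_le_divide_eq[of "NN * (K + 1)" \<delta> \<delta>e] by simp
  ultimately have \<delta>: "\<delta> \<le> 1" "NN * \<delta> \<le> \<kappa> * c0 / 2" "NN * ((K + 1) * \<delta>) \<le> \<delta>e"
    using NN K by (simp_all add: field_simps)
  have main: "close r \<and> l1 n (\<psi> r) (\<psi> p) \<le> C * h"
    if r: "r \<in> U" and h: "0 < h" "h < \<delta>" and n: "\<And>j. j < N \<Longrightarrow> \<bar>\<phi> r j - \<phi> p j\<bar> \<le> (K + 1) * h" for r h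
  proof -
    have "l1 N (\<phi> r) (\<phi> p) \<le> (\<Sum>j<N. (K + 1) * h)" unfolding l1_def by (rule sum_mono) (use n in auto)
    also have "\<dots> \<le> NN * ((K + 1) * h)" using NN K h by (simp add: mult_right_mono)
    also have "\<dots> < NN * ((K + 1) * \<delta>)" using NN K h by simp
    also have "\<dots> \<le> \<delta>e" by (rule \<delta>(3))
    finally have cl: "close r" by (rule \<delta>e(2)[OF r])
    define L where "L = l1 n (\<psi> r) (\<psi> p)"
    have "c0 * L \<le> (\<Sum>j<N. \<bar>\<Sum>i<n. J j i * (\<psi> r i - \<psi> p i)\<bar>)"
      unfolding L_def l1_def by (rule c0(2))
    also have "\<dots> \<le> (\<Sum>j<N. (K + 1) * h + \<eta>1 * L)"
    proof (rule sum_mono)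
      fix j assume j: "j \<in> {..<N}"
      then have "\<bar>\<phi> r j - \<phi> p j - (\<Sum>i<n. J j i * (\<psi> r i - \<psi> p i))\<bar> \<le> \<eta>1 * L"
        using cl r by (simp add: close_def L_def)
      then show "\<bar>\<Sum>i<n. J j i * (\<psi> r i - \<psi> p i)\<bar> \<le> (K + 1) * h + \<eta>1 * L"
        using n[of j] j by (simp add: abs_le_iff)
    qed
    also have "\<dots> = real N * ((K + 1) * h + \<eta>1 * L)" by simp
    also have "\<dots> \<le> NN * ((K + 1) * h + \<eta>1 * L)"
      using NN K h \<eta>1(1) by (intro mult_right_mono) (auto simp: L_def)
    also have "\<dots> = NN * (K + 1) * h + (NN * \<eta>1) * L" by (simp add: algebra_simps)
    also have "\<dots> \<le> NN * (K + 1) * h + c0 / 2 * L"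
      using \<eta>1(2) by (intro add_left_mono mult_right_mono) (auto simp: L_def)
    \<comment> \<open>Half of the left-hand side has been used to absorb the error term.\<close>
    finally have "c0 * L \<le> 2 * NN * (K + 1) * h" by (simp add: algebra_simps)
    then have "L \<le> C * h" using c0(1) by (simp add: C_def field_simps)
    then show ?thesis using cl by (simp add: L_def)
  qed
  have "\<bar>g r - g p\<bar> \<le> \<eta> * h"
    if r: "r \<in> U \<inter> Y" "r' \<in> U \<inter> Y" and h: "0 < h" "h < \<delta>"
      and np: "near_pair N (\<phi> p) K \<delta> h (\<phi> r) (\<phi> r')" for r r' h
  proof -
    have np1: "\<bar>\<phi> r j - \<phi> p j\<bar> \<le> K * h" and np2: "\<bar>\<phi> r j + \<phi> r' j - 2 * \<phi> p j\<bar> \<le> \<delta> * h" if "j < N" for j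
      using np that by (auto simp: near_pair_def)
    have dh: "\<delta> * h \<le> 1 * h" using \<delta>(1) h by (intro mult_right_mono) auto
    have 1: "close r \<and> l1 n (\<psi> r) (\<psi> p) \<le> C * h"
      by (rule main) (use r h np1 in \<open>fastforce simp: distrib_right\<close>)+
    \<comment> \<open>Only the first point of a pair is bounded directly; the near symmetry bounds
      the second one, at the expense of \<open>\<delta> * h \<le> h\<close>.\<close>
    have "\<bar>\<phi> r' j - \<phi> p j\<bar> \<le> (K + 1) * h" if "j < N" for j
      using np1[OF that] np2[OF that] dh by (simp add: distrib_right abs_le_iff)
    then have 2: "close r' \<and> l1 n (\<psi> r') (\<psi> p) \<le> C * h"
      using main[of r' h] r h by blast
    define w w' where "w i = \<psi> r i - \<psi> p i" and "w' i = \<psi> r' i - \<psi> p i" for i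
    have "c0 * (\<Sum>i<n. \<bar>w i + w' i\<bar>) \<le> (\<Sum>j<N. \<bar>\<Sum>i<n. J j i * (w i + w' i)\<bar>)"
      by (rule c0(2))
    also have "\<dots> \<le> (\<Sum>j<N. \<delta> * h + 2 * \<eta>1 * C * h)"
    proof (rule sum_mono)
      fix j assume j: "j \<in> {..<N}"
      have "\<bar>\<phi> r j - \<phi> p j - (\<Sum>i<n. J j i * w i)\<bar> \<le> \<eta>1 * l1 n (\<psi> r) (\<psi> p)"
        "\<bar>\<phi> r' j - \<phi> p j - (\<Sum>i<n. J j i * w' i)\<bar> \<le> \<eta>1 * l1 n (\<psi> r') (\<psi> p)"
        using 1 2 r j by (auto simp: close_def w_def w'_def)
      moreover have "\<eta>1 * l1 n (\<psi> r) (\<psi> p) \<le> \<eta>1 * (C * h)" "\<eta>1 * l1 n (\<psi> r') (\<psi> p) \<le> \<eta>1 * (C * h)"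
        using 1 2 \<eta>1(1) by (auto intro: mult_left_mono)
      moreover have "(\<Sum>i<n. J j i * (w i + w' i)) = (\<Sum>i<n. J j i * w i) + (\<Sum>i<n. J j i * w' i)"
        by (simp add: distrib_left sum.distrib)
      moreover have "2 * \<eta>1 * C * h = \<eta>1 * (C * h) + \<eta>1 * (C * h)" by simp
      ultimately show "\<bar>\<Sum>i<n. J j i * (w i + w' i)\<bar> \<le> \<delta> * h + 2 * \<eta>1 * C * h"
        using np2[of j] j by (simp add: abs_le_iff)
    qed
    also have "\<dots> = real N * ((\<delta> + 2 * \<eta>1 * C) * h)" by (simp add: distrib_right)
    also have "\<dots> \<le> NN * ((\<delta> + 2 * \<eta>1 * C) * h)"
      using NN \<delta>pos \<eta>1(1) C h by (intro mult_right_mono) auto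
    also have "\<dots> = (NN * \<delta> + NN * (2 * \<eta>1 * C)) * h" by (simp add: algebra_simps)
    also have "\<dots> \<le> (\<kappa> * c0) * h" using \<delta>(2) \<eta>1(3) h by (intro mult_right_mono) auto
    finally have "(\<Sum>i<n. \<bar>w i + w' i\<bar>) \<le> \<kappa> * h" using c0(1) by (simp add: field_simps)
    then have ww: "\<bar>w i + w' i\<bar> \<le> \<kappa> * h" if "i < n" for i
      using member_le_sum[of i "{..<n}" "\<lambda>i. \<bar>w i + w' i\<bar>"] that by simp
    have dw: "\<bar>d i * w i\<bar> \<le> \<bar>d i\<bar> * (\<kappa> * h)" if i: "i < n" for i
    proof (cases "i \<in> vanishing n m (\<psi> p)")
      case True
      have "r \<in> V" "r' \<in> V" using 1 2 by (auto simp: close_def)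
      then have "\<psi> r \<in> corner_space n m" "\<psi> r' \<in> corner_space n m" using corner_chartD(6)[OF c] by auto
      then have "0 \<le> w i" "0 \<le> w' i" using True by (auto simp: corner_space_def vanishing_def w_def w'_def)
      then have "\<bar>w i\<bar> \<le> \<kappa> * h" using ww[OF i] by simp
      then show ?thesis by (simp add: abs_mult mult_left_mono)
    qed (use d0[OF i] in simp)
    have "\<bar>g r - g p - (\<Sum>i<n. d i * w i)\<bar> \<le> \<eta>2 * l1 n (\<psi> r) (\<psi> p)"
      using 1 r by (simp add: close_def w_def)
    then have "\<bar>g r - g p\<bar> \<le> \<bar>\<Sum>i<n. d i * w i\<bar> + \<eta>2 * l1 n (\<psi> r) (\<psi> p)" by linarith
    also have "\<bar>\<Sum>i<n. d i * w i\<bar> \<le> (\<Sum>i<n. \<bar>d i\<bar> * (\<kappa> * h))"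
      by (rule order_trans[OF sum_abs sum_mono]) (use dw in auto)
    also have "\<dots> = (M * \<kappa>) * h" by (simp add: M_def sum_distrib_right mult.assoc)
    also have "\<dots> \<le> \<eta> / 2 * h" using \<kappa>(2) h by (intro mult_right_mono) auto
    also have "\<eta>2 * l1 n (\<psi> r) (\<psi> p) \<le> \<eta>2 * (C * h)" using 1 \<eta>2(1) by (intro mult_left_mono) auto
    also have "\<dots> = \<eta> / 2 * h" by (simp only: mult.assoc[symmetric] \<eta>2(2))
    finally show ?thesis by simp
  qed
  then show ?thesis using \<delta>pos by blast
qed

section \<open>Compactifications\<close>

lemma mfd_chart: "manifold_with_corners n X A \<Longrightarrow> (V, m, \<psi>) \<in> A \<Longrightarrow> corner_chart n X (V, m, \<psi>)"
  by (auto simp: manifold_with_corners_def)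

lemma mfd_chart_exists:
  assumes "manifold_with_corners n X A" "p \<in> topspace X"
  obtains V m \<psi> where "(V, m, \<psi>) \<in> A" "p \<in> V"
proof -
  have "p \<in> (\<Union>(U, m, \<phi>)\<in>A. U)" using assms by (simp add: manifold_with_corners_def)
  then show ?thesis using that by auto
qed

lemma stratum_iff:
  assumes M: "manifold_with_corners n X A" and c: "(V, m, \<psi>) \<in> A" and p: "p \<in> V"
  shows "p \<in> stratum n A k \<longleftrightarrow> card (vanishing n m (\<psi> p)) = k"
proof
  assume "p \<in> stratum n A k"
  then obtain U l \<phi> where U: "(U, l, \<phi>) \<in> A" "p \<in> U" "card (vanishing n l (\<phi> p)) = k"
    unfolding stratum_def by blast
  have "smooth_transition n (U, l, \<phi>) (V, m, \<psi>)" "smooth_transition n (V, m, \<psi>) (U, l, \<phi>)"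
    using M U(1) c unfolding manifold_with_corners_def by blast+
  from depth_unique[OF mfd_chart[OF M U(1)] mfd_chart[OF M c] this U(2) p] U(3)
  show "card (vanishing n m (\<psi> p)) = k" by simp
qed (use c p in \<open>auto simp: stratum_def\<close>)

text \<open>Boundary functions are described in charts that are merely compatible with the atlas, so
  the depth must be readable in those as well.\<close>

lemma smooth_chart_stratum:
  assumes M: "manifold_with_corners n X A" and c: "(V, m, \<psi>) \<in> smooth_charts n X A"
    and p: "p \<in> V" "p \<in> stratum n A k"
  shows "card (vanishing n m (\<psi> p)) = k"
proof -
  obtain U l \<phi> where U: "(U, l, \<phi>) \<in> A" "p \<in> U" "card (vanishing n l (\<phi> p)) = k"
    using p(2) unfolding stratum_def by blast
  have "corner_chart n X (V, m, \<psi>)" "smooth_transition n (U, l, \<phi>) (V, m, \<psi>)"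
    "smooth_transition n (V, m, \<psi>) (U, l, \<phi>)"
    using c U(1) unfolding smooth_charts_def by blast+
  from depth_unique[OF mfd_chart[OF M U(1)] this U(2) p(1)] U(3)
  show ?thesis by simp
qed

lemma stratum_subset_topspace: "manifold_with_corners n X A \<Longrightarrow> stratum n A k \<subseteq> topspace X"
  by (auto simp: stratum_def manifold_with_corners_def)

lemma finite_vanishing: "finite (vanishing n m z)"
  by (simp add: vanishing_def)

lemma eventually_nonvanishing:
  assumes c: "corner_chart n X (V, m, \<psi>)" and p: "p \<in> V" and k: "k < n" "\<psi> p k \<noteq> 0"
  shows "\<forall>\<^sub>F r in nhdsin X p. \<psi> r k \<noteq> 0"
  unfolding chart_nhdsin[OF c p]
proof (intro exI[of _ "\<bar>\<psi> p k\<bar>"] conjI ballI impI)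
  fix r assume "l1 n (\<psi> r) (\<psi> p) < \<bar>\<psi> p k\<bar>"
  then show "\<psi> r k \<noteq> 0" using abs_le_l1[OF k(1), of "\<psi> r" "\<psi> p"] by auto
qed (use k in auto)

text \<open>Changing a coordinate that is free at \<open>p\<close>, or changing a positive one
  slightly, preserves the set of vanishing coordinates. Hence the stratum contains the coordinate
  lines along which criticality is defined.\<close>

lemma eventually_stratum_line:
  assumes M: "manifold_with_corners n X A" and c: "(V, m, \<psi>) \<in> A" and p: "p \<in> V" "p \<in> stratum n A k"
    and i: "i < n" "i \<notin> vanishing n m (\<psi> p)"
  shows "\<forall>\<^sub>F r in nhdsin X p. r \<in> V \<and> (\<forall>j. j \<noteq> i \<longrightarrow> \<psi> r j = \<psi> p j) \<longrightarrow> r \<in> V \<inter> stratum n A k"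
proof -
  have ev: "\<forall>\<^sub>F r in nhdsin X p. i \<in> {n - m..<n} \<longrightarrow> \<psi> r i \<noteq> 0"
  proof (cases "i \<in> {n - m..<n}")
    case True
    then have "\<psi> p i \<noteq> 0" using i by (auto simp: vanishing_def)
    from eventually_nonvanishing[OF mfd_chart[OF M c] p(1) i(1) this] show ?thesis
      by eventually_elim simp
  next
    case False
    show ?thesis by (rule always_eventually) (use False in blast)
  qed
  have "r \<in> stratum n A k" if "i \<in> {n - m..<n} \<longrightarrow> \<psi> r i \<noteq> 0" "r \<in> V" "\<And>j. j \<noteq> i \<Longrightarrow> \<psi> r j = \<psi> p j" for r
  proof -
    have "j \<in> vanishing n m (\<psi> r) \<longleftrightarrow> j \<in> vanishing n m (\<psi> p)" for j
    proof (cases "j = i")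
      case True
      then show ?thesis using that(1) i(2) by (auto simp: vanishing_def)
    next
      case False
      then show ?thesis using that(3)[of j] by (simp add: vanishing_def)
    qed
    then have "vanishing n m (\<psi> r) = vanishing n m (\<psi> p)" by blast
    then show ?thesis using stratum_iff[OF M c] that(2) p by simp
  qed
  then show ?thesis by (intro eventually_mono[OF ev]) blast
qed

lemma eventually_interior:
  assumes M: "manifold_with_corners n X A" and p: "p \<in> mfd_interior n A"
  shows "\<forall>\<^sub>F r in nhdsin X p. r \<in> mfd_interior n A"
proof -
  obtain V m \<psi> where c: "(V, m, \<psi>) \<in> A" "p \<in> V" "card (vanishing n m (\<psi> p)) = 0"
    using p unfolding stratum_def by blast
  then have nv: "vanishing n m (\<psi> p) = {}" using finite_vanishing by simp
  have "\<forall>\<^sub>F r in nhdsin X p. \<forall>i\<in>{n - m..<n}. \<psi> r i \<noteq> 0"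
    by (intro eventually_ball_finite ballI eventually_nonvanishing[OF mfd_chart[OF M c(1)] c(2)])
      (use nv in \<open>auto simp: vanishing_def\<close>)
  then show ?thesis using eventually_nhdsin_mem[OF corner_chartD(2)[OF mfd_chart[OF M c(1)]] c(2)]
  proof eventually_elim
    case (elim r)
    then have "vanishing n m (\<psi> r) = {}" by (auto simp: vanishing_def)
    then show ?case using stratum_iff[OF M c(1) elim(2)] by simp
  qed
qed

lemma C_diff_mfd_chart_deriv:
  assumes M: "manifold_with_corners n X A" and g: "C_diff_mfd k n A Y g" "1 \<le> k"
    and c: "(V, m, \<psi>) \<in> A" and p: "p \<in> V" "p \<in> Y"
  shows "\<exists>d. chart_deriv X n \<psi> Y g p d"
  by (rule C_diff_on_chart_deriv[OF mfd_chart[OF M c] p g(2)])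
    (use g(1) c in \<open>auto simp: C_diff_mfd_def\<close>)

lemma critical_point_chart:
  assumes M: "manifold_with_corners n X A" and p: "p \<in> critical_points n A k g" and Y: "stratum n A k \<subseteq> Y"
    and g: "\<And>V m \<psi>. (V, m, \<psi>) \<in> A \<Longrightarrow> p \<in> V \<Longrightarrow> \<exists>d. chart_deriv X n \<psi> Y g p d"
  obtains V m \<psi> d where "(V, m, \<psi>) \<in> A" "p \<in> V" "chart_deriv X n \<psi> Y g p d"
    "\<And>i. i < n \<Longrightarrow> i \<notin> vanishing n m (\<psi> p) \<Longrightarrow> d i = 0"
proof -
  obtain V m \<psi> where c: "(V, m, \<psi>) \<in> A" "p \<in> V" and ps: "p \<in> stratum n A k"
    and cr: "\<And>i. i < n \<Longrightarrow> i \<notin> vanishing n m (\<psi> p) \<Longrightarrow>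
      has_partial_derivative (\<lambda>x. g (inv_into V \<psi> x)) i 0 (\<psi> p) (\<psi> ` (V \<inter> stratum n A k))"
    using p unfolding critical_points_def by auto
  obtain d where d: "chart_deriv X n \<psi> Y g p d" using g[OF c] by blast
  have "d i = 0" if i: "i < n" "i \<notin> vanishing n m (\<psi> p)" for i
  proof (rule chart_deriv_partial[OF mfd_chart[OF M c(1)] c(2) d i(1) cr[OF i]])
    show "\<forall>\<^sub>F r in nhdsin X p. r \<in> V \<and> (\<forall>j. j \<noteq> i \<longrightarrow> \<psi> r j = \<psi> p j) \<longrightarrow> r \<in> Y \<inter> (V \<inter> stratum n A k)"
      using eventually_stratum_line[OF M c ps i] by eventually_elim (use Y in auto)
  qed auto
  then show ?thesis using that c d by blast
qed

text \<open>This connects the definition of a stratified critical point, which mentions charts, with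
  the condition on pairs in the image of the embedding, which does not.\<close>

lemma critical_point_near_pair:
  assumes M: "manifold_with_corners n X A" and U: "openin X U" and emb: "C1_embedding n X A U N \<phi>"
    and p: "p \<in> U" "p \<in> critical_points n A k g" and Y: "stratum n A k \<subseteq> Y"
    and g: "\<And>V m \<psi>. (V, m, \<psi>) \<in> A \<Longrightarrow> p \<in> V \<Longrightarrow> \<exists>d. chart_deriv X n \<psi> Y g p d"
    and K: "K > 0" and \<eta>: "\<eta> > 0"
  shows "\<exists>\<delta>>0. \<forall>r\<in>U \<inter> Y. \<forall>r'\<in>U \<inter> Y. \<forall>h. 0 < h \<and> h < \<delta> \<longrightarrow>
    near_pair N (\<phi> p) K \<delta> h (\<phi> r) (\<phi> r') \<longrightarrow> \<bar>g r - g p\<bar> \<le> \<eta> * h"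
proof -
  obtain V m \<psi> d where c: "(V, m, \<psi>) \<in> A" "p \<in> V" and d: "chart_deriv X n \<psi> Y g p d"
    "\<And>i. i < n \<Longrightarrow> i \<notin> vanishing n m (\<psi> p) \<Longrightarrow> d i = 0"
    by (rule critical_point_chart[OF M p(2) Y g]; (assumption | rule that))
  note ch = mfd_chart[OF M c(1)]
  have e: "embedding_map (subtopology X U) (Euclidean_space N) \<phi>"
    "\<And>j. j < N \<Longrightarrow> C_diff_mfd 1 n A U (\<lambda>p. \<phi> p j)" using emb unfolding C1_embedding_def by auto
  obtain J :: "nat \<Rightarrow> nat \<Rightarrow> real" where J: "\<And>j i. j < N \<Longrightarrow> i < n \<Longrightarrow>
      has_partial_derivative (\<lambda>x. \<phi> (inv_into V \<psi> x) j) i (J j i) (\<psi> p) (\<psi> ` (U \<inter> V))"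
    and inj: "\<And>v :: nat \<Rightarrow> real. (\<And>j. j < N \<Longrightarrow> (\<Sum>i<n. J j i * v i) = 0) \<Longrightarrow> (\<forall>i<n. v i = 0)"
  proof -
    have "\<exists>J :: nat \<Rightarrow> nat \<Rightarrow> real.
        (\<forall>j<N. \<forall>i<n. has_partial_derivative (\<lambda>x. \<phi> (inv_into V \<psi> x) j) i (J j i) (\<psi> p) (\<psi> ` (U \<inter> V))) \<and>
        (\<forall>v :: nat \<Rightarrow> real. (\<forall>j<N. (\<Sum>i<n. J j i * v i) = 0) \<longrightarrow> (\<forall>i<n. v i = 0))"
      using emb c p(1) unfolding C1_embedding_def by blast
    then show ?thesis using that by blast
  qed
  \<comment> \<open>The injectivity assumption concerns a matrix \<open>J\<close> of partial
    derivatives; they agree with the entries of the total derivative supplied by the C^1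
    property.\<close>
  have "chart_deriv X n \<psi> U (\<lambda>r. \<phi> r j) p (J j)" if j: "j < N" for j
  proof -
    obtain b where b: "chart_deriv X n \<psi> U (\<lambda>r. \<phi> r j) p b"
      using C_diff_mfd_chart_deriv[OF M e(2)[OF j] _ c p(1)] by auto
    have "b i = J j i" if i: "i < n" for i
    proof (rule chart_deriv_partial[OF ch c(2) b i J[OF j i]])
      show "\<forall>\<^sub>F r in nhdsin X p. r \<in> V \<and> (\<forall>j. j \<noteq> i \<longrightarrow> \<psi> r j = \<psi> p j) \<longrightarrow> r \<in> U \<inter> (U \<inter> V)"
        using eventually_nhdsin_mem[OF U p(1)] by eventually_elim simp
    qed auto
    then show ?thesis using b unfolding chart_deriv_def by simp
  qed
  from critical_near_pair[OF ch p(1) c(2) U e(1) this inj d K \<eta>] show ?thesis by blast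
qed

section \<open>Semialgebraic sets in coordinates\<close>

lemma polynomial_functions_polyfun:
  "F \<in> polynomial_functions N \<Longrightarrow> F \<in> polyfun (coords N)"
  by (induction rule: polynomial_functions.induct) (auto simp: coords_def intro: polyfun.intros)

lemma semialgebraic_semialg_set:
  assumes "semialgebraic N S" shows "semialg_set N S"
proof -
  obtain F where F: "finite F" "\<And>B. B \<in> F \<Longrightarrow> basic_semialgebraic N B" "S = \<Union>F"
    using assms unfolding semialgebraic_def by blast
  have "\<exists>P. semialg (coords N) P \<and> B = {x \<in> real_tuples N. P x}" if "B \<in> F" for B
  proof -
    obtain P Q where PQ: "finite P" "finite Q" "P \<subseteq> polynomial_functions N" "Q \<subseteq> polynomial_functions N"
      "B = {x \<in> real_tuples N. (\<forall>p\<in>P. p x = 0) \<and> (\<forall>q\<in>Q. 0 < q x)}"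
      using F(2)[OF \<open>B \<in> F\<close>] unfolding basic_semialgebraic_def by blast
    have "semialg (coords N) (\<lambda>x. (\<forall>p\<in>P. p x = 0) \<and> (\<forall>q\<in>Q. 0 < q x))"
      using PQ(1-4) by (intro semialg_conj semialg_ball_finite semialg_eq semialg_pos polyfun_const)
        (auto intro: polynomial_functions_polyfun)
    then show ?thesis using PQ(5) by blast
  qed
  then obtain P where P: "\<And>B. B \<in> F \<Longrightarrow> semialg (coords N) (P B)" "\<And>B. B \<in> F \<Longrightarrow> B = {x \<in> real_tuples N. P B x}"
    by metis
  have "semialg (coords N) (\<lambda>x. \<exists>B\<in>F. P B x)" by (rule semialg_bex_finite[OF F(1) P(1)])
  moreover have "S = {x \<in> real_tuples N. \<exists>B\<in>F. P B x}" unfolding F(3) using P(2) by blast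
  ultimately show ?thesis unfolding semialg_set_def by blast
qed

lemma real_tuples_Suc: "x \<in> real_tuples N \<longleftrightarrow> x \<in> real_tuples (Suc N) \<and> x N = 0"
proof -
  have "(\<forall>i\<ge>N. x i = 0) \<longleftrightarrow> (\<forall>i\<ge>Suc N. x i = 0) \<and> x N = 0"
    by (metis Suc_leD Suc_leI le_neq_implies_less order_refl)
  then show ?thesis by (simp add: topspace_Euclidean_space)
qed

lemma semialg_set_Suc:
  assumes "semialg_set N S" shows "semialg_set (Suc N) S"
proof -
  obtain P where P: "semialg (coords N) P" "S = {x \<in> real_tuples N. P x}"
    using assms by (auto simp: semialg_set_def)
  have "semialg (coords (Suc N)) (\<lambda>x. P x \<and> x N = 0)"
    by (intro semialg_conj semialg_comp[OF P(1)] semialg_eq polyfun_const)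
      (auto simp: coords_def intro!: polyfun_var)
  moreover have "S = {x \<in> real_tuples (Suc N). P x \<and> x N = 0}"
    unfolding P(2) real_tuples_Suc[of _ N] by blast
  ultimately show ?thesis unfolding semialg_set_def by blast
qed

text \<open>The graph of \<open>(f, 1 / \<tau>)\<close> over the points that are limits of points with \<open>f \<noteq> 0\<close>.  It is
  recovered from the graphs of \<open>f\<close> and \<open>fbar\<close>, because \<open>f / fbar = 1 / \<tau>\<close> wherever \<open>f \<noteq> 0\<close>.\<close>

definition quotient_closure :: "nat \<Rightarrow> (nat \<Rightarrow> real) set \<Rightarrow> (nat \<Rightarrow> real) set \<Rightarrow> (nat \<Rightarrow> real) set" where
  "quotient_closure N F B = {w \<in> real_tuples (Suc (Suc N)). w(Suc N := 0) \<in> F \<and>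
     (\<forall>\<delta>. 0 < \<delta> \<longrightarrow> (\<exists>q\<in>F. \<exists>b\<in>B. q N \<noteq> 0 \<and>
        (\<forall>i\<in>{..<N}. q i = b i \<and> \<bar>q i - w i\<bar> < \<delta>) \<and> \<bar>w (Suc N) * b N - q N\<bar> < \<delta> * \<bar>b N\<bar>))}"

lemma semialg_abs_less_abs:
  assumes "F \<in> polyfun V" "G \<in> polyfun V" "H \<in> polyfun V"
  shows "semialg V (\<lambda>s. \<bar>F s\<bar> < G s * \<bar>H s\<bar>)"
proof -
  have "semialg V (\<lambda>s. \<bar>F s\<bar> < G s * H s \<and> 0 \<le> H s \<or> \<bar>F s\<bar> < G s * - H s \<and> H s < 0)"
    by (intro semialg_disj semialg_conj semialg_abs_less semialg_less semialg_le polyfun_mult polyfun_uminus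
        polyfun_const assms)
  moreover have "(\<lambda>s. \<bar>F s\<bar> < G s * H s \<and> 0 \<le> H s \<or> \<bar>F s\<bar> < G s * - H s \<and> H s < 0) = (\<lambda>s. \<bar>F s\<bar> < G s * \<bar>H s\<bar>)"
    by (intro ext) (auto simp: abs_if)
  ultimately show ?thesis by simp
qed

lemma semialg_set_quotient_closure:
  assumes F: "semialg_set (Suc N) F" and B: "semialg_set (Suc N) B"
  shows "semialg_set (Suc (Suc N)) (quotient_closure N F B)"
proof -
  obtain P where P: "semialg (coords (Suc N)) P" "F = {x \<in> real_tuples (Suc N). P x}"
    using F by (auto simp: semialg_set_def)
  let ?C = "coords (Suc (Suc N))"
  let ?V = "ext_tuple (Suc N) (ext_tuple (Suc N) (ext_real ?C))"
  have w0: "(\<lambda>w. w i) \<in> polyfun ?C" if "i < Suc (Suc N)" for i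
    by (rule polyfun_var) (use that in \<open>simp add: coords_def\<close>)
  have w: "(\<lambda>z. fst (fst (fst z)) i) \<in> polyfun ?V" if "i < Suc (Suc N)" for i
    using polyfun_tuple_fst[OF polyfun_tuple_fst[OF polyfun_ext_fst[OF w0[OF that]]]] .
  have \<delta>: "(\<lambda>z. snd (fst (fst z))) \<in> polyfun ?V"
    by (intro polyfun_tuple_fst polyfun_ext_snd)
  have q: "(\<lambda>z. snd (fst z) i) \<in> polyfun ?V" if "i < Suc N" for i
    by (intro polyfun_tuple_fst polyfun_tuple_snd that)
  have b: "(\<lambda>z. snd z i) \<in> polyfun ?V" if "i < Suc N" for i
    by (intro polyfun_tuple_snd that)
  have 1: "semialg ?V (\<lambda>z. snd (fst z) N \<noteq> 0)"
    by (intro semialg_not semialg_eq q polyfun_const) simp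
  have 2: "semialg ?V (\<lambda>z. \<forall>i\<in>{..<N}. snd (fst z) i = snd z i \<and>
      \<bar>snd (fst z) i - fst (fst (fst z)) i\<bar> < snd (fst (fst z)))"
    by (rule semialg_ball_finite[OF finite_lessThan], rule semialg_conj, rule semialg_eq[OF q b], simp, simp,
        rule semialg_abs_less[OF polyfun_diff[OF q w] \<delta>]) simp_all
  have 3: "semialg ?V (\<lambda>z. \<bar>fst (fst (fst z)) (Suc N) * snd z N - snd (fst z) N\<bar> < snd (fst (fst z)) * \<bar>snd z N\<bar>)"
    by (rule semialg_abs_less_abs[OF polyfun_diff[OF polyfun_mult[OF w b] q] \<delta> b]) simp_all
  have "semialg ?C (\<lambda>w. \<forall>\<delta>. 0 < \<delta> \<longrightarrow> (\<exists>q\<in>F. \<exists>b\<in>B. q N \<noteq> 0 \<and>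
        (\<forall>i\<in>{..<N}. q i = b i \<and> \<bar>q i - w i\<bar> < \<delta>) \<and> \<bar>w (Suc N) * b N - q N\<bar> < \<delta> * \<bar>b N\<bar>))"
    by (rule semialg_all, rule semialg_imp, rule semialg_less[OF polyfun_const polyfun_ext_snd],
        rule semialg_bex[OF F], rule semialg_bex[OF B], rule semialg_conj, rule 1, rule semialg_conj, rule 2, rule 3)
  moreover have "semialg ?C (\<lambda>w. P (w(Suc N := 0)))"
    by (rule semialg_comp[OF P(1)]) (auto simp: coords_def intro!: polyfun_var)
  ultimately have "semialg ?C (\<lambda>w. P (w(Suc N := 0)) \<and> (\<forall>\<delta>. 0 < \<delta> \<longrightarrow> (\<exists>q\<in>F. \<exists>b\<in>B. q N \<noteq> 0 \<and>
        (\<forall>i\<in>{..<N}. q i = b i \<and> \<bar>q i - w i\<bar> < \<delta>) \<and> \<bar>w (Suc N) * b N - q N\<bar> < \<delta> * \<bar>b N\<bar>)))"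
    by (intro semialg_conj)
  moreover have "quotient_closure N F B = {w \<in> real_tuples (Suc (Suc N)). P (w(Suc N := 0)) \<and>
      (\<forall>\<delta>. 0 < \<delta> \<longrightarrow> (\<exists>q\<in>F. \<exists>b\<in>B. q N \<noteq> 0 \<and>
        (\<forall>i\<in>{..<N}. q i = b i \<and> \<bar>q i - w i\<bar> < \<delta>) \<and> \<bar>w (Suc N) * b N - q N\<bar> < \<delta> * \<bar>b N\<bar>))}"
  proof -
    have "w(Suc N := 0) \<in> F \<longleftrightarrow> P (w(Suc N := 0))" if "w \<in> real_tuples (Suc (Suc N))" for w
      using that unfolding P(2) real_tuples_Suc[of _ "Suc N"] by (simp add: topspace_Euclidean_space)
    then show ?thesis unfolding quotient_closure_def by blast
  qed
  ultimately show ?thesis unfolding semialg_set_def by blast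
qed

lemma chart_deriv_subset:
  assumes "chart_deriv X n \<psi> Y g p d" "Y' \<subseteq> Y" shows "chart_deriv X n \<psi> Y' g p d"
  unfolding chart_deriv_def
proof (intro allI impI)
  fix \<eta> :: real assume "\<eta> > 0"
  then have "\<forall>\<^sub>F r in nhdsin X p. r \<in> Y \<longrightarrow>
      \<bar>g r - g p - (\<Sum>i<n. d i * (\<psi> r i - \<psi> p i))\<bar> \<le> \<eta> * l1 n (\<psi> r) (\<psi> p)"
    using assms(1) unfolding chart_deriv_def by blast
  then show "\<forall>\<^sub>F r in nhdsin X p. r \<in> Y' \<longrightarrow>
      \<bar>g r - g p - (\<Sum>i<n. d i * (\<psi> r i - \<psi> p i))\<bar> \<le> \<eta> * l1 n (\<psi> r) (\<psi> p)"
    by (rule eventually_mono) (use assms(2) in blast)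
qed

lemma embedding_inj_on:
  assumes "embedding_map (subtopology X U) Y \<phi>" "U \<subseteq> topspace X"
  shows "inj_on \<phi> U"
proof -
  have "topspace (subtopology X U) = U" using assms(2) by auto
  then show ?thesis
    using assms(1) homeomorphic_imp_injective_map unfolding embedding_map_def by metis
qed

text \<open>The condition on pairs makes no reference to the depth, so the critical points of all
  strata are treated at once on the graph of \<open>g\<close>, as the member
  \<open>\<epsilon> = 0\<close> of a pencil.\<close>

lemma finite_stratified_critical_values:
  assumes M: "manifold_with_corners n X A" and U: "openin X U" and emb: "C1_embedding n X A U N \<phi>"
    and sa: "semialgebraic_function N (\<phi> ` U) (\<lambda>x. g (inv_into U \<phi> x))"
    and g: "C_diff_mfd \<infinity> n A (topspace X) g"
  shows "finite (g ` (U \<inter> (\<Union>k. critical_points n A k g)))"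
proof -
  have e: "embedding_map (subtopology X U) (Euclidean_space N) \<phi>" using emb by (simp add: C1_embedding_def)
  have UX: "U \<subseteq> topspace X" by (rule openin_subset[OF U])
  have inj: "inj_on \<phi> U"
    by (rule embedding_inj_on[OF e UX])
  define W where "W = graph_on N (\<phi> ` U) (\<lambda>x. g (inv_into U \<phi> x))"
  \<comment> \<open>The graph has one value coordinate; the second one expected by a pencil is
    filled with 0.\<close>
  have W: "semialg_set (Suc (Suc N)) W"
    unfolding W_def
    by (intro semialg_set_Suc semialgebraic_semialg_set sa[unfolded semialgebraic_function_def])
  have Wi: "W = (\<lambda>r. (\<phi> r)(N := g r)) ` U"
    unfolding W_def graph_on_def image_image by (rule image_cong) (use inj in auto)
  have tup: "x \<in> real_tuples (Suc N)" if "x \<in> W" for x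
    using that semialgebraic_semialg_set[OF sa[unfolded semialgebraic_function_def]]
    unfolding W_def semialg_set_def by blast
  have pen: "pencil N 0 ((\<phi> r)(N := g r)) = g r" for r by (simp add: pencil_def)
  have "g p \<in> pencil_critical_values N W 0" if p: "p \<in> U" "p \<in> critical_points n A k g" for p k
  proof -
    have gd: "\<exists>d. chart_deriv X n \<psi> (topspace X) g p d" if "(V, m, \<psi>) \<in> A" "p \<in> V" for V m \<psi>
      by (rule C_diff_mfd_chart_deriv[OF M g _ that]) (use p(1) UX in auto)
    have "pencil_critical N W 0 ((\<phi> p)(N := g p))"
      unfolding pencil_critical_def
    proof (intro allI impI)
      fix K \<eta> :: real assume K: "0 < K \<and> 0 < \<eta>"
      have "\<exists>\<delta>>0. \<forall>r\<in>U \<inter> topspace X. \<forall>r'\<in>U \<inter> topspace X. \<forall>h. 0 < h \<and> h < \<delta> \<longrightarrow>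
          near_pair N (\<phi> p) K \<delta> h (\<phi> r) (\<phi> r') \<longrightarrow> \<bar>g r - g p\<bar> \<le> \<eta> * h"
        by (rule critical_point_near_pair[OF M U emb p stratum_subset_topspace[OF M]])
          (use gd K in auto)
      then obtain \<delta> where \<delta>: "\<delta> > 0" "\<And>r r' h. r \<in> U \<Longrightarrow> r' \<in> U \<Longrightarrow> 0 < h \<and> h < \<delta> \<Longrightarrow>
          near_pair N (\<phi> p) K \<delta> h (\<phi> r) (\<phi> r') \<Longrightarrow> \<bar>g r - g p\<bar> \<le> \<eta> * h" using UX by blast
      show "\<exists>\<delta>>0. \<forall>q\<in>W. \<forall>q'\<in>W. \<forall>h. 0 < h \<and> h < \<delta> \<longrightarrow>
          near_pair N ((\<phi> p)(N := g p)) K \<delta> h q q' \<longrightarrow>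
          \<bar>pencil N 0 q - pencil N 0 ((\<phi> p)(N := g p))\<bar> \<le> \<eta> * h"
        unfolding Wi using \<delta> by (intro exI[of _ \<delta>]) (auto simp: pen near_pair_def)
    qed
    then show ?thesis unfolding pencil_critical_values_def using p(1) pen by (force simp: Wi)
  qed
  then have "g ` (U \<inter> (\<Union>k. critical_points n A k g)) \<subseteq> pencil_critical_values N W 0" by blast
  then show ?thesis using finite_pencil_critical_values[OF W] finite_subset by blast
qed

section \<open>Flat points of the boundary function and cluster points\<close>

text \<open>Near \<open>p\<close> the function is a monomial in the \<open>y\<close>-coordinates
  with positive exponents, and at interior points all of these are nonzero. So its derivative in one
  of them does not vanish there.\<close>

lemma boundary_function_not_flat:
  assumes M: "manifold_with_corners n X A" and bf: "boundary_function n X A \<tau>"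
    and p: "p \<in> mfd_boundary n A"
  shows "\<exists>S. openin X S \<and> p \<in> S \<and> (\<forall>q\<in>S \<inter> mfd_interior n A. \<forall>(V, m, \<psi>)\<in>A. q \<in> V \<longrightarrow>
    \<not> chart_deriv X n \<psi> (mfd_interior n A) \<tau> q (\<lambda>_. 0))"
proof -
  have "\<exists>(U, l, \<phi>)\<in>smooth_charts n X A. p \<in> U \<and> \<phi> p = (\<lambda>_. 0) \<and>
      (\<exists>\<alpha>::nat \<Rightarrow> nat. (\<forall>i\<in>{n - l..<n}. 0 < \<alpha> i) \<and> (\<forall>q\<in>U. \<tau> q = (\<Prod>i\<in>{n - l..<n}. \<phi> q i ^ \<alpha> i)))"
    using bf p unfolding boundary_function_def by blast
  then obtain x where x: "x \<in> smooth_charts n X A" "case x of (U, l, \<phi>) \<Rightarrow> p \<in> U \<and> \<phi> p = (\<lambda>_. 0) \<and>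
      (\<exists>\<alpha>::nat \<Rightarrow> nat. (\<forall>i\<in>{n - l..<n}. 0 < \<alpha> i) \<and> (\<forall>q\<in>U. \<tau> q = (\<Prod>i\<in>{n - l..<n}. \<phi> q i ^ \<alpha> i)))"
    by (elim bexE)
  obtain U l \<phi> where xe: "x = (U, l, \<phi>)" by (cases x)
  have sc: "(U, l, \<phi>) \<in> smooth_charts n X A" and pU: "p \<in> U"
    and "\<exists>\<alpha>::nat \<Rightarrow> nat. (\<forall>i\<in>{n - l..<n}. 0 < \<alpha> i) \<and> (\<forall>q\<in>U. \<tau> q = (\<Prod>i\<in>{n - l..<n}. \<phi> q i ^ \<alpha> i))"
    using x unfolding xe prod.case by blast+
  then obtain \<alpha> :: "nat \<Rightarrow> nat" where \<alpha>: "\<And>i. i \<in> {n - l..<n} \<Longrightarrow> 0 < \<alpha> i"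
    and \<tau>: "\<And>q. q \<in> U \<Longrightarrow> \<tau> q = (\<Prod>i\<in>{n - l..<n}. \<phi> q i ^ \<alpha> i)" by blast
  have c: "corner_chart n X (U, l, \<phi>)" using sc by (simp add: smooth_charts_def)
  obtain k0 where k0: "k0 \<ge> 1" "p \<in> stratum n A k0" using p unfolding mfd_boundary_def by auto
  have "card (vanishing n l (\<phi> p)) \<ge> 1" using smooth_chart_stratum[OF M sc pU k0(2)] k0(1) by simp
  then have "vanishing n l (\<phi> p) \<noteq> {}" by auto
  then have k: "n - 1 < n" "n - 1 \<in> {n - l..<n}" by (auto simp: vanishing_def)
  \<comment> \<open>The last coordinate, which is a \<open>y\<close>-coordinate because
    \<open>p\<close> has positive depth.\<close>
  define k where "k = n - 1"
  have False if q: "q \<in> U" "q \<in> mfd_interior n A" and V: "(V, m, \<psi>) \<in> A" "q \<in> V"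
    and flat: "chart_deriv X n \<psi> (mfd_interior n A) \<tau> q (\<lambda>_. 0)" for q V m \<psi>
  proof -
    have "card (vanishing n l (\<phi> q)) = 0" by (rule smooth_chart_stratum[OF M sc q])
    then have "vanishing n l (\<phi> q) = {}" using finite_vanishing by simp
    then have nz: "\<phi> q i \<noteq> 0" if "i \<in> {n - l..<n}" for i using that by (auto simp: vanishing_def)
    obtain \<rho> where \<rho>: "filterlim \<rho> (nhdsin X q) (at_right 0)"
      "\<forall>\<^sub>F t in at_right 0. \<rho> t \<in> U \<and> \<phi> (\<rho> t) = (\<phi> q)(k := \<phi> q k + 1 * t)"
      using chart_curve[OF c q(1), of k 1] k(1) unfolding k_def by blast
    \<comment> \<open>Flatness is given in a chart of \<open>A\<close>, while the monomial lives in
      the compatible chart \<open>\<phi>\<close>; the chain rule along a coordinate curve of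
      \<open>\<phi>\<close> transports it.\<close>
    have "smooth_transition n (U, l, \<phi>) (V, m, \<psi>)" using sc V(1) by (auto simp: smooth_charts_def)
    from smooth_transition_deriv[OF c this q(1) V(2)] obtain B where
      B: "\<And>j. j < n \<Longrightarrow> chart_deriv X n \<phi> V (\<lambda>r. \<psi> r j) q (B j)" by blast
    have \<rho>V: "\<forall>\<^sub>F t in at_right 0. \<rho> t \<in> V" and \<rho>M: "\<forall>\<^sub>F t in at_right 0. \<rho> t \<in> mfd_interior n A"
      using \<rho>(1) eventually_nhdsin_mem[OF corner_chartD(2)[OF mfd_chart[OF M V(1)]] V(2)]
        eventually_interior[OF M q(2)] unfolding filterlim_iff by blast+
    have kn: "k < n" using k(1) by (simp add: k_def)
    have "((\<lambda>t. (\<psi> (\<rho> t) j - \<psi> q j) / t) \<longlongrightarrow> B j k) (at_right 0)" if "j < n" for j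
      using chart_deriv_coord[OF B[OF that] \<rho>(1) kn \<rho>V \<rho>(2)] by simp
    from chart_chain[OF flat \<rho>(1) \<rho>M this]
    have lim0: "((\<lambda>t. (\<tau> (\<rho> t) - \<tau> q) / t) \<longlongrightarrow> 0) (at_right 0)" by simp
    define R where "R = (\<Prod>i\<in>{n - l..<n} - {k}. \<phi> q i ^ \<alpha> i)"
    have kl: "k \<in> {n - l..<n}" using k(2) by (simp add: k_def)
    have R0: "R \<noteq> 0" unfolding R_def using nz by (auto simp: prod_zero_iff)
    have prod_k: "(\<Prod>i\<in>{n - l..<n}. z i ^ \<alpha> i) = R * z k ^ \<alpha> k"
      if "\<And>i. i \<noteq> k \<Longrightarrow> z i = \<phi> q i" for z :: "nat \<Rightarrow> real"
    proof -
      have "(\<Prod>i\<in>{n - l..<n} - {k}. z i ^ \<alpha> i) = R"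
        unfolding R_def by (rule prod.cong) (use that in auto)
      then show ?thesis using prod.remove[OF _ kl, of "\<lambda>i. z i ^ \<alpha> i"] by (simp add: mult.commute)
    qed
    have "((\<lambda>x. R * x ^ \<alpha> k) has_real_derivative R * (real (\<alpha> k) * \<phi> q k ^ (\<alpha> k - 1))) (at (\<phi> q k))"
      by (auto intro!: derivative_eq_intros)
    then have "((\<lambda>t. (R * (\<phi> q k + t) ^ \<alpha> k - R * \<phi> q k ^ \<alpha> k) / t) \<longlongrightarrow>
        R * (real (\<alpha> k) * \<phi> q k ^ (\<alpha> k - 1))) (at_right 0)"
      unfolding DERIV_def by (rule filterlim_mono[OF _ order_refl]) (simp add: at_le)
    moreover have "\<forall>\<^sub>F t in at_right 0. (R * (\<phi> q k + t) ^ \<alpha> k - R * \<phi> q k ^ \<alpha> k) / t = (\<tau> (\<rho> t) - \<tau> q) / t"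
      using \<rho>(2)
    proof eventually_elim
      case (elim t)
      have "\<tau> (\<rho> t) = R * (\<phi> q k + t) ^ \<alpha> k"
        using \<tau>[of "\<rho> t"] prod_k[of "\<phi> (\<rho> t)"] elim by simp
      moreover have "\<tau> q = R * \<phi> q k ^ \<alpha> k" using \<tau>[OF q(1)] prod_k[of "\<phi> q"] by simp
      ultimately show ?case by simp
    qed
    ultimately have "((\<lambda>t. (\<tau> (\<rho> t) - \<tau> q) / t) \<longlongrightarrow> R * (real (\<alpha> k) * \<phi> q k ^ (\<alpha> k - 1))) (at_right 0)"
      using tendsto_cong by fast
    from tendsto_unique[OF trivial_limit_at_right_real this lim0]
    show False using R0 nz[OF kl] \<alpha>[OF kl] by simp
  qed
  then show ?thesis using corner_chartD(2)[OF c] pU by (intro exI[of _ U]) auto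
qed

lemma compact_space_cluster_point:
  assumes "compact_space X" "\<And>j::nat. p j \<in> topspace X"
  obtains x where "x \<in> topspace X" "\<And>S. openin X S \<Longrightarrow> x \<in> S \<Longrightarrow> \<exists>\<^sub>F j in sequentially. p j \<in> S"
proof -
  have "\<exists>x\<in>topspace X. \<forall>S. openin X S \<and> x \<in> S \<longrightarrow> (\<exists>\<^sub>F j in sequentially. p j \<in> S)"
  proof (rule ccontr)
    assume n: "\<not> ?thesis"
    \<comment> \<open>Without a cluster point the open sets that the sequence eventually leaves
      cover the space; a finite subcover would eventually be left altogether.\<close>
    define \<U> where "\<U> = {S. openin X S \<and> (\<forall>\<^sub>F j in sequentially. p j \<notin> S)}"
    have "topspace X \<subseteq> \<Union>\<U>" using n unfolding \<U>_def frequently_def by blast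
    moreover have "\<forall>S\<in>\<U>. openin X S" by (simp add: \<U>_def)
    ultimately obtain \<F> where \<F>: "finite \<F>" "\<F> \<subseteq> \<U>" "topspace X \<subseteq> \<Union>\<F>"
      using assms(1)[unfolded compact_space_alt, rule_format, of \<U>] by metis
    have "\<forall>\<^sub>F j in sequentially. \<forall>S\<in>\<F>. p j \<notin> S"
      by (rule eventually_ball_finite[OF \<F>(1)]) (use \<F>(2) in \<open>auto simp: \<U>_def\<close>)
    moreover have "\<forall>\<^sub>F j in sequentially. \<exists>S\<in>\<F>. p j \<in> S"
      using \<F>(3) assms(2) by (intro always_eventually) blast
    ultimately have "\<forall>\<^sub>F j::nat in sequentially. False" by eventually_elim blast
    then show False by simp
  qed
  then show ?thesis using that by blast
qed

section \<open>Critical values of the perturbed functions\<close>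

lemma chart_deriv_quotient:
  assumes M: "manifold_with_corners n X A"
    and \<tau>: "C_diff_mfd \<infinity> n A (topspace X) \<tau>" "\<forall>p\<in>mfd_interior n A. 0 < \<tau> p"
    and c: "(V, m, \<psi>) \<in> A" "p \<in> V" "p \<in> mfd_interior n A"
  shows "\<exists>d. chart_deriv X n \<psi> (mfd_interior n A) (\<lambda>r. \<epsilon> / \<tau> r) p d"
proof -
  have MX: "mfd_interior n A \<subseteq> topspace X" by (rule stratum_subset_topspace[OF M])
  then have "p \<in> topspace X" using c(3) by blast
  from C_diff_mfd_chart_deriv[OF M \<tau>(1) _ c(1,2) this]
  obtain d where d0: "chart_deriv X n \<psi> (topspace X) \<tau> p d" by auto
  have d: "chart_deriv X n \<psi> (mfd_interior n A) \<tau> p d" by (rule chart_deriv_subset[OF d0 MX])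
  have "((\<lambda>y. \<epsilon> / y) has_real_derivative - \<epsilon> / (\<tau> p)\<^sup>2) (at (\<tau> p))"
    using \<tau>(2)[rule_format, OF c(3)] by (auto intro!: derivative_eq_intros simp: power2_eq_square)
  from chart_deriv_compose[OF mfd_chart[OF M c(1)] c(2) d this] show ?thesis by blast
qed

lemma chart_deriv_perturbed:
  assumes M: "manifold_with_corners n X A" and f: "C_diff_mfd \<infinity> n A (mfd_interior n A) f"
    and \<tau>: "C_diff_mfd \<infinity> n A (topspace X) \<tau>" "\<forall>p\<in>mfd_interior n A. 0 < \<tau> p"
    and c: "(V, m, \<psi>) \<in> A" "p \<in> V" "p \<in> mfd_interior n A"
  shows "\<exists>d. chart_deriv X n \<psi> (mfd_interior n A) (\<lambda>r. f r + \<epsilon> / \<tau> r) p d"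
proof -
  obtain d where d: "chart_deriv X n \<psi> (mfd_interior n A) f p d"
    using C_diff_mfd_chart_deriv[OF M f _ c] by auto
  obtain d' where d': "chart_deriv X n \<psi> (mfd_interior n A) (\<lambda>r. \<epsilon> / \<tau> r) p d'"
    using chart_deriv_quotient[OF M \<tau> c] by blast
  show ?thesis using chart_deriv_add[OF d d'] by blast
qed

text \<open>The set \<open>W\<close> is semialgebraic and consists of points of the graph of
  \<open>(f, 1 / \<tau>)\<close>, although \<open>\<tau>\<close> itself is not semialgebraic. It
  contains the lift of every point that is a limit of points with \<open>f \<noteq> 0\<close>; hence
  the pencil results apply to the critical values at such points.\<close>

lemma perturbed_critical_values_cover:
  assumes M: "manifold_with_corners n X A" and U: "openin X U" and emb: "C1_embedding n X A U N \<phi>"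
    and saf: "semialgebraic_function N (\<phi> ` (U \<inter> mfd_interior n A)) (\<lambda>x. f (inv_into U \<phi> x))"
    and sab: "semialgebraic_function N (\<phi> ` U) (\<lambda>x. fbar (inv_into U \<phi> x))"
    and f: "C_diff_mfd \<infinity> n A (mfd_interior n A) f"
    and \<tau>: "C_diff_mfd \<infinity> n A (topspace X) \<tau>" "\<forall>p\<in>mfd_interior n A. 0 < \<tau> p"
    and fb: "\<forall>p\<in>mfd_interior n A. fbar p = \<tau> p * f p"
  obtains E where "finite (limit_values E)"
    "\<And>p \<epsilon>. p \<in> U \<Longrightarrow> p \<in> critical_points n A 0 (\<lambda>p. f p + \<epsilon> / \<tau> p) \<Longrightarrow>
      \<exists>\<^sub>F r in nhdsin X p. r \<in> mfd_interior n A \<and> f r \<noteq> 0 \<Longrightarrow> f p + \<epsilon> / \<tau> p \<in> E \<epsilon>"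
proof -
  let ?M = "mfd_interior n A"
  have e: "embedding_map (subtopology X U) (Euclidean_space N) \<phi>" using emb by (simp add: C1_embedding_def)
  have UX: "U \<subseteq> topspace X" by (rule openin_subset[OF U])
  have inj: "inj_on \<phi> U"
    by (rule embedding_inj_on[OF e UX])
  have MX: "?M \<subseteq> topspace X" by (rule stratum_subset_topspace[OF M])
  define F where "F = graph_on N (\<phi> ` (U \<inter> ?M)) (\<lambda>x. f (inv_into U \<phi> x))"
  define B where "B = graph_on N (\<phi> ` U) (\<lambda>x. fbar (inv_into U \<phi> x))"
  have Fs: "semialg_set (Suc N) F" and Bs: "semialg_set (Suc N) B"
    unfolding F_def B_def using saf sab unfolding semialgebraic_function_def
    by (auto intro: semialgebraic_semialg_set)
  have Fi: "F = (\<lambda>r. (\<phi> r)(N := f r)) ` (U \<inter> ?M)" and Bi: "B = (\<lambda>r. (\<phi> r)(N := fbar r)) ` U"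
    unfolding F_def B_def graph_on_def image_image by (rule image_cong; use inj in auto)+
  define W where "W = quotient_closure N F B"
  have Ws: "semialg_set (Suc (Suc N)) W" unfolding W_def by (rule semialg_set_quotient_closure[OF Fs Bs])
  define lift where "lift r = (\<phi> r)(N := f r, Suc N := 1 / \<tau> r)" for r
  have \<phi>t: "\<phi> r \<in> real_tuples N" if "r \<in> U" for r
    using continuous_map_image_subset_topspace[OF homeomorphic_imp_continuous_map[OF
      e[unfolded embedding_map_def]]] that UX by auto
  note \<tau>d = chart_deriv_quotient[OF M \<tau>]
  have \<tau>c: "\<forall>\<^sub>F r in nhdsin X p. r \<in> ?M \<longrightarrow> \<bar>1 / \<tau> r - 1 / \<tau> p\<bar> < \<delta>" if p: "p \<in> ?M" and "\<delta> > 0" for p \<delta>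
  proof -
    obtain V m \<psi> where c: "(V, m, \<psi>) \<in> A" "p \<in> V" using mfd_chart_exists[OF M, of p] p MX by blast
    obtain d where d: "chart_deriv X n \<psi> ?M (\<lambda>r. 1 / \<tau> r) p d" using \<tau>d[OF c p] by blast
    show ?thesis by (rule chart_deriv_continuous[OF mfd_chart[OF M c(1)] c(2) d \<open>\<delta> > 0\<close>])
  qed
  \<comment> \<open>Multiplied out, closeness to \<open>1 / \<tau> r\<close> is expressed by the
    values of \<open>f\<close> and \<open>fbar\<close> alone, as required in
    \<open>quotient_closure\<close>.\<close>
  have quot: "\<bar>u * fbar r - f r\<bar> < \<delta> * \<bar>fbar r\<bar> \<longleftrightarrow> \<bar>u - 1 / \<tau> r\<bar> < \<delta>" if "r \<in> ?M" "f r \<noteq> 0" for u r \<delta>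
  proof -
    have "fbar r \<noteq> 0" "u * fbar r - f r = (u - 1 / \<tau> r) * fbar r"
      using fb[rule_format, OF that(1)] \<tau>(2)[rule_format, OF that(1)] that(2) by (auto simp: field_simps)
    then show ?thesis by (simp add: abs_mult)
  qed
  \<comment> \<open>Equal positions in the graphs of \<open>f\<close> and \<open>fbar\<close> come
    from the same point of the manifold, by injectivity of the embedding.\<close>
  have same: "r' = r" if "r \<in> U" "r' \<in> U" "\<forall>i\<in>{..<N}. ((\<phi> r)(N := a)) i = ((\<phi> r')(N := b)) i" for r r' a b
  proof -
    have "\<phi> r i = \<phi> r' i" for i
      using that(3) \<phi>t[OF that(1)] \<phi>t[OF that(2)] by (cases "i < N") (auto simp: topspace_Euclidean_space)
    then have "\<phi> r' = \<phi> r" by (intro ext) simp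
    then show ?thesis using inj_onD[OF inj] that(1,2) by blast
  qed
  have W_lift: "\<exists>r\<in>U \<inter> ?M. w = lift r" if w: "w \<in> W" for w
  proof -
    obtain r where r: "r \<in> U" "r \<in> ?M" "w(Suc N := 0) = (\<phi> r)(N := f r)"
      using w unfolding W_def quotient_closure_def Fi by auto
    have wi: "w i = ((\<phi> r)(N := f r)) i" if "i \<noteq> Suc N" for i using r(3) that by (metis fun_upd_other)
    have "w (Suc N) = 1 / \<tau> r"
    proof (rule ccontr)
      \<comment> \<open>Half the supposed discrepancy: continuity of \<open>1 / \<tau>\<close> and
        the quotient condition each contribute less than \<open>\<delta>\<close>.\<close>
      define \<delta> where "\<delta> = \<bar>w (Suc N) - 1 / \<tau> r\<bar> / 2"
      assume "w (Suc N) \<noteq> 1 / \<tau> r"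
      then have \<delta>: "\<delta> > 0" by (simp add: \<delta>_def)
      obtain s where s: "s > 0" "\<And>r'. r' \<in> U \<Longrightarrow> l1 N (\<phi> r') (\<phi> r) < s \<Longrightarrow> r' \<in> ?M \<Longrightarrow> \<bar>1 / \<tau> r' - 1 / \<tau> r\<bar> < \<delta>"
        using \<tau>c[OF r(2) \<delta>] unfolding embedding_nhdsin[OF e U r(1)] by blast
      \<comment> \<open>The division by \<open>N + 1\<close> turns coordinatewise closeness into
        \<open>l1\<close> distance below \<open>s\<close>.\<close>
      define \<delta>' where "\<delta>' = min \<delta> (s / (real N + 1))"
      have \<delta>': "\<delta>' > 0" using \<delta> s(1) by (simp add: \<delta>'_def)
      obtain q b where qb: "q \<in> F" "b \<in> B" "q N \<noteq> 0" "\<forall>i\<in>{..<N}. q i = b i \<and> \<bar>q i - w i\<bar> < \<delta>'"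
        "\<bar>w (Suc N) * b N - q N\<bar> < \<delta>' * \<bar>b N\<bar>"
        using w \<delta>' unfolding W_def quotient_closure_def by blast
      obtain r1 where r1: "r1 \<in> U" "r1 \<in> ?M" "q = (\<phi> r1)(N := f r1)" using qb(1) unfolding Fi by auto
      obtain r2 where r2: "r2 \<in> U" "b = (\<phi> r2)(N := fbar r2)" using qb(2) unfolding Bi by auto
      have "\<forall>i\<in>{..<N}. ((\<phi> r1)(N := f r1)) i = ((\<phi> r2)(N := fbar r2)) i"
        using qb(4) unfolding r1(3) r2(2) by blast
      from same[OF r1(1) r2(1) this] have "b N = fbar r1" by (simp add: r2(2))
      moreover have "q N = f r1" by (simp add: r1(3))
      ultimately have "\<bar>w (Suc N) * fbar r1 - f r1\<bar> < \<delta>' * \<bar>fbar r1\<bar>" "f r1 \<noteq> 0"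
        using qb(3,5) by simp_all
      then have 1: "\<bar>w (Suc N) - 1 / \<tau> r1\<bar> < \<delta>'" using quot[OF r1(2)] by blast
      have "l1 N (\<phi> r1) (\<phi> r) \<le> (\<Sum>i<N. \<delta>')"
        unfolding l1_def
      proof (rule sum_mono)
        fix i assume i: "i \<in> {..<N}"
        then have "\<bar>q i - w i\<bar> < \<delta>'" using qb(4) by blast
        then show "\<bar>\<phi> r1 i - \<phi> r i\<bar> \<le> \<delta>'" using i r1(3) wi[of i] by simp
      qed
      also have "\<dots> < (real N + 1) * \<delta>'" using \<delta>' by simp
      also have "\<dots> \<le> s"
      proof -
        have "\<delta>' \<le> s / (real N + 1)" by (simp add: \<delta>'_def)
        then show ?thesis by (simp add: field_simps)
      qed
      finally have "\<bar>1 / \<tau> r1 - 1 / \<tau> r\<bar> < \<delta>" by (intro s(2) r1)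
      moreover have "\<delta>' \<le> \<delta>" by (simp add: \<delta>'_def)
      ultimately have "\<bar>w (Suc N) - 1 / \<tau> r\<bar> < 2 * \<delta>" using 1 by linarith
      then show False by (simp add: \<delta>_def)
    qed
    then have "w = lift r" using wi by (auto simp: lift_def fun_eq_iff)
    then show ?thesis using r by blast
  qed
  have lift_W: "lift p \<in> W" if p: "p \<in> U" "p \<in> ?M" and fr: "\<exists>\<^sub>F r in nhdsin X p. r \<in> ?M \<and> f r \<noteq> 0" for p
    unfolding W_def quotient_closure_def mem_Collect_eq
  proof (intro conjI allI impI)
    show "lift p \<in> real_tuples (Suc (Suc N))" using \<phi>t[OF p(1)] by (auto simp: lift_def topspace_Euclidean_space)
    have "(lift p)(Suc N := 0) = (\<phi> p)(N := f p)"
      using \<phi>t[OF p(1)] by (auto simp: lift_def fun_eq_iff topspace_Euclidean_space)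
    then show "(lift p)(Suc N := 0) \<in> F" using p by (simp add: Fi)
    fix \<delta> :: real assume \<delta>: "0 < \<delta>"
    have "\<forall>\<^sub>F r in nhdsin X p. l1 N (\<phi> r) (\<phi> p) < \<delta>"
      unfolding embedding_nhdsin[OF e U p(1)] using \<delta> by blast
    then have "\<forall>\<^sub>F r in nhdsin X p. r \<in> U \<and> l1 N (\<phi> r) (\<phi> p) < \<delta> \<and> (r \<in> ?M \<longrightarrow> \<bar>1 / \<tau> r - 1 / \<tau> p\<bar> < \<delta>)"
      by (intro eventually_conj eventually_nhdsin_mem[OF U p(1)] \<tau>c[OF p(2) \<delta>])
    from frequently_eventually_conj[OF fr this] have "\<exists>\<^sub>F r in nhdsin X p. (r \<in> ?M \<and> f r \<noteq> 0) \<and>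
        r \<in> U \<and> l1 N (\<phi> r) (\<phi> p) < \<delta> \<and> (r \<in> ?M \<longrightarrow> \<bar>1 / \<tau> r - 1 / \<tau> p\<bar> < \<delta>)"
      by (rule frequently_elim1) blast
    from frequently_ex[OF this] obtain r where r: "r \<in> ?M" "f r \<noteq> 0" "r \<in> U" "l1 N (\<phi> r) (\<phi> p) < \<delta>"
      "\<bar>1 / \<tau> r - 1 / \<tau> p\<bar> < \<delta>" by blast
    have "\<bar>1 / \<tau> p * fbar r - f r\<bar> < \<delta> * \<bar>fbar r\<bar>"
      unfolding quot[OF r(1,2)] using r(5) by simp
    moreover have "\<bar>\<phi> r i - \<phi> p i\<bar> < \<delta>" if "i < N" for i
      using le_less_trans[OF abs_le_l1[OF that] r(4)] .
    ultimately show "\<exists>q\<in>F. \<exists>b\<in>B. q N \<noteq> 0 \<and> (\<forall>i\<in>{..<N}. q i = b i \<and> \<bar>q i - lift p i\<bar> < \<delta>) \<and>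
        \<bar>lift p (Suc N) * b N - q N\<bar> < \<delta> * \<bar>b N\<bar>"
      using r by (intro bexI[of _ "(\<phi> r)(N := f r)"] bexI[of _ "(\<phi> r)(N := fbar r)"])
        (auto simp: lift_def Fi Bi)
  qed
  have pen: "pencil N \<epsilon> (lift r) = f r + \<epsilon> / \<tau> r" for \<epsilon> r by (simp add: pencil_def lift_def)
  show ?thesis
  proof (rule that[of "pencil_critical_values N W"])
    show "finite (limit_values (pencil_critical_values N W))"
      by (rule finite_limit_pencil_critical_values[OF Ws])
    fix p \<epsilon> assume p: "p \<in> U" "p \<in> critical_points n A 0 (\<lambda>p. f p + \<epsilon> / \<tau> p)"
      and fr: "\<exists>\<^sub>F r in nhdsin X p. r \<in> ?M \<and> f r \<noteq> 0"
    have pM: "p \<in> ?M" using p(2) by (simp add: critical_points_def)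
    have gd: "\<exists>d. chart_deriv X n \<psi> ?M (\<lambda>p. f p + \<epsilon> / \<tau> p) p d" if c: "(V, m, \<psi>) \<in> A" "p \<in> V" for V m \<psi>
      by (rule chart_deriv_perturbed[OF M f \<tau> c pM])
    have "pencil_critical N W \<epsilon> (lift p)" unfolding pencil_critical_def
    proof (intro allI impI)
      fix K \<eta> :: real assume K: "0 < K \<and> 0 < \<eta>"
      have "\<exists>\<delta>>0. \<forall>r\<in>U \<inter> ?M. \<forall>r'\<in>U \<inter> ?M. \<forall>h. 0 < h \<and> h < \<delta> \<longrightarrow> near_pair N (\<phi> p) K \<delta> h (\<phi> r) (\<phi> r') \<longrightarrow>
          \<bar>(f r + \<epsilon> / \<tau> r) - (f p + \<epsilon> / \<tau> p)\<bar> \<le> \<eta> * h"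
        by (rule critical_point_near_pair[OF M U emb p order_refl]) (use gd K in auto)
      then obtain \<delta> where \<delta>: "\<delta> > 0" "\<And>r r' h. r \<in> U \<inter> ?M \<Longrightarrow> r' \<in> U \<inter> ?M \<Longrightarrow> 0 < h \<and> h < \<delta> \<Longrightarrow>
          near_pair N (\<phi> p) K \<delta> h (\<phi> r) (\<phi> r') \<Longrightarrow> \<bar>(f r + \<epsilon> / \<tau> r) - (f p + \<epsilon> / \<tau> p)\<bar> \<le> \<eta> * h" by blast
      have "near_pair N (lift p) K \<delta> h (lift r) (lift r') = near_pair N (\<phi> p) K \<delta> h (\<phi> r) (\<phi> r')" for \<delta> h r r'
        by (auto simp: near_pair_def lift_def)
      then show "\<exists>\<delta>>0. \<forall>q\<in>W. \<forall>q'\<in>W. \<forall>h. 0 < h \<and> h < \<delta> \<longrightarrow> near_pair N (lift p) K \<delta> h q q' \<longrightarrow>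
          \<bar>pencil N \<epsilon> q - pencil N \<epsilon> (lift p)\<bar> \<le> \<eta> * h"
        \<comment> \<open>Every point of \<open>W\<close> is a lift, so the estimate for pairs in
          the manifold gives the one for pairs in \<open>W\<close>.\<close>
        using \<delta> W_lift pen by (intro exI[of _ \<delta>] conjI ballI allI impI) metis+
    qed
    then show "f p + \<epsilon> / \<tau> p \<in> pencil_critical_values N W \<epsilon>"
      unfolding pencil_critical_values_def mem_Collect_eq
      using lift_W[OF p(1) pM fr] by (intro bexI[of _ "lift p"]) (simp_all add: pen)
  qed
qed

text \<open>Near \<open>p\<close> only \<open>\<epsilon> / \<tau>\<close> is left, and at an
  interior point all coordinates are tangential, so its whole derivative vanishes there.\<close>

lemma perturbed_critical_flat:
  assumes M: "manifold_with_corners n X A" and f: "C_diff_mfd \<infinity> n A (mfd_interior n A) f"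
    and \<tau>: "C_diff_mfd \<infinity> n A (topspace X) \<tau>" "\<forall>p\<in>mfd_interior n A. 0 < \<tau> p"
    and p: "p \<in> critical_points n A 0 (\<lambda>p. f p + \<epsilon> / \<tau> p)" and \<epsilon>: "\<epsilon> \<noteq> 0"
    and f0: "\<forall>\<^sub>F r in nhdsin X p. r \<in> mfd_interior n A \<longrightarrow> f r = 0" "f p = 0"
  shows "\<exists>(V, m, \<psi>)\<in>A. p \<in> V \<and> chart_deriv X n \<psi> (mfd_interior n A) \<tau> p (\<lambda>_. 0)"
proof -
  let ?M = "mfd_interior n A"
  have pM: "p \<in> ?M" using p by (simp add: critical_points_def)
  have ex: "\<exists>d. chart_deriv X n \<psi> ?M (\<lambda>r. f r + \<epsilon> / \<tau> r) p d" if "(V, m, \<psi>) \<in> A" "p \<in> V" for V m \<psi>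
    by (rule chart_deriv_perturbed[OF M f \<tau> that pM])
  obtain V m \<psi> d where c: "(V, m, \<psi>) \<in> A" "p \<in> V" and d: "chart_deriv X n \<psi> ?M (\<lambda>r. f r + \<epsilon> / \<tau> r) p d"
    and d0: "\<And>i. i < n \<Longrightarrow> i \<notin> vanishing n m (\<psi> p) \<Longrightarrow> d i = 0"
    by (rule critical_point_chart[OF M p order_refl ex]; (assumption | rule that))
  have "card (vanishing n m (\<psi> p)) = 0" using stratum_iff[OF M c] pM by blast
  then have "vanishing n m (\<psi> p) = {}" using finite_vanishing by simp
  then have "chart_deriv X n \<psi> ?M (\<lambda>r. f r + \<epsilon> / \<tau> r) p (\<lambda>_. 0)"
    using d d0 unfolding chart_deriv_def by simp
  then have 1: "chart_deriv X n \<psi> ?M (\<lambda>r. \<epsilon> / \<tau> r) p (\<lambda>_. 0)"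
  proof (rule chart_deriv_cong)
    show "f p + \<epsilon> / \<tau> p = \<epsilon> / \<tau> p" using f0(2) by simp
    show "\<forall>\<^sub>F r in nhdsin X p. r \<in> ?M \<longrightarrow> f r + \<epsilon> / \<tau> r = \<epsilon> / \<tau> r"
      using f0(1) by eventually_elim simp
  qed
  have \<tau>p: "\<tau> p > 0" using \<tau>(2) pM by blast
  \<comment> \<open>The map \<open>y \<mapsto> \<epsilon> / y\<close> is its own inverse and
    recovers \<open>\<tau>\<close> from \<open>\<epsilon> / \<tau>\<close>.\<close>
  have "((\<lambda>y. \<epsilon> / y) has_real_derivative - \<epsilon> / (\<epsilon> / \<tau> p)\<^sup>2) (at (\<epsilon> / \<tau> p))"
    using \<tau>p \<epsilon> by (auto intro!: derivative_eq_intros simp: power2_eq_square)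
  from chart_deriv_compose[OF mfd_chart[OF M c(1)] c(2) 1 this]
  have "chart_deriv X n \<psi> ?M (\<lambda>r. \<epsilon> / (\<epsilon> / \<tau> r)) p (\<lambda>_. 0)" by simp
  then have "chart_deriv X n \<psi> ?M \<tau> p (\<lambda>_. 0)"
    by (rule chart_deriv_cong) (use \<epsilon> in auto)
  then show ?thesis using c by blast
qed

lemma mfd_interior_or_boundary:
  assumes "manifold_with_corners n X A" "x \<in> topspace X"
  shows "x \<in> mfd_interior n A \<or> x \<in> mfd_boundary n A"
proof -
  obtain V m \<psi> where c: "(V, m, \<psi>) \<in> A" "x \<in> V" using mfd_chart_exists[OF assms] by blast
  then have "x \<in> stratum n A (card (vanishing n m (\<psi> x)))" by (auto simp: stratum_def)
  then show ?thesis unfolding mfd_boundary_def by (cases "card (vanishing n m (\<psi> x))") auto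
qed

text \<open>A nonzero limit value outside the sets \<open>limit_values (E U)\<close> can only arise
  at points near which \<open>f\<close> vanishes. A cluster point of these is ruled out in the
  interior, where \<open>\<tau>\<close> is bounded below and the values tend to 0, and on the
  boundary, near which \<open>\<tau>\<close> has no flat interior points.\<close>

lemma limit_critical_values_cover:
  assumes comp: "compactification n X A f fbar \<tau>" and \<U>: "finite \<U>" "\<Union>\<U> = topspace X"
    and E: "\<And>U p \<epsilon>. U \<in> \<U> \<Longrightarrow> p \<in> U \<Longrightarrow> p \<in> critical_points n A 0 (\<lambda>p. f p + \<epsilon> / \<tau> p) \<Longrightarrow>
      \<exists>\<^sub>F r in nhdsin X p. r \<in> mfd_interior n A \<and> f r \<noteq> 0 \<Longrightarrow> f p + \<epsilon> / \<tau> p \<in> E U \<epsilon>"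
  shows "limit_critical_values n A f \<tau> \<subseteq> insert 0 (\<Union>U\<in>\<U>. limit_values (E U))"
proof
  let ?M = "mfd_interior n A"
  have M: "manifold_with_corners n X A" and cX: "compact_space X"
    and f: "C_diff_mfd \<infinity> n A ?M f" and bf: "boundary_function n X A \<tau>"
    using comp by (auto simp: compactification_def)
  have \<tau>: "C_diff_mfd \<infinity> n A (topspace X) \<tau>" "\<forall>p\<in>?M. 0 < \<tau> p" using bf by (auto simp: boundary_function_def)
  have MX: "?M \<subseteq> topspace X" by (rule stratum_subset_topspace[OF M])
  fix c assume "c \<in> limit_critical_values n A f \<tau>"
  then obtain \<epsilon> cs where \<epsilon>: "\<epsilon> \<longlonglongrightarrow> 0" and cs: "cs \<longlonglongrightarrow> c"
    and "\<And>j::nat. cs j \<in> perturbed_critical_values n A f \<tau> (\<epsilon> j)"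
    unfolding limit_critical_values_def by blast
  then have "\<forall>j. \<exists>q. q \<in> critical_points n A 0 (\<lambda>p. f p + \<epsilon> j / \<tau> p) \<and> cs j = f q + \<epsilon> j / \<tau> q"
    unfolding perturbed_critical_values_def critical_values_def by blast
  then obtain p where p: "\<And>j. p j \<in> critical_points n A 0 (\<lambda>p. f p + \<epsilon> j / \<tau> p)"
    and csp: "\<And>j. cs j = f (p j) + \<epsilon> j / \<tau> (p j)" by metis
  have pM: "p j \<in> ?M" for j using p[of j] by (simp add: critical_points_def)
  have pX: "p j \<in> topspace X" for j using pM MX by blast
  show "c \<in> insert 0 (\<Union>U\<in>\<U>. limit_values (E U))"
  proof (rule ccontr)
    assume n: "\<not> ?thesis"
    then have c0: "c \<noteq> 0" by simp
    \<comment> \<open>The points to which the semialgebraic description of \<open>1 / \<tau>\<close>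
      applies. The filter includes \<open>p j\<close> itself, so \<open>f (p j) \<noteq> 0\<close>
      is sufficient.\<close>
    define good where "good j \<longleftrightarrow> (\<exists>\<^sub>F r in nhdsin X (p j). r \<in> ?M \<and> f r \<noteq> 0)" for j
    have "\<forall>\<^sub>F j in sequentially. \<not> (p j \<in> U \<and> good j)" if U: "U \<in> \<U>" for U
    proof -
      have "c \<notin> limit_values (E U)" using n U by blast
      then obtain \<delta> where \<delta>: "\<delta> > 0" "\<And>\<epsilon> c'. \<bar>\<epsilon>\<bar> < \<delta> \<Longrightarrow> \<bar>c' - c\<bar> < \<delta> \<Longrightarrow> c' \<notin> E U \<epsilon>"
        unfolding limit_values_def by blast
      have "\<forall>\<^sub>F j in sequentially. dist (\<epsilon> j) 0 < \<delta>" "\<forall>\<^sub>F j in sequentially. dist (cs j) c < \<delta>"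
        using \<epsilon> cs \<delta>(1) unfolding tendsto_iff by blast+
      then show ?thesis
      proof eventually_elim
        case (elim j)
        then have "cs j \<notin> E U (\<epsilon> j)" using \<delta>(2) by (simp add: dist_real_def)
        then show ?case using E[OF U _ p[of j]] csp[of j] unfolding good_def by auto
      qed
    qed
    then have "\<forall>\<^sub>F j in sequentially. \<forall>U\<in>\<U>. \<not> (p j \<in> U \<and> good j)"
      by (intro eventually_ball_finite[OF \<U>(1)]) blast
    then have bad: "\<forall>\<^sub>F j in sequentially. \<not> good j"
      by eventually_elim (use pX \<U>(2) in blast)
    have "\<forall>\<^sub>F j in sequentially. dist (cs j) c < \<bar>c\<bar> / 2"
      using cs c0 unfolding tendsto_iff by (metis half_gt_zero zero_less_abs_iff)
    then have large: "\<forall>\<^sub>F j in sequentially. \<bar>cs j\<bar> > \<bar>c\<bar> / 2"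
      by eventually_elim (simp add: dist_real_def abs_if split: if_splits)
    have loc: "f (p j) = 0" "\<forall>\<^sub>F r in nhdsin X (p j). r \<in> ?M \<longrightarrow> f r = 0" if "\<not> good j" for j
    proof -
      show *: "\<forall>\<^sub>F r in nhdsin X (p j). r \<in> ?M \<longrightarrow> f r = 0"
        using that unfolding good_def not_frequently by eventually_elim blast
      then show "f (p j) = 0" using pM[of j] pX[of j] unfolding eventually_nhdsin by blast
    qed
    have flat: "\<forall>\<^sub>F j in sequentially. \<exists>(V, m, \<psi>)\<in>A. p j \<in> V \<and> chart_deriv X n \<psi> ?M \<tau> (p j) (\<lambda>_. 0)"
      using bad large
    proof eventually_elim
      case (elim j)
      \<comment> \<open>Otherwise the critical value would be 0, as \<open>f\<close> vanishes at
        \<open>p j\<close>, whereas it stays away from 0.\<close>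
      have "\<epsilon> j \<noteq> 0" using csp[of j] loc(1)[OF elim(1)] elim(2) by auto
      from perturbed_critical_flat[OF M f \<tau> p this loc(2,1)[OF elim(1)]] show ?case .
    qed
    obtain x where x: "x \<in> topspace X" "\<And>S. openin X S \<Longrightarrow> x \<in> S \<Longrightarrow> \<exists>\<^sub>F j in sequentially. p j \<in> S"
      using compact_space_cluster_point[where p = p, OF cX pX] by blast
    from mfd_interior_or_boundary[OF M x(1)] show False
    proof
      assume xM: "x \<in> ?M"
      obtain V m \<psi> where c: "(V, m, \<psi>) \<in> A" "x \<in> V" using mfd_chart_exists[OF M x(1)] by blast
      obtain d where d: "chart_deriv X n \<psi> (topspace X) \<tau> x d"
        using C_diff_mfd_chart_deriv[OF M \<tau>(1) _ c x(1)] by auto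
      have \<tau>x: "\<tau> x > 0" using \<tau>(2) xM by blast
      then have "\<forall>\<^sub>F r in nhdsin X x. r \<in> topspace X \<longrightarrow> \<bar>\<tau> r - \<tau> x\<bar> < \<tau> x / 2"
        by (intro chart_deriv_continuous[OF mfd_chart[OF M c(1)] c(2) d]) simp
      then obtain S where S: "openin X S" "x \<in> S" "\<And>r. r \<in> S \<Longrightarrow> r \<in> topspace X \<Longrightarrow> \<bar>\<tau> r - \<tau> x\<bar> < \<tau> x / 2"
        using x(1) unfolding eventually_nhdsin by blast
      \<comment> \<open>On \<open>S\<close> the function \<open>\<tau>\<close> exceeds half its
        value at \<open>x\<close>, so parameters below this bound give values smaller than half of
        \<open>\<bar>c\<bar>\<close>.\<close>
      define \<delta> where "\<delta> = \<bar>c\<bar> / 2 * (\<tau> x / 2)"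
      have "\<delta> > 0" using c0 \<tau>x by (simp add: \<delta>_def)
      then have "\<forall>\<^sub>F j in sequentially. dist (\<epsilon> j) 0 < \<delta>" using \<epsilon> unfolding tendsto_iff by blast
      with bad large have "\<forall>\<^sub>F j in sequentially. p j \<notin> S"
      proof eventually_elim
        case (elim j)
        show ?case
        proof
          assume "p j \<in> S"
          then have "\<bar>\<tau> (p j) - \<tau> x\<bar> < \<tau> x / 2" by (rule S(3)[OF _ pX])
          then have \<tau>j: "\<tau> x / 2 < \<tau> (p j)" by (simp only: abs_less_iff) linarith
          then have pos: "\<tau> (p j) > 0" using \<tau>x by linarith
          have "\<bar>c\<bar> / 2 < \<bar>\<epsilon> j\<bar> / \<tau> (p j)"
            using elim(2) csp[of j] loc(1)[OF elim(1)] pos by (simp add: abs_divide)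
          then have "\<bar>c\<bar> / 2 * \<tau> (p j) < \<bar>\<epsilon> j\<bar>" using pos by (simp add: pos_less_divide_eq)
          moreover have "\<bar>c\<bar> / 2 * (\<tau> x / 2) \<le> \<bar>c\<bar> / 2 * \<tau> (p j)" using \<tau>j by (intro mult_left_mono) auto
          ultimately show False using elim(3) by (simp add: \<delta>_def dist_real_def)
        qed
      qed
      then show False using x(2)[OF S(1,2)] unfolding frequently_def by simp
    next
      assume "x \<in> mfd_boundary n A"
      from boundary_function_not_flat[OF M bf this] obtain S where S: "openin X S" "x \<in> S"
        "\<forall>q\<in>S \<inter> ?M. \<forall>(V, m, \<psi>)\<in>A. q \<in> V \<longrightarrow> \<not> chart_deriv X n \<psi> ?M \<tau> q (\<lambda>_. 0)"
        by (elim exE conjE)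
      from flat have "\<forall>\<^sub>F j in sequentially. p j \<notin> S"
      proof eventually_elim
        case (elim j)
        show ?case
        proof
          assume "p j \<in> S"
          then have "p j \<in> S \<inter> ?M" using pM by blast
          from bspec[OF S(3) this] elim show False unfolding case_prod_beta by blast
        qed
      qed
      then show False using x(2)[OF S(1,2)] unfolding frequently_def by simp
    qed
  qed
qed

theorem proposition4p10:
  fixes n :: nat and X :: "'a topology" and A :: "'a chart set"
    and f fbar \<tau> :: "'a \<Rightarrow> real"
  assumes "compactification n X A f fbar \<tau>"
    and "locally_semialgebraic n X A f fbar"
  shows "finite (limit_critical_values n A f \<tau>) \<and>
         finite (boundary_critical_values n A fbar) \<and>
         finite_action_compactification n X A f fbar \<tau>"
proof -
  let ?M = "mfd_interior n A"
  have M: "manifold_with_corners n X A" and f: "C_diff_mfd \<infinity> n A ?M f"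
    and fb: "C_diff_mfd \<infinity> n A (topspace X) fbar" and bf: "boundary_function n X A \<tau>"
    and fbe: "\<forall>p\<in>?M. fbar p = \<tau> p * f p"
    using assms(1) by (auto simp: compactification_def)
  have \<tau>: "C_diff_mfd \<infinity> n A (topspace X) \<tau>" "\<forall>p\<in>?M. 0 < \<tau> p" using bf by (auto simp: boundary_function_def)
  obtain \<U> where \<U>: "finite \<U>" "\<And>U. U \<in> \<U> \<Longrightarrow> openin X U" "\<Union>\<U> = topspace X"
    and emb: "\<And>U. U \<in> \<U> \<Longrightarrow> \<exists>N \<phi>. C1_embedding n X A U N \<phi> \<and>
      semialgebraic_function N (\<phi> ` U) (\<lambda>x. fbar (inv_into U \<phi> x)) \<and>
      semialgebraic_function N (\<phi> ` (U \<inter> ?M)) (\<lambda>x. f (inv_into U \<phi> x))"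
    using assms(2) unfolding locally_semialgebraic_def nash_function_def by metis
  have bdry: "finite (fbar ` (U \<inter> (\<Union>k. critical_points n A k fbar)))" if U: "U \<in> \<U>" for U
    using emb[OF U] finite_stratified_critical_values[OF M \<U>(2)[OF U] _ _ fb] by blast
  have "boundary_critical_values n A fbar \<subseteq> (\<Union>U\<in>\<U>. fbar ` (U \<inter> (\<Union>k. critical_points n A k fbar)))"
  proof
    fix c assume "c \<in> boundary_critical_values n A fbar"
    then obtain k p where p: "p \<in> critical_points n A k fbar" "c = fbar p"
      unfolding boundary_critical_values_def critical_values_def by blast
    then have "p \<in> topspace X" using stratum_subset_topspace[OF M] by (auto simp: critical_points_def)
    then obtain U where "U \<in> \<U>" "p \<in> U" using \<U>(3) by blast
    then show "c \<in> (\<Union>U\<in>\<U>. fbar ` (U \<inter> (\<Union>k. critical_points n A k fbar)))" using p by blast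
  qed
  then have fin_b: "finite (boundary_critical_values n A fbar)"
    by (rule finite_subset) (use \<U>(1) bdry in blast)
  have Eex: "\<exists>E. finite (limit_values E) \<and> (\<forall>p \<epsilon>. p \<in> U \<longrightarrow> p \<in> critical_points n A 0 (\<lambda>p. f p + \<epsilon> / \<tau> p) \<longrightarrow>
      (\<exists>\<^sub>F r in nhdsin X p. r \<in> ?M \<and> f r \<noteq> 0) \<longrightarrow> f p + \<epsilon> / \<tau> p \<in> E \<epsilon>)" if U: "U \<in> \<U>" for U
  proof -
    obtain N \<phi> where e: "C1_embedding n X A U N \<phi>"
      "semialgebraic_function N (\<phi> ` (U \<inter> ?M)) (\<lambda>x. f (inv_into U \<phi> x))"
      "semialgebraic_function N (\<phi> ` U) (\<lambda>x. fbar (inv_into U \<phi> x))" using emb[OF U] by blast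
    show ?thesis
      by (rule perturbed_critical_values_cover[OF M \<U>(2)[OF U] e f \<tau> fbe]) blast
  qed
  have "\<exists>E. \<forall>U\<in>\<U>. finite (limit_values (E U)) \<and> (\<forall>p \<epsilon>. p \<in> U \<longrightarrow>
      p \<in> critical_points n A 0 (\<lambda>p. f p + \<epsilon> / \<tau> p) \<longrightarrow>
      (\<exists>\<^sub>F r in nhdsin X p. r \<in> ?M \<and> f r \<noteq> 0) \<longrightarrow> f p + \<epsilon> / \<tau> p \<in> E U \<epsilon>)"
    by (rule bchoice, rule ballI, rule Eex)
  then obtain E where E: "\<And>U. U \<in> \<U> \<Longrightarrow> finite (limit_values (E U))"
    "\<And>U p \<epsilon>. U \<in> \<U> \<Longrightarrow> p \<in> U \<Longrightarrow> p \<in> critical_points n A 0 (\<lambda>p. f p + \<epsilon> / \<tau> p) \<Longrightarrow>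
      \<exists>\<^sub>F r in nhdsin X p. r \<in> ?M \<and> f r \<noteq> 0 \<Longrightarrow> f p + \<epsilon> / \<tau> p \<in> E U \<epsilon>" by blast
  have "limit_critical_values n A f \<tau> \<subseteq> insert 0 (\<Union>U\<in>\<U>. limit_values (E U))"
    by (rule limit_critical_values_cover[OF assms(1) \<U>(1,3)]) (rule E(2))
  then have fin_l: "finite (limit_critical_values n A f \<tau>)"
    by (rule finite_subset) (use \<U>(1) E(1) in blast)
  \<comment> \<open>The other critical values form a finite, hence closed, set; its complement
    separates 0 from them.\<close>
  have "0 isolated_in boundary_critical_values n A fbar" if "0 \<in> boundary_critical_values n A fbar"
    unfolding isolated_in_def
  proof (intro conjI exI)
    show "open (- (boundary_critical_values n A fbar - {0}))"
      using fin_b by (intro open_Compl finite_imp_closed) simp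
  qed (use that in auto)
  then have "finite_action_compactification n X A f fbar \<tau>"
    unfolding finite_action_compactification_def
    using assms(1) finite_imp_bounded[OF fin_l] by blast
  then show ?thesis using fin_l fin_b by blast
qed

end
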